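(* Let $\mathcal{L}$ be a positive semi-definite linear operator from $L^\infty(\mathbb{T}^d)$ to $L^\infty(\mathbb{T}^d)$ with operator norm $\|\mathcal{L}\|$, and let $\phi$ be a solution on $\mathbb{T}^d$ of the general $L^2$ gradient flow dynamics $$\frac{\partial}{\partial t}\phi=\epsilon\Delta\phi-\frac1\epsilon W'(\phi)-\big[\mathcal{L}(f(\phi)-\omega)\big]f'(\phi)-\tilde M\Big(\int_{\mathbb{T}^d}(f(\phi)-\omega)\,dx\Big)f'(\phi),\qquad\phi(0,\cdot)=\phi_0,$$ where $\tilde M=M$ if the volume constraint $\int_{\mathbb{T}^d}(f(\phi)-\omega)\,dx=0$ is imposed (through the penalty term with constant $M$), and $\tilde M=0$ if there is no volume constraint. Suppose $$\frac{\epsilon\tilde\omega}{6}\Big[\|\mathcal{L}\|+\tilde M|\mathbb{T}^d|\Big]\le1 .$$ If $0\le\phi_0\le1$, then $0\le\phi(t)\le1$ for every $t>0$.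
   Context: $\mathbb{T}^d=\prod_{i=1}^d[-X_i,X_i]\subset\mathbb{R}^d$, $d=2,3$, is a periodic box, and all function spaces are periodic. The parameters are $\epsilon>0$, $M>0$, $\omega\in(0,1)$, $\tilde\omega=\max\{\omega,1-\omega\}$. $W(s)=18(s^2-s)^2$. $f$ is the extended nonlinearity: $f(s)=0$ for $s<0$, $f(s)=3s^2-2s^3$ for $0\le s\le1$, $f(s)=1$ for $s>1$. Positive semi-definiteness is with respect to the $L^2$ inner product. Solutions are global weak solutions: for every $T>0$, $\phi\in C([0,T];L^p(\mathbb{T}^d))\cap L^\infty(0,T;H^1(\mathbb{T}^d))\cap L^2(0,T;H^2(\mathbb{T}^d))$ for $p\in[2,6)$, $\phi(0,\cdot)=\phi_0$, and the equation holds when tested against any $w\in L^2(\mathbb{T}^d)$, with $\frac{d}{dt}\int_{\mathbb{T}^d}\phi w\,dx$ taken in the distributional sense in $(0,T)$. *)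

theory Defs
  imports "HOL-Analysis.Analysis" "HOL-Probability.Essential_Supremum"
begin

text \<open>Functions on the torus are represented by functions on the closed fundamental cell, up to
  equality almost everywhere (opposite faces are null sets). Periodicity enters through the test
  functions that define weak derivatives.\<close>

definition torus :: "real^'d \<Rightarrow> (real^'d) measure" where
  "torus X = lebesgue_on (cbox (- X) X)"

section \<open>Lebesgue spaces\<close>

definition Lp_space :: "real \<Rightarrow> 'a measure \<Rightarrow> ('a \<Rightarrow> real) set" where
  "Lp_space p M = {u \<in> borel_measurable M. integrable M (\<lambda>x. \<bar>u x\<bar> powr p)}"

definition Lp_norm :: "real \<Rightarrow> 'a measure \<Rightarrow> ('a \<Rightarrow> real) \<Rightarrow> real" where
  "Lp_norm p M u = (\<integral>x. \<bar>u x\<bar> powr p \<partial>M) powr (1 / p)"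

definition Linf_space :: "'a measure \<Rightarrow> ('a \<Rightarrow> real) set" where
  "Linf_space M = {u \<in> borel_measurable M. esssup M (\<lambda>x. ereal \<bar>u x\<bar>) < \<infinity>}"

definition Linf_norm :: "'a measure \<Rightarrow> ('a \<Rightarrow> real) \<Rightarrow> real" where
  "Linf_norm M u = real_of_ereal (esssup M (\<lambda>x. ereal \<bar>u x\<bar>))"

section \<open>Bounded operators on the space of essentially bounded functions\<close>

text \<open>All identities hold almost everywhere, since elements of the space are classes of functions;
  the last but one conjunct says that the operator is well defined on classes.\<close>

definition Linf_bounded_linear ::
    "'a measure \<Rightarrow> (('a \<Rightarrow> real) \<Rightarrow> ('a \<Rightarrow> real)) \<Rightarrow> bool" where
  "Linf_bounded_linear M L \<longleftrightarrow>
     (\<forall>u\<in>Linf_space M. L u \<in> Linf_space M) \<and>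
     (\<forall>u\<in>Linf_space M. \<forall>v\<in>Linf_space M. AE x in M. L (\<lambda>y. u y + v y) x = L u x + L v x) \<and>
     (\<forall>c. \<forall>u\<in>Linf_space M. AE x in M. L (\<lambda>y. c * u y) x = c * L u x) \<and>
     (\<forall>u\<in>Linf_space M. \<forall>v\<in>Linf_space M.
        (AE x in M. u x = v x) \<longrightarrow> (AE x in M. L u x = L v x)) \<and>
     (\<exists>K. \<forall>u\<in>Linf_space M. Linf_norm M (L u) \<le> K * Linf_norm M u)"

definition Linf_onorm :: "'a measure \<Rightarrow> (('a \<Rightarrow> real) \<Rightarrow> ('a \<Rightarrow> real)) \<Rightarrow> real" where
  "Linf_onorm M L = (SUP u\<in>Linf_space M. Linf_norm M (L u) / Linf_norm M u)"

definition L2_pos_semidef :: "'a measure \<Rightarrow> (('a \<Rightarrow> real) \<Rightarrow> ('a \<Rightarrow> real)) \<Rightarrow> bool" where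
  "L2_pos_semidef M L \<longleftrightarrow> (\<forall>u\<in>Linf_space M. 0 \<le> (\<integral>x. L u x * u x \<partial>M))"

section \<open>Periodic Sobolev spaces\<close>

text \<open>Infinitely often differentiable: differentiable everywhere, with all first partial
  derivatives again infinitely often differentiable (greatest fixed point).\<close>

coinductive smooth :: "('a::euclidean_space \<Rightarrow> real) \<Rightarrow> bool" where
  "(\<forall>x. u differentiable (at x)) \<Longrightarrow>
   (\<forall>b\<in>Basis. smooth (\<lambda>x. frechet_derivative u (at x) b)) \<Longrightarrow> smooth u"

definition partial_deriv :: "'d \<Rightarrow> (real^'d \<Rightarrow> real) \<Rightarrow> real^'d \<Rightarrow> real" where
  "partial_deriv i u x = frechet_derivative u (at x) (axis i 1)"

definition periodic :: "real^'d \<Rightarrow> (real^'d \<Rightarrow> real) \<Rightarrow> bool" where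
  "periodic X u \<longleftrightarrow> (\<forall>i x. u (x + axis i (2 * X $ i)) = u x)"

definition has_weak_partial ::
    "real^'d \<Rightarrow> 'd \<Rightarrow> (real^'d \<Rightarrow> real) \<Rightarrow> (real^'d \<Rightarrow> real) \<Rightarrow> bool" where
  "has_weak_partial X i u g \<longleftrightarrow>
     integrable (torus X) u \<and> integrable (torus X) g \<and>
     (\<forall>\<psi>. smooth \<psi> \<longrightarrow> periodic X \<psi> \<longrightarrow>
        (\<integral>x. u x * partial_deriv i \<psi> x \<partial>torus X) = - (\<integral>x. g x * \<psi> x \<partial>torus X))"

text \<open>Weak derivatives are unique almost everywhere, so the choice is immaterial.\<close>

definition weak_partial :: "real^'d \<Rightarrow> 'd \<Rightarrow> (real^'d \<Rightarrow> real) \<Rightarrow> real^'d \<Rightarrow> real" where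
  "weak_partial X i u = (SOME g. has_weak_partial X i u g)"

definition weak_laplacian :: "real^'d \<Rightarrow> (real^'d \<Rightarrow> real) \<Rightarrow> real^'d \<Rightarrow> real" where
  "weak_laplacian X u x = (\<Sum>i\<in>UNIV. weak_partial X i (weak_partial X i u) x)"

primrec Hk_space :: "nat \<Rightarrow> real^'d \<Rightarrow> (real^'d \<Rightarrow> real) set" where
  "Hk_space 0 X = Lp_space 2 (torus X)"
| "Hk_space (Suc k) X =
     {u \<in> Lp_space 2 (torus X). \<forall>i. \<exists>g\<in>Hk_space k X. has_weak_partial X i u g}"

primrec Hk_norm :: "nat \<Rightarrow> real^'d \<Rightarrow> (real^'d \<Rightarrow> real) \<Rightarrow> real" where
  "Hk_norm 0 X u = Lp_norm 2 (torus X) u"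
| "Hk_norm (Suc k) X u =
     sqrt ((Lp_norm 2 (torus X) u)\<^sup>2 + (\<Sum>i\<in>UNIV. (Hk_norm k X (weak_partial X i u))\<^sup>2))"

section \<open>Function spaces in time\<close>

definition C_Lp :: "real \<Rightarrow> real \<Rightarrow> 'a measure \<Rightarrow> (real \<Rightarrow> 'a \<Rightarrow> real) set" where
  "C_Lp T p M = {\<phi>. (\<forall>t\<in>{0..T}. \<phi> t \<in> Lp_space p M) \<and>
     (\<forall>t\<in>{0..T}. ((\<lambda>s. Lp_norm p M (\<lambda>x. \<phi> s x - \<phi> t x)) \<longlongrightarrow> 0) (at t within {0..T}))}"

text \<open>Bochner measurability on \<open>(0,T)\<close>: almost everywhere limit, in the norm \<open>N\<close>, of simple
  functions with values in the function space \<open>V\<close>.\<close>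

definition bochner_measurable ::
    "real \<Rightarrow> ('a \<Rightarrow> real) set \<Rightarrow> (('a \<Rightarrow> real) \<Rightarrow> real) \<Rightarrow> (real \<Rightarrow> 'a \<Rightarrow> real) \<Rightarrow> bool" where
  "bochner_measurable T V N \<phi> \<longleftrightarrow>
     (AE t in lebesgue_on {0<..<T}. \<phi> t \<in> V) \<and>
     (\<exists>s. (\<forall>n. simple_function (lebesgue_on {0<..<T}) (s n) \<and> (\<forall>t\<in>{0<..<T}. s n t \<in> V)) \<and>
          (AE t in lebesgue_on {0<..<T}. (\<lambda>n. N (\<lambda>x. \<phi> t x - s n t x)) \<longlonglongrightarrow> 0))"

definition Linf_Hk :: "real \<Rightarrow> nat \<Rightarrow> real^'d \<Rightarrow> (real \<Rightarrow> real^'d \<Rightarrow> real) set" where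
  "Linf_Hk T k X = {\<phi>. bochner_measurable T (Hk_space k X) (Hk_norm k X) \<phi> \<and>
     esssup (lebesgue_on {0<..<T}) (\<lambda>t. ereal (Hk_norm k X (\<phi> t))) < \<infinity>}"

definition L2_Hk :: "real \<Rightarrow> nat \<Rightarrow> real^'d \<Rightarrow> (real \<Rightarrow> real^'d \<Rightarrow> real) set" where
  "L2_Hk T k X = {\<phi>. bochner_measurable T (Hk_space k X) (Hk_norm k X) \<phi> \<and>
     integrable (lebesgue_on {0<..<T}) (\<lambda>t. (Hk_norm k X (\<phi> t))\<^sup>2)}"

definition test_function :: "real \<Rightarrow> (real \<Rightarrow> real) \<Rightarrow> bool" where
  "test_function T \<eta> \<longleftrightarrow> smooth \<eta> \<and>
     compact (closure {t. \<eta> t \<noteq> 0}) \<and> closure {t. \<eta> t \<noteq> 0} \<subseteq> {0<..<T}"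

text \<open>\<open>dG/dt = R\<close> in the distributional sense in \<open>(0,T)\<close>. The integrability conditions say that
  \<open>G\<close> and \<open>R\<close> are locally integrable, hence are distributions; without them a non-integrable
  product would be assigned the integral \<open>0\<close>.\<close>

definition distributional_deriv :: "real \<Rightarrow> (real \<Rightarrow> real) \<Rightarrow> (real \<Rightarrow> real) \<Rightarrow> bool" where
  "distributional_deriv T G R \<longleftrightarrow>
     (\<forall>\<eta>. test_function T \<eta> \<longrightarrow>
        integrable (lebesgue_on {0<..<T}) (\<lambda>t. G t * \<eta> t) \<and>
        integrable (lebesgue_on {0<..<T}) (\<lambda>t. R t * \<eta> t) \<and>
        - (\<integral>t. G t * deriv \<eta> t \<partial>lebesgue_on {0<..<T}) =
          (\<integral>t. R t * \<eta> t \<partial>lebesgue_on {0<..<T}))"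

section \<open>The gradient flow\<close>

definition W_pot :: "real \<Rightarrow> real" where
  "W_pot s = 18 * (s\<^sup>2 - s)\<^sup>2"

definition f_ext :: "real \<Rightarrow> real" where
  "f_ext s = (if s < 0 then 0 else if s \<le> 1 then 3 * s\<^sup>2 - 2 * s ^ 3 else 1)"

definition flow_rhs ::
    "real^'d \<Rightarrow> real \<Rightarrow> real \<Rightarrow> real \<Rightarrow> ((real^'d \<Rightarrow> real) \<Rightarrow> (real^'d \<Rightarrow> real)) \<Rightarrow>
     (real^'d \<Rightarrow> real) \<Rightarrow> real^'d \<Rightarrow> real" where
  "flow_rhs X \<epsilon> \<omega> Mt L u x =
     \<epsilon> * weak_laplacian X u x - 1 / \<epsilon> * deriv W_pot (u x)
     - L (\<lambda>y. f_ext (u y) - \<omega>) x * deriv f_ext (u x)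
     - Mt * (\<integral>y. (f_ext (u y) - \<omega>) \<partial>torus X) * deriv f_ext (u x)"

definition global_weak_solution ::
    "real^'d \<Rightarrow> real \<Rightarrow> real \<Rightarrow> real \<Rightarrow> ((real^'d \<Rightarrow> real) \<Rightarrow> (real^'d \<Rightarrow> real)) \<Rightarrow>
     (real^'d \<Rightarrow> real) \<Rightarrow> (real \<Rightarrow> real^'d \<Rightarrow> real) \<Rightarrow> bool" where
  "global_weak_solution X \<epsilon> \<omega> Mt L \<phi>0 \<phi> \<longleftrightarrow>
     (AE x in torus X. \<phi> 0 x = \<phi>0 x) \<and>
     (\<forall>T>0. (\<forall>p. 2 \<le> p \<and> p < 6 \<longrightarrow> \<phi> \<in> C_Lp T p (torus X)) \<and>
            \<phi> \<in> Linf_Hk T 1 X \<and> \<phi> \<in> L2_Hk T 2 X \<and>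
            (\<forall>w\<in>Lp_space 2 (torus X).
               distributional_deriv T (\<lambda>t. \<integral>x. \<phi> t x * w x \<partial>torus X)
                 (\<lambda>t. \<integral>x. flow_rhs X \<epsilon> \<omega> Mt L (\<phi> t) x * w x \<partial>torus X)))"

end

theory Submission
  imports Defs
begin

text \<open>Outside \<open>[0,1]\<close> the extended nonlinearity has \<open>f' = 0\<close>, so the nonlocal term and the penalty
  term vanish there; what remains is diffusion and the force \<open>- W' / \<epsilon>\<close>, and \<open>W'\<close> is positive
  above \<open>1\<close> and negative below \<open>0\<close>. Hence, for a convex \<open>H\<close> that vanishes on \<open>[0,1]\<close> and has the
  bounded Lipschitz derivative \<open>h\<close>, formally \<open>d/dt \<integral> H(\<phi>) = \<epsilon> \<integral> \<Delta>\<phi> h(\<phi>) - 1/\<epsilon> \<integral> W'(\<phi>) h(\<phi>) \<le> 0\<close>.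
  Choosing \<open>H\<close> positive exactly on \<open>s > 1\<close>, and then its reflection at \<open>1/2\<close>, gives the two
  bounds.

  Two steps of this computation have to be justified for weak solutions.

  Space: \<open>\<integral> \<Delta>u h(u) \<le> 0\<close> for \<open>u\<close> in \<open>H\<^sup>2\<close> (\<open>weak_laplacian_monotone\<close>). Instead of a chain rule
  for Sobolev functions, second differences are used. Let \<open>u\<^sub>k\<close> be the translate of \<open>u\<close> by \<open>k\<close> in
  a coordinate direction. Translation invariance of the torus gives \<open>\<integral> (u\<^sub>k - 2 u + u\<^sub>-\<^sub>k) h(u) =
  - \<integral> (u\<^sub>k - u) (h(u\<^sub>k) - h(u)) \<le> 0\<close> for monotone \<open>h\<close>. After division by \<open>k\<^sup>2\<close> the left-hand side
  tends to the integral of the second weak derivative times \<open>h(u)\<close>. This limit is taken by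
  approximating \<open>h(u)\<close> with uniformly bounded trigonometric polynomials, which are admissible
  test functions, and by continuity of translations in \<open>L\<^sup>1\<close>.

  Time: the equation is only tested with functions that do not depend on time
  (\<open>energy_nonincreasing\<close>). By convexity \<open>H(\<phi>(b)) - H(\<phi>(a)) \<le> h(\<phi>(b)) (\<phi>(b) - \<phi>(a))\<close>, and the
  integral of the right-hand side is the time integral over \<open>(a,b)\<close> of the flow tested with \<open>w =
  h(\<phi>(b))\<close>. Summing over a partition and refining it, the test function at time \<open>\<tau>\<close> tends to
  \<open>h(\<phi>(\<tau>))\<close>. Dominated convergence applies because the \<open>L\<^sup>1\<close> norm of the right-hand side is
  bounded by a constant plus a multiple of the squared \<open>H\<^sup>2\<close> norm. As \<open>h\<close> is bounded, this \<open>L\<^sup>1\<close>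
  bound suffices, and no Sobolev embedding is needed for the cubic \<open>W'\<close>.\<close>

section \<open>Convergence of integrals and derivatives\<close>

text \<open>Bounded functions that tend to zero in \<open>L\<^sup>1\<close> also tend to zero when weighted with a fixed
  integrable \<open>r\<close>: on \<open>{\<bar>r\<bar> \<le> m}\<close> the weight is bounded, and the tail of \<open>r\<close> is small.\<close>

lemma L1_null_times_integrable:
  fixes r :: "'a \<Rightarrow> real" and e :: "nat \<Rightarrow> 'a \<Rightarrow> real"
  assumes r: "integrable M r"
    and e: "\<And>n. integrable M (e n)"
    and B: "\<And>n. AE x in M. \<bar>e n x\<bar> \<le> B"
    and lim: "(\<lambda>n. \<integral>x. \<bar>e n x\<bar> \<partial>M) \<longlonglongrightarrow> 0"
  shows "(\<lambda>n. \<integral>x. r x * e n x \<partial>M) \<longlonglongrightarrow> 0"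
proof (rule LIMSEQ_I)
  fix \<eta> :: real assume \<eta>: "\<eta> > 0"
  define B' where "B' = \<bar>B\<bar> + 1"
  have B'pos: "B' > 0" by (simp add: B'_def)
  have BB: "AE x in M. \<bar>e n x\<bar> \<le> B'" for n
    using B[of n] by eventually_elim (simp add: B'_def)
  have [measurable]: "r \<in> borel_measurable M" "\<And>n. e n \<in> borel_measurable M"
    using r e by auto
  have "(\<lambda>m::nat. \<integral>x. (if \<bar>r x\<bar> > real m then \<bar>r x\<bar> else 0) \<partial>M) \<longlonglongrightarrow> (\<integral>x. 0 \<partial>M)"
  proof (rule integral_dominated_convergence[where w = "\<lambda>x. \<bar>r x\<bar>"])
    show "AE x in M. (\<lambda>m::nat. if \<bar>r x\<bar> > real m then \<bar>r x\<bar> else 0) \<longlonglongrightarrow> 0"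
    proof (rule AE_I2, rule tendsto_eventually)
      fix x
      obtain N :: nat where "\<bar>r x\<bar> \<le> real N" using real_arch_simple by blast
      then show "\<forall>\<^sub>F m::nat in sequentially. (if \<bar>r x\<bar> > real m then \<bar>r x\<bar> else 0) = 0"
        by (intro eventually_sequentiallyI[of N]) auto
    qed
  qed (use r in auto)
  then have "(\<lambda>m::nat. \<integral>x. (if \<bar>r x\<bar> > real m then \<bar>r x\<bar> else 0) \<partial>M) \<longlonglongrightarrow> 0"
    by simp
  from LIMSEQ_D[OF this, of "\<eta> / (2 * B')"] \<eta> B'pos obtain m :: nat
    where m: "norm ((\<integral>x. (if \<bar>r x\<bar> > real m then \<bar>r x\<bar> else 0) \<partial>M) - 0) < \<eta> / (2 * B')"
    by auto
  define K where "K = real m + 1"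
  have Kpos: "K > 0" by (simp add: K_def)
  from LIMSEQ_D[OF lim, of "\<eta> / (2 * K)"] \<eta> Kpos obtain N where
    N: "\<And>n. n \<ge> N \<Longrightarrow> norm ((\<integral>x. \<bar>e n x\<bar> \<partial>M) - 0) < \<eta> / (2 * K)"
    by auto
  have intm: "integrable M (\<lambda>x. if \<bar>r x\<bar> > real m then \<bar>r x\<bar> else 0)"
    by (rule Bochner_Integration.integrable_bound[OF r]) auto
  have "norm ((\<integral>x. r x * e n x \<partial>M) - 0) < \<eta>" if n: "n \<ge> N" for n
  proof -
    have ptw: "AE x in M. \<bar>r x * e n x\<bar> \<le> K * \<bar>e n x\<bar> + B' * (if \<bar>r x\<bar> > real m then \<bar>r x\<bar> else 0)"
      using BB[of n]
    proof eventually_elim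
      case (elim x)
      show ?case
      proof (cases "\<bar>r x\<bar> > real m")
        case True
        have "\<bar>r x * e n x\<bar> \<le> B' * \<bar>r x\<bar>"
          using elim by (simp add: abs_mult mult.commute[of B'] mult_left_mono)
        then show ?thesis using True Kpos by (simp add: add_increasing)
      next
        case False
        then show ?thesis
          by (auto simp: abs_mult K_def intro!: mult_right_mono)
      qed
    qed
    have "\<bar>\<integral>x. r x * e n x \<partial>M\<bar> \<le> (\<integral>x. \<bar>r x * e n x\<bar> \<partial>M)"
      by (rule integral_abs_bound)
    also have "\<dots> \<le> (\<integral>x. K * \<bar>e n x\<bar> + B' * (if \<bar>r x\<bar> > real m then \<bar>r x\<bar> else 0) \<partial>M)"
      by (rule integral_mono_AE') (use ptw intm e[of n] in auto)
    also have "\<dots> = K * (\<integral>x. \<bar>e n x\<bar> \<partial>M) + B' * (\<integral>x. (if \<bar>r x\<bar> > real m then \<bar>r x\<bar> else 0) \<partial>M)"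
      using intm e[of n] by (subst Bochner_Integration.integral_add) auto
    also have "\<dots> < K * (\<eta> / (2 * K)) + B' * (\<eta> / (2 * B'))"
      by (intro add_strict_mono mult_strict_left_mono) (use N[OF n] m Kpos B'pos in auto)
    also have "\<dots> = \<eta>" using Kpos B'pos by (simp add: field_simps)
    finally show ?thesis by simp
  qed
  then show "\<exists>N. \<forall>n\<ge>N. norm ((\<integral>x. r x * e n x \<partial>M) - 0) < \<eta>" by blast
qed

lemma L2_null_imp_L1_null:
  fixes d :: "nat \<Rightarrow> 'a \<Rightarrow> real"
  assumes fin: "finite_measure M"
    and meas: "\<And>n. d n \<in> borel_measurable M"
    and sq: "\<And>n. integrable M (\<lambda>x. (d n x)\<^sup>2)"
    and lim: "(\<lambda>n. \<integral>x. (d n x)\<^sup>2 \<partial>M) \<longlonglongrightarrow> 0"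
  shows "(\<lambda>n. \<integral>x. \<bar>d n x\<bar> \<partial>M) \<longlonglongrightarrow> 0"
proof (rule LIMSEQ_I)
  interpret finite_measure M by fact
  fix \<eta> :: real assume \<eta>: "\<eta> > 0"
  define V where "V = measure M (space M) + 1"
  have V: "V > 0" by (simp add: V_def add_nonneg_pos)
  define \<delta> where "\<delta> = \<eta> / V"
  have \<delta>: "\<delta> > 0" using V \<eta> by (simp add: \<delta>_def)
  from LIMSEQ_D[OF lim, of "\<delta> * \<eta>"] \<delta> \<eta> obtain N where
    N: "\<And>n. n \<ge> N \<Longrightarrow> norm ((\<integral>x. (d n x)\<^sup>2 \<partial>M) - 0) < \<delta> * \<eta>" by auto
  have "norm ((\<integral>x. \<bar>d n x\<bar> \<partial>M) - 0) < \<eta>" if n: "n \<ge> N" for n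
  proof -
    have "(\<integral>x. \<bar>d n x\<bar> \<partial>M) \<le> (\<integral>x. \<delta> / 2 + (1 / (2 * \<delta>)) * (d n x)\<^sup>2 \<partial>M)"
    proof (rule integral_mono')
      show "integrable M (\<lambda>x. \<delta> / 2 + (1 / (2 * \<delta>)) * (d n x)\<^sup>2)" using sq by simp
      fix x
      have "0 \<le> (\<bar>d n x\<bar> - \<delta>)\<^sup>2" by simp
      then have "2 * \<delta> * \<bar>d n x\<bar> \<le> \<delta>\<^sup>2 + (d n x)\<^sup>2"
        by (simp add: power2_diff algebra_simps)
      then show "\<bar>d n x\<bar> \<le> \<delta> / 2 + (1 / (2 * \<delta>)) * (d n x)\<^sup>2"
        using \<delta> by (simp add: field_simps power2_eq_square)
      then show "0 \<le> \<delta> / 2 + (1 / (2 * \<delta>)) * (d n x)\<^sup>2"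
        using \<delta> by simp
    qed
    also have "\<dots> = (V - 1) * \<delta> / 2 + (1 / (2 * \<delta>)) * (\<integral>x. (d n x)\<^sup>2 \<partial>M)"
      using sq by (simp add: V_def)
    also have "\<dots> < V * \<delta> / 2 + (1 / (2 * \<delta>)) * (\<delta> * \<eta>)"
    proof (rule add_strict_mono)
      show "(V - 1) * \<delta> / 2 < V * \<delta> / 2" using \<delta> by (simp add: algebra_simps)
      show "(1 / (2 * \<delta>)) * (\<integral>x. (d n x)\<^sup>2 \<partial>M) < (1 / (2 * \<delta>)) * (\<delta> * \<eta>)"
        by (rule mult_strict_left_mono) (use N[OF n] \<delta> in auto)
    qed
    also have "\<dots> = \<eta>" using \<delta> V by (simp add: \<delta>_def field_simps)
    finally show ?thesis by simp
  qed
  then show "\<exists>N. \<forall>n\<ge>N. norm ((\<integral>x. \<bar>d n x\<bar> \<partial>M) - 0) < \<eta>" by blast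
qed

lemma DERIV_zero_of_quadratic_bound:
  fixes f :: "real \<Rightarrow> real"
  assumes "\<And>x. \<bar>f x - f a\<bar> \<le> C * (x - a)\<^sup>2"
  shows "(f has_real_derivative 0) (at a)"
  unfolding has_field_derivative_iff
proof (rule tendsto_rabs_zero_cancel, rule tendsto_sandwich[OF _ _ tendsto_const])
  show "\<forall>\<^sub>F x in at a. \<bar>(f x - f a) / (x - a)\<bar> \<le> C * \<bar>x - a\<bar>"
    unfolding eventually_at_filter
  proof (intro always_eventually allI impI)
    fix x assume "x \<noteq> a"
    then have "\<bar>x - a\<bar> > 0" by simp
    then show "\<bar>(f x - f a) / (x - a)\<bar> \<le> C * \<bar>x - a\<bar>"
      using assms[of x] by (simp add: abs_divide divide_le_eq power2_eq_square mult.assoc flip: abs_mult)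
  qed
  have "((\<lambda>x. C * \<bar>x - a\<bar>) \<longlongrightarrow> C * \<bar>a - a\<bar>) (at a)" by (intro tendsto_intros)
  then show "((\<lambda>x. C * \<bar>x - a\<bar>) \<longlongrightarrow> 0) (at a)" by simp
qed auto

section \<open>Trigonometric polynomials on the torus\<close>

text \<open>Angular frequency of the basic \<open>2 X\<^sub>i\<close>-periodic oscillations in the \<open>i\<close>-th coordinate.\<close>

definition freq :: "real^'d \<Rightarrow> 'd \<Rightarrow> real" where
  "freq X i = pi / X $ i"

text \<open>Trigonometric polynomials on the torus, as the algebra generated by the constants and the basic
  sines and cosines. In this form closure under products, translations and partial derivatives
  follows by induction.\<close>

inductive trig_poly :: "real^'d \<Rightarrow> (real^'d \<Rightarrow> real) \<Rightarrow> bool" for X where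
  trig_poly_const: "trig_poly X (\<lambda>x. c)"
| trig_poly_cos: "trig_poly X (\<lambda>x. cos (freq X i * x $ i))"
| trig_poly_sin: "trig_poly X (\<lambda>x. sin (freq X i * x $ i))"
| trig_poly_add: "trig_poly X u \<Longrightarrow> trig_poly X v \<Longrightarrow> trig_poly X (\<lambda>x. u x + v x)"
| trig_poly_mult: "trig_poly X u \<Longrightarrow> trig_poly X v \<Longrightarrow> trig_poly X (\<lambda>x. u x * v x)"

lemma trig_poly_cmul: "trig_poly X u \<Longrightarrow> trig_poly X (\<lambda>x. c * u x)"
  by (rule trig_poly_mult[OF trig_poly_const])

lemma trig_poly_sum:
  "finite I \<Longrightarrow> (\<And>i. i \<in> I \<Longrightarrow> trig_poly X (u i)) \<Longrightarrow> trig_poly X (\<lambda>x. \<Sum>i\<in>I. u i x)"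
  by (induction I rule: finite_induct) (simp_all add: trig_poly_const trig_poly_add)

lemma trig_poly_continuous: "trig_poly X u \<Longrightarrow> continuous_on S u"
  by (induction rule: trig_poly.induct) (auto intro!: continuous_intros)

lemma trig_poly_bounded:
  assumes "trig_poly X u" shows "\<exists>B. \<forall>x. \<bar>u x\<bar> \<le> B"
  using assms
proof induction
  case (trig_poly_const c)
  show ?case by (rule exI[of _ "\<bar>c\<bar>"]) simp
next
  case (trig_poly_add u v)
  then obtain A B where A: "\<And>x. \<bar>u x\<bar> \<le> A" and B: "\<And>x. \<bar>v x\<bar> \<le> B" by auto
  have "\<bar>u x + v x\<bar> \<le> A + B" for x using A[of x] B[of x] by linarith
  then show ?case by auto
next
  case (trig_poly_mult u v)
  then obtain A B where A: "\<And>x. \<bar>u x\<bar> \<le> A" and B: "\<And>x. \<bar>v x\<bar> \<le> B" by auto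
  have "\<bar>u x * v x\<bar> \<le> A * B" for x
    unfolding abs_mult using A[of x] B[of x] by (intro mult_mono) linarith+
  then show ?case by auto
qed (auto intro: exI[of _ 1])

lemma trig_poly_periodic:
  assumes X: "\<And>i. X $ i \<noteq> 0" and "trig_poly X u"
  shows "periodic X u"
proof -
  have *: "freq X i * (x + axis j (2 * X $ j)) $ i = freq X i * x $ i + (if i = j then 2 * pi else 0)"
    for i j and x :: "real^'a"
    using X[of i] by (auto simp: axis_def field_simps freq_def)
  show ?thesis
    using assms(2) unfolding periodic_def
    by induction (simp_all only: *, simp_all)
qed

lemma trig_poly_shift:
  assumes "trig_poly X u" shows "trig_poly X (\<lambda>x. u (x + a))"
  using assms
proof induction
  case (trig_poly_cos i)
  have "trig_poly X (\<lambda>x. cos (freq X i * a $ i) * cos (freq X i * x $ i)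
      + (- sin (freq X i * a $ i)) * sin (freq X i * x $ i))"
    by (simp only: trig_poly.intros)
  then show ?case by (simp add: distrib_left cos_add mult.commute)
next
  case (trig_poly_sin i)
  have "trig_poly X (\<lambda>x. cos (freq X i * a $ i) * sin (freq X i * x $ i)
      + sin (freq X i * a $ i) * cos (freq X i * x $ i))"
    by (simp only: trig_poly.intros)
  then show ?case by (simp add: distrib_left sin_add mult.commute)
qed (simp_all add: trig_poly.intros)

text \<open>The coefficients \<open>D j\<close> are the partial derivatives; as they lie in the same algebra, the
  coinductive smoothness predicate follows at once.\<close>

lemma trig_poly_has_derivative:
  assumes "trig_poly X u"
  shows "\<exists>D. (\<forall>j. trig_poly X (D j)) \<and>
    (\<forall>x. (u has_derivative (\<lambda>v. \<Sum>j\<in>UNIV. v $ j * D j x)) (at x))"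
  using assms
proof induction
  case (trig_poly_const c)
  show ?case by (rule exI[of _ "\<lambda>j x. 0"]) (simp, rule trig_poly.trig_poly_const)
next
  case (trig_poly_cos i)
  let ?D = "\<lambda>j x. if j = i then (- freq X i) * sin (freq X i * x $ i) else 0"
  have "trig_poly X (?D j)" for j
    by (cases "j = i") (simp_all only: simp_thms if_True if_False trig_poly_const trig_poly_cmul[OF trig_poly.trig_poly_sin])
  moreover have "((\<lambda>x. cos (freq X i * x $ i)) has_derivative (\<lambda>v. \<Sum>j\<in>UNIV. v $ j * ?D j x)) (at x)" for x
    by (auto intro!: derivative_eq_intros bounded_linear_imp_has_derivative simp: bounded_linear_vec_nth if_distrib[where f="\<lambda>y. _ * y"] sum.delta cong: if_cong)
  ultimately show ?case by (intro exI[of _ ?D]) blast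
next
  case (trig_poly_sin i)
  let ?D = "\<lambda>j x. if j = i then freq X i * cos (freq X i * x $ i) else 0"
  have "trig_poly X (?D j)" for j
    by (cases "j = i") (simp_all add: trig_poly_const trig_poly_cmul[OF trig_poly.trig_poly_cos])
  moreover have "((\<lambda>x. sin (freq X i * x $ i)) has_derivative (\<lambda>v. \<Sum>j\<in>UNIV. v $ j * ?D j x)) (at x)" for x
    by (auto intro!: derivative_eq_intros bounded_linear_imp_has_derivative simp: bounded_linear_vec_nth if_distrib[where f="\<lambda>y. _ * y"] sum.delta cong: if_cong)
  ultimately show ?case by (intro exI[of _ ?D]) blast
next
  case (trig_poly_add u v)
  then obtain D E where D: "\<forall>j. trig_poly X (D j)" "\<forall>x. (u has_derivative (\<lambda>v. \<Sum>j\<in>UNIV. v $ j * D j x)) (at x)"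
    and E: "\<forall>j. trig_poly X (E j)" "\<forall>x. (v has_derivative (\<lambda>v. \<Sum>j\<in>UNIV. v $ j * E j x)) (at x)"
    by blast
  show ?case
  proof (intro exI[of _ "\<lambda>j x. D j x + E j x"] conjI allI)
    show "((\<lambda>x. u x + v x) has_derivative (\<lambda>v. \<Sum>j\<in>UNIV. v $ j * (D j x + E j x))) (at x)" for x
      using has_derivative_add[OF D(2)[rule_format] E(2)[rule_format]]
      by (simp add: distrib_left sum.distrib)
  qed (use D E in \<open>simp add: trig_poly.trig_poly_add\<close>)
next
  case (trig_poly_mult u v)
  then obtain D E where D: "\<forall>j. trig_poly X (D j)" "\<forall>x. (u has_derivative (\<lambda>v. \<Sum>j\<in>UNIV. v $ j * D j x)) (at x)"
    and E: "\<forall>j. trig_poly X (E j)" "\<forall>x. (v has_derivative (\<lambda>v. \<Sum>j\<in>UNIV. v $ j * E j x)) (at x)"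
    by blast
  show ?case
  proof (intro exI[of _ "\<lambda>j x. u x * E j x + D j x * v x"] conjI allI)
    show "((\<lambda>x. u x * v x) has_derivative (\<lambda>w. \<Sum>j\<in>UNIV. w $ j * (u x * E j x + D j x * v x))) (at x)" for x
      by (rule has_derivative_eq_rhs[OF has_derivative_mult[OF D(2)[rule_format] E(2)[rule_format]]])
         (simp add: fun_eq_iff distrib_left sum.distrib sum_distrib_left mult_ac)
  qed (use D E trig_poly_mult in \<open>simp add: trig_poly.trig_poly_add trig_poly.trig_poly_mult\<close>)
qed

lemma trig_poly_differentiable: "trig_poly X u \<Longrightarrow> u differentiable (at x)"
  using trig_poly_has_derivative unfolding differentiable_def by fast

lemma trig_poly_frechet_derivative:
  assumes "trig_poly X u"
  shows "trig_poly X (\<lambda>x. frechet_derivative u (at x) b)"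
proof -
  from trig_poly_has_derivative[OF assms] obtain D where D: "\<forall>j. trig_poly X (D j)"
    "\<forall>x. (u has_derivative (\<lambda>v. \<Sum>j\<in>UNIV. v $ j * D j x)) (at x)" by blast
  have "(\<lambda>x. frechet_derivative u (at x) b) = (\<lambda>x. \<Sum>j\<in>UNIV. b $ j * D j x)"
    using frechet_derivative_at[OF D(2)[rule_format]] by (auto simp: fun_eq_iff)
  then show ?thesis using D by (simp add: trig_poly_sum trig_poly_cmul)
qed

lemma trig_poly_partial_deriv: "trig_poly X u \<Longrightarrow> trig_poly X (partial_deriv i u)"
  using trig_poly_frechet_derivative[of X u "axis i 1"] by (simp add: partial_deriv_def[abs_def])

lemma trig_poly_smooth:
  assumes "trig_poly X u" shows "smooth u"
  using assms
  by (coinduction arbitrary: u)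
     (use trig_poly_differentiable trig_poly_frechet_derivative in blast)

lemma partial_deriv_shift:
  assumes "\<psi> differentiable (at (x + a))"
  shows "partial_deriv i (\<lambda>x. \<psi> (x + a)) x = partial_deriv i \<psi> (x + a)"
proof -
  have "((\<lambda>x. x + a) has_derivative (\<lambda>v. v)) (at x)" by (auto intro!: derivative_eq_intros)
  from has_derivative_compose[OF this, of \<psi> "frechet_derivative \<psi> (at (x + a))"] assms
  have "((\<lambda>x. \<psi> (x + a)) has_derivative frechet_derivative \<psi> (at (x + a))) (at x)"
    by (simp add: frechet_derivative_works)
  from frechet_derivative_at[OF this] show ?thesis by (simp add: partial_deriv_def)
qed

lemma partial_deriv_line:
  assumes "\<psi> differentiable (at (x + s *\<^sub>R axis i 1))"
  shows "((\<lambda>s. \<psi> (x + s *\<^sub>R axis i 1)) has_real_derivative partial_deriv i \<psi> (x + s *\<^sub>R axis i 1)) (at s)"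
proof -
  have 1: "((\<lambda>s. x + s *\<^sub>R axis i 1) has_derivative (\<lambda>t. t *\<^sub>R axis i 1)) (at s)"
    by (auto intro!: derivative_eq_intros)
  have 2: "(\<psi> has_derivative frechet_derivative \<psi> (at (x + s *\<^sub>R axis i 1))) (at (x + s *\<^sub>R axis i 1))"
    using assms by (simp add: frechet_derivative_works)
  have "linear (frechet_derivative \<psi> (at (x + s *\<^sub>R axis i 1)))"
    using linear_frechet_derivative[OF assms] .
  then show ?thesis
    using has_derivative_compose[OF 1 2]
    by (simp add: has_field_derivative_def partial_deriv_def linear_cmul mult_commute_abs)
qed

text \<open>Second-order Taylor estimate, uniform in the base point because the second partial derivative
  is bounded.\<close>

lemma trig_poly_taylor:
  assumes "trig_poly X \<psi>"
  shows "\<exists>C. \<forall>x s. \<bar>\<psi> (x + s *\<^sub>R axis i 1) - \<psi> x - s * partial_deriv i \<psi> x\<bar> \<le> C * s\<^sup>2"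
proof -
  let ?p1 = "partial_deriv i \<psi>" and ?p2 = "partial_deriv i (partial_deriv i \<psi>)"
  have t1: "trig_poly X ?p1" and t2: "trig_poly X ?p2" using assms by (simp_all only: trig_poly_partial_deriv)
  obtain C where C: "\<And>x. \<bar>?p2 x\<bar> \<le> C" using trig_poly_bounded[OF t2] by blast
  have L1: "\<bar>?p1 (x + s *\<^sub>R axis i 1) - ?p1 x\<bar> \<le> C * \<bar>s\<bar>" for x s
  proof -
    have "norm (?p1 (x + s *\<^sub>R axis i 1) - ?p1 (x + 0 *\<^sub>R axis i 1)) \<le> C * norm (s - 0)"
      by (rule field_differentiable_bound[where S=UNIV and f'="\<lambda>s. ?p2 (x + s *\<^sub>R axis i 1)"
            and f = "\<lambda>s. ?p1 (x + s *\<^sub>R axis i 1)"])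
         (use C partial_deriv_line[OF trig_poly_differentiable[OF t1]] in auto)
    then show ?thesis by simp
  qed
  have "\<bar>\<psi> (x + s *\<^sub>R axis i 1) - \<psi> x - s * ?p1 x\<bar> \<le> C * s\<^sup>2" for x s
  proof -
    let ?f = "\<lambda>r. \<psi> (x + r *\<^sub>R axis i 1) - r * ?p1 x"
    let ?S = "closed_segment 0 s"
    have "norm (?f s - ?f 0) \<le> (C * \<bar>s\<bar>) * norm (s - 0)"
    proof (rule field_differentiable_bound[where S="?S" and f'="\<lambda>r. ?p1 (x + r *\<^sub>R axis i 1) - ?p1 x" and f = ?f])
      fix r assume r: "r \<in> ?S"
      show "(?f has_field_derivative ?p1 (x + r *\<^sub>R axis i 1) - ?p1 x) (at r within ?S)"
        by (auto intro!: derivative_eq_intros DERIV_subset[OF partial_deriv_line[OF trig_poly_differentiable[OF assms]]])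
      have "\<bar>r\<bar> \<le> \<bar>s\<bar>" using r by (auto simp: closed_segment_eq_real_ivl split: if_splits)
      moreover have "0 \<le> C" using C[of 0] by linarith
      ultimately show "norm (?p1 (x + r *\<^sub>R axis i 1) - ?p1 x) \<le> C * \<bar>s\<bar>"
        using L1[of x r] by (smt (verit) mult_left_mono real_norm_def)
    qed auto
    then show ?thesis by (simp add: power2_eq_square mult.assoc)
  qed
  then show ?thesis by blast
qed

section \<open>Density of trigonometric polynomials\<close>

lemma space_torus [simp]: "space (torus X) = cbox (- X) X"
  by (simp add: torus_def)

lemma finite_measure_torus: "finite_measure (torus X)"
  unfolding torus_def by (rule finite_measure_lebesgue_on) simp

lemma AE_torus_D: "AE x in torus X. P x \<Longrightarrow> AE x in lebesgue. x \<in> cbox (- X) X \<longrightarrow> P x"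
  unfolding torus_def by (subst (asm) AE_restrict_space_iff) auto

lemma AE_torus_box: "AE x in torus X. x \<in> box (- X) X"
proof -
  have "AE x in lebesgue. x \<notin> cbox (- X) X - box (- X) X"
    using AE_not_in[of "cbox (- X) X - box (- X) X" lebesgue] negligible_frontier_interval[of "- X" X]
    by (simp add: negligible_iff_null_sets)
  then show ?thesis
    unfolding torus_def by (subst AE_restrict_space_iff) (auto elim: eventually_mono)
qed

lemma AE_torus_negligible: "negligible N \<Longrightarrow> AE x in torus X. x \<notin> N"
  unfolding torus_def
  by (subst AE_restrict_space_iff)
     (auto dest!: AE_not_in simp: negligible_iff_null_sets elim: eventually_mono)

lemma torus_not_null: "(\<And>i. X $ i > 0) \<Longrightarrow> \<not> (AE x in torus X. False)"
proof
  assume X: "\<And>i. X $ i > 0" and "AE x in torus X. False"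
  from AE_torus_D[OF this(2)] have "AE x in lebesgue. x \<notin> box (- X) X"
  proof eventually_elim
    case (elim x) then show ?case using box_subset_cbox[of "- X" X] by auto
  qed
  then have "negligible (box (- X) X)"
    by (simp add: negligible_iff_null_sets AE_iff_null_sets[symmetric])
  moreover have "0 \<in> box (- X) X" using X by (auto simp: mem_box_cart)
  ultimately show False using open_not_negligible[of "box (- X) X"] by auto
qed

lemma borel_measurable_torus: "continuous_on UNIV f \<Longrightarrow> f \<in> borel_measurable (torus X)"
  for f :: "real^'d \<Rightarrow> real"
  unfolding torus_def
  by (rule continuous_imp_measurable_on_sets_lebesgue) (auto intro: continuous_on_subset)

lemma integrable_torus_bounded:
  assumes "f \<in> borel_measurable (torus X)" "AE x in torus X. \<bar>f x\<bar> \<le> B"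
  shows "integrable (torus X) (f :: _ \<Rightarrow> real)"
  by (rule finite_measure.integrable_const_bound[OF finite_measure_torus, where B=B]) (use assms in auto)

lemma trig_poly_measurable: "trig_poly X u \<Longrightarrow> u \<in> borel_measurable (torus X)"
  by (rule borel_measurable_torus[OF trig_poly_continuous])

lemma trig_poly_integrable:
  assumes "trig_poly X u" shows "integrable (torus X) u"
proof -
  obtain B where "\<And>x. \<bar>u x\<bar> \<le> B" using trig_poly_bounded[OF assms] by auto
  then show ?thesis by (intro integrable_torus_bounded[where B=B] trig_poly_measurable assms) auto
qed

lemma integrable_times_bounded:
  assumes "integrable M r" "w \<in> borel_measurable M" "AE x in M. \<bar>w x\<bar> \<le> B"
  shows "integrable M (\<lambda>x. r x * w x :: real)"
proof -
  have "integrable M (\<lambda>x. B * r x)" using assms(1) by simp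
  then show ?thesis
  proof (rule Bochner_Integration.integrable_bound)
    show "AE x in M. norm (r x * w x) \<le> norm (B * r x)"
      using assms(3)
    proof eventually_elim
      case (elim x)
      then have "\<bar>w x\<bar> * \<bar>r x\<bar> \<le> \<bar>B\<bar> * \<bar>r x\<bar>" by (intro mult_right_mono) auto
      then show ?case by (simp add: abs_mult mult.commute)
    qed
  qed (use assms in auto)
qed

lemma integrable_times_trig_poly:
  assumes "integrable (torus X) f" "trig_poly X u" shows "integrable (torus X) (\<lambda>x. f x * u x)"
proof -
  obtain B where "\<And>x. \<bar>u x\<bar> \<le> B" using trig_poly_bounded[OF assms(2)] by auto
  then show ?thesis by (intro integrable_times_bounded[where B=B] trig_poly_measurable assms) auto
qed

text \<open>The embedding of the torus into Euclidean space. On the cell it identifies only boundary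
  points, so that the Weierstrass theorem for polynomials on its image yields trigonometric
  polynomials.\<close>

definition torus_embed :: "real^'d \<Rightarrow> real^'d \<Rightarrow> (real^'d) \<times> (real^'d)" where
  "torus_embed X x = (\<chi> i. cos (freq X i * x $ i), \<chi> i. sin (freq X i * x $ i))"

lemma continuous_on_torus_embed: "continuous_on S (torus_embed X)"
  unfolding torus_embed_def by (intro continuous_intros)

lemma torus_embed_fibre:
  assumes X: "\<And>i. X $ i > 0" and x: "x \<in> cbox (- X) X" and y: "y \<in> cbox (- X) X"
    and eq: "torus_embed X x = torus_embed X y" and ne: "x \<noteq> y"
  shows "x \<notin> box (- X) X"
proof -
  obtain i where i: "x $ i \<noteq> y $ i" using ne by (auto simp: vec_eq_iff)
  let ?a = "freq X i * x $ i" and ?b = "freq X i * y $ i"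
  have "cos ?a = cos ?b" "sin ?a = sin ?b"
    using eq by (auto simp: torus_embed_def vec_eq_iff)
  then obtain n :: int where n: "?a = ?b + 2 * pi * n"
    using sin_cos_eq_iff[of ?a ?b] by auto
  have Xi: "X $ i > 0" by fact
  have "pi * x $ i = pi * (y $ i + 2 * X $ i * n)"
    using n Xi by (simp add: freq_def field_simps)
  then have xy: "x $ i = y $ i + 2 * X $ i * n" by simp
  then have "n \<noteq> 0" using i by auto
  then have "2 * X $ i \<le> 2 * X $ i * \<bar>real_of_int n\<bar>" using Xi by simp
  also have "\<dots> = \<bar>x $ i - y $ i\<bar>" using xy Xi by (simp add: abs_mult)
  finally have "2 * X $ i \<le> \<bar>x $ i - y $ i\<bar>" .
  moreover have "\<bar>x $ i\<bar> \<le> X $ i" "\<bar>y $ i\<bar> \<le> X $ i"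
    using x y by (auto simp: mem_box_cart abs_le_iff minus_le_iff)
  ultimately have "\<bar>x $ i\<bar> = X $ i" by linarith
  then show ?thesis by (auto simp: mem_box_cart abs_if split: if_splits intro!: exI[of _ i])
qed

lemma trig_poly_polynomial:
  assumes "real_polynomial_function p"
  shows "trig_poly X (\<lambda>x. p (torus_embed X x))"
  using assms
proof induction
  case (linear f)
  then have lin: "linear f" by (simp add: bounded_linear.linear)
  have *: "f (torus_embed X x) = (\<Sum>j\<in>Basis. f j * (torus_embed X x \<bullet> j))" for x
  proof -
    have "f (torus_embed X x) = f (\<Sum>j\<in>Basis. (torus_embed X x \<bullet> j) *\<^sub>R j)"
      by (simp add: euclidean_representation)
    also have "\<dots> = (\<Sum>j\<in>Basis. f j * (torus_embed X x \<bullet> j))"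
      using lin by (simp add: linear_sum linear_cmul mult.commute)
    finally show ?thesis .
  qed
  have "trig_poly X (\<lambda>x. torus_embed X x \<bullet> j)" if "j \<in> Basis" for j
    using that trig_poly_cos[of X] trig_poly_sin[of X]
    by (auto simp: Basis_prod_def torus_embed_def Basis_vec_def inner_axis)
  then show ?case unfolding * by (intro trig_poly_sum trig_poly_cmul) auto
next
  case (const c) show ?case by (rule trig_poly_const)
next
  case (add f g) then show ?case by (intro trig_poly_add)
next
  case (mult f g) then show ?case by (intro trig_poly_mult)
qed

text \<open>Vanishing on the boundary makes \<open>c\<close> constant on the fibres of the embedding. It descends to a
  function \<open>F\<close> on the image, which is continuous since closed subsets of the compact cell have
  closed images.\<close>

lemma trig_poly_uniform_approx:
  fixes c :: "real^'d \<Rightarrow> real"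
  assumes X: "\<And>i. X $ i > 0" and c: "continuous_on (cbox (- X) X) c"
    and c0: "\<And>x. x \<in> cbox (- X) X - box (- X) X \<Longrightarrow> c x = 0" and \<eta>: "\<eta> > 0"
  shows "\<exists>\<psi>. trig_poly X \<psi> \<and> (\<forall>x\<in>cbox (- X) X. \<bar>c x - \<psi> x\<bar> < \<eta>)"
proof -
  let ?Q = "cbox (- X) X" and ?S = "torus_embed X ` cbox (- X) X"
  define F where "F y = c (SOME x. x \<in> ?Q \<and> torus_embed X x = y)" for y
  have F: "F (torus_embed X x) = c x" if x: "x \<in> ?Q" for x
  proof -
    define z where "z = (SOME z. z \<in> ?Q \<and> torus_embed X z = torus_embed X x)"
    have z: "z \<in> ?Q" "torus_embed X z = torus_embed X x"
      unfolding z_def using someI[of "\<lambda>z. z \<in> ?Q \<and> torus_embed X z = torus_embed X x" x] x by auto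
    have "c z = c x"
    proof (cases "z = x")
      case False
      then have "x \<notin> box (- X) X" "z \<notin> box (- X) X"
        using torus_embed_fibre[OF X, of x z] torus_embed_fibre[OF X, of z x] x z by auto
      then show ?thesis using c0 x z by simp
    qed simp
    then show ?thesis by (simp add: F_def z_def)
  qed
  have S: "compact ?S"
    by (intro compact_continuous_image continuous_on_torus_embed) simp
  have contF: "continuous_on ?S F"
    unfolding continuous_on_closed_vimage[OF compact_imp_closed[OF S]]
  proof (intro allI impI)
    fix B :: "real set" assume "closed B"
    then have "closed (?Q \<inter> c -` B)"
      using c continuous_on_closed_vimage[of ?Q c] by (simp add: Int_commute closed_cbox)
    then have "compact (?Q \<inter> c -` B)"
      by (meson Int_lower1 bounded_cbox bounded_subset compact_eq_bounded_closed)
    then have "compact (torus_embed X ` (?Q \<inter> c -` B))"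
      by (intro compact_continuous_image continuous_on_torus_embed)
    moreover have "torus_embed X ` (?Q \<inter> c -` B) = F -` B \<inter> ?S"
      using F by force
    ultimately show "closed (F -` B \<inter> ?S)" by (simp add: compact_imp_closed)
  qed
  obtain g where g: "real_polynomial_function g" "\<And>y. y \<in> ?S \<Longrightarrow> \<bar>F y - g y\<bar> < \<eta>"
    using Stone_Weierstrass_real_polynomial_function[OF S contF \<eta>] by auto
  show ?thesis
  proof (intro exI conjI ballI)
    show "trig_poly X (\<lambda>x. g (torus_embed X x))" by (rule trig_poly_polynomial[OF g(1)])
    show "\<bar>c x - g (torus_embed X x)\<bar> < \<eta>" if "x \<in> ?Q" for x
      using g(2)[of "torus_embed X x"] F[OF that] that by auto
  qed
qed

text \<open>The uniform bound on the approximations is essential below: it allows for limits against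
  weights that are merely integrable. It is obtained by approximating first with continuous
  functions, clamped to \<open>[-B,B]\<close> and cut off near the boundary.\<close>

lemma trig_poly_dense_bounded:
  fixes w :: "real^'d \<Rightarrow> real"
  assumes X: "\<And>i. X $ i > 0" and w: "w \<in> borel_measurable (torus X)"
    and B: "AE x in torus X. \<bar>w x\<bar> \<le> B"
  obtains \<psi> where "\<And>n::nat. trig_poly X (\<psi> n)" "\<And>n x. x \<in> cbox (- X) X \<Longrightarrow> \<bar>\<psi> n x\<bar> \<le> B + 1"
    "(\<lambda>n. \<integral>x. \<bar>\<psi> n x - w x\<bar> \<partial>torus X) \<longlonglongrightarrow> 0"
proof -
  let ?Q = "cbox (- X) X" and ?I = "box (- X) X"
  interpret finite_measure "torus X" by (rule finite_measure_torus)
  have B0: "B \<ge> 0"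
  proof (rule ccontr)
    assume "\<not> B \<ge> 0"
    with B have "AE x in torus X. False" by (auto elim: eventually_mono)
    with torus_not_null[OF X] show False by simp
  qed
  obtain N g where N: "negligible N" and g: "\<And>n::nat. continuous_on UNIV (g n)"
    and lim: "\<And>x. x \<notin> N \<Longrightarrow> (\<lambda>n. g n x) \<longlonglongrightarrow> (if x \<in> ?Q then w x else 0)"
    using w measurable_on_iff_borel_measurable[of ?Q w] unfolding torus_def measurable_on_def
    by auto
  define c where "c n x = min 1 (real n * infdist x (- ?I)) * max (- B) (min B (g n x))" for n x
  have cont: "continuous_on S (c n)" for n S
    unfolding c_def by (intro continuous_intros continuous_on_subset[OF g]) auto
  have c0: "c n x = 0" if "x \<in> ?Q - ?I" for n x
    using that B0 by (auto simp: c_def)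
  have cB: "\<bar>c n x\<bar> \<le> B" for n x
  proof -
    have "\<bar>max (- B) (min B (g n x))\<bar> \<le> B" using B0 by auto
    moreover have "\<bar>min 1 (real n * infdist x (- ?I))\<bar> \<le> 1"
      using infdist_nonneg[of x "- ?I"] mult_nonneg_nonneg[of "real n" "infdist x (- ?I)"] by linarith
    ultimately have "\<bar>c n x\<bar> \<le> 1 * B" unfolding c_def abs_mult by (intro mult_mono) auto
    then show ?thesis by simp
  qed
  have clim: "AE x in torus X. (\<lambda>n. c n x) \<longlonglongrightarrow> w x"
    using AE_torus_box AE_torus_negligible[OF N] B
  proof eventually_elim
    case (elim x)
    have "infdist x (- ?I) \<noteq> 0"
    proof -
      have "closed (- ?I)" by (simp add: open_box closed_Compl)
      moreover have "- ?I \<noteq> {}"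
      proof
        assume e: "- ?I = {}"
        have "bounded (- (- ?I))" by simp
        then show False unfolding e by simp
      qed
      ultimately show ?thesis using elim in_closed_iff_infdist_zero[of "- ?I" x] by auto
    qed
    then have pos: "infdist x (- ?I) > 0" using infdist_nonneg[of x "- ?I"] by linarith
    obtain m :: nat where m: "1 / infdist x (- ?I) \<le> real m" using real_arch_simple by blast
    have ev: "\<forall>\<^sub>F n in sequentially. max (- B) (min B (g n x)) = c n x"
    proof (rule eventually_sequentiallyI[of m])
      fix n assume "m \<le> n"
      then have "1 / infdist x (- ?I) \<le> real n" using m by linarith
      then have "1 \<le> real n * infdist x (- ?I)" using pos by (simp add: field_simps)
      then show "max (- B) (min B (g n x)) = c n x" by (simp add: c_def)
    qed
    have "(\<lambda>n. g n x) \<longlonglongrightarrow> w x" using lim[of x] elim box_subset_cbox[of "-X" X] by auto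
    then have "(\<lambda>n. max (- B) (min B (g n x))) \<longlonglongrightarrow> max (- B) (min B (w x))"
      by (intro tendsto_intros)
    then have "(\<lambda>n. max (- B) (min B (g n x))) \<longlonglongrightarrow> w x" using elim by (simp add: abs_le_iff max_absorb2 min_absorb2 minus_le_iff)
    then show ?case using ev by (rule Lim_transform_eventually)
  qed
  have cm: "c n \<in> borel_measurable (torus X)" for n by (rule borel_measurable_torus[OF cont])
  have ci: "integrable (torus X) (c n)" for n
    by (rule integrable_torus_bounded[OF cm, where B=B]) (simp add: cB)
  have wi: "integrable (torus X) w" by (rule integrable_torus_bounded[OF w B])
  have "(\<lambda>n. \<integral>x. \<bar>c n x - w x\<bar> \<partial>torus X) \<longlonglongrightarrow> (\<integral>x. 0 \<partial>torus X)"
  proof (rule integral_dominated_convergence[where w = "\<lambda>x. 2 * B"])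
    show "AE x in torus X. (\<lambda>n. \<bar>c n x - w x\<bar>) \<longlonglongrightarrow> 0"
      using clim by eventually_elim (simp add: LIM_zero_iff tendsto_rabs_zero_iff)
    show "AE x in torus X. norm \<bar>c n x - w x\<bar> \<le> 2 * B" for n
      using B
    proof eventually_elim
      case (elim x) then show ?case using cB[of n x] by simp
    qed
  qed (use cm w in auto)
  then have c_lim: "(\<lambda>n. \<integral>x. \<bar>c n x - w x\<bar> \<partial>torus X) \<longlonglongrightarrow> 0" by simp
  have "\<exists>\<psi>. trig_poly X \<psi> \<and> (\<forall>x\<in>?Q. \<bar>c n x - \<psi> x\<bar> < inverse (real (Suc n)))" for n
    by (rule trig_poly_uniform_approx[OF X cont c0]) auto
  then obtain \<psi> where \<psi>: "\<And>n. trig_poly X (\<psi> n)"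
    "\<And>n x. x \<in> ?Q \<Longrightarrow> \<bar>c n x - \<psi> n x\<bar> < inverse (real (Suc n))" by metis
  have inv1: "inverse (real (Suc n)) \<le> 1" for n by (simp add: field_simps)
  show ?thesis
  proof
    show "trig_poly X (\<psi> n)" for n by fact
    show "\<bar>\<psi> n x\<bar> \<le> B + 1" if "x \<in> ?Q" for n x
      using \<psi>(2)[OF that, of n] cB[of n x] inv1[of n] by linarith
    have up: "(\<integral>x. \<bar>\<psi> n x - w x\<bar> \<partial>torus X) \<le>
        (\<integral>x. \<bar>c n x - w x\<bar> \<partial>torus X) + measure (torus X) ?Q * inverse (real (Suc n))" for n
    proof -
      have "(\<integral>x. \<bar>\<psi> n x - w x\<bar> \<partial>torus X) \<le>
        (\<integral>x. \<bar>c n x - w x\<bar> + inverse (real (Suc n)) \<partial>torus X)"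
      proof (rule integral_mono)
        show "integrable (torus X) (\<lambda>x. \<bar>\<psi> n x - w x\<bar>)"
          using trig_poly_integrable[OF \<psi>(1)] wi by auto
        show "integrable (torus X) (\<lambda>x. \<bar>c n x - w x\<bar> + inverse (real (Suc n)))"
          using ci wi by (intro Bochner_Integration.integrable_add) auto
        fix x assume "x \<in> space (torus X)"
        then show "\<bar>\<psi> n x - w x\<bar> \<le> \<bar>c n x - w x\<bar> + inverse (real (Suc n))"
          using \<psi>(2)[of x n] by auto
      qed
      also have "\<dots> = (\<integral>x. \<bar>c n x - w x\<bar> \<partial>torus X) + measure (torus X) ?Q * inverse (real (Suc n))"
        using ci wi by (subst Bochner_Integration.integral_add) auto
      finally show ?thesis .
    qed
    have "(\<lambda>n. (\<integral>x. \<bar>c n x - w x\<bar> \<partial>torus X) + measure (torus X) ?Q * inverse (real (Suc n)))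
        \<longlonglongrightarrow> 0 + measure (torus X) ?Q * 0"
      by (intro tendsto_intros c_lim LIMSEQ_inverse_real_of_nat)
    then show "(\<lambda>n. \<integral>x. \<bar>\<psi> n x - w x\<bar> \<partial>torus X) \<longlonglongrightarrow> 0"
      by (rule metric_tendsto_imp_tendsto[OF _ always_eventually])
         (use up in \<open>auto simp: dist_real_def intro: order_trans[OF _ abs_ge_self]\<close>)
  qed
qed

lemma trig_poly_dense_L1:
  fixes f :: "real^'d \<Rightarrow> real"
  assumes X: "\<And>i. X $ i > 0" and f: "integrable (torus X) f" and \<eta>: "\<eta> > 0"
  shows "\<exists>\<psi>. trig_poly X \<psi> \<and> (\<integral>x. \<bar>f x - \<psi> x\<bar> \<partial>torus X) < \<eta>"
proof -
  define w where "w m x = max (- real m) (min (real m) (f x))" for m :: nat and x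
  have [measurable]: "f \<in> borel_measurable (torus X)" using f by auto
  have wm: "w m \<in> borel_measurable (torus X)" for m unfolding w_def[abs_def] by measurable
  have wB: "\<bar>w m x\<bar> \<le> real m" for m x by (auto simp: w_def)
  have wi: "integrable (torus X) (w m)" for m
    by (rule integrable_torus_bounded[OF wm, where B="real m"]) (simp add: wB)
  have "(\<lambda>m. \<integral>x. \<bar>f x - w m x\<bar> \<partial>torus X) \<longlonglongrightarrow> (\<integral>x. 0 \<partial>torus X)"
  proof (rule integral_dominated_convergence[where w = "\<lambda>x. \<bar>f x\<bar>"])
    show "AE x in torus X. (\<lambda>m. \<bar>f x - w m x\<bar>) \<longlonglongrightarrow> 0"
    proof (rule AE_I2, rule tendsto_eventually)
      fix x
      obtain N :: nat where "\<bar>f x\<bar> \<le> real N" using real_arch_simple by blast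
      then show "\<forall>\<^sub>F m in sequentially. \<bar>f x - w m x\<bar> = 0"
        by (intro eventually_sequentiallyI[of N]) (auto simp: w_def)
    qed
    show "AE x in torus X. norm \<bar>f x - w m x\<bar> \<le> \<bar>f x\<bar>" for m
      by (auto simp: w_def)
  qed (use wm f in auto)
  then have "(\<lambda>m. \<integral>x. \<bar>f x - w m x\<bar> \<partial>torus X) \<longlonglongrightarrow> 0" by simp
  from LIMSEQ_D[OF this, of "\<eta> / 2"] \<eta> obtain m where m: "(\<integral>x. \<bar>f x - w m x\<bar> \<partial>torus X) < \<eta> / 2"
    by (auto)
  obtain \<psi> where \<psi>: "\<And>n::nat. trig_poly X (\<psi> n)"
    "(\<lambda>n. \<integral>x. \<bar>\<psi> n x - w m x\<bar> \<partial>torus X) \<longlonglongrightarrow> 0"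
    by (rule trig_poly_dense_bounded[OF X wm[of m], of "real m"]) (use wB in auto)
  from LIMSEQ_D[OF \<psi>(2), of "\<eta> / 2"] \<eta> obtain n where n: "(\<integral>x. \<bar>\<psi> n x - w m x\<bar> \<partial>torus X) < \<eta> / 2"
    by (auto)
  have "(\<integral>x. \<bar>f x - \<psi> n x\<bar> \<partial>torus X) \<le> (\<integral>x. \<bar>f x - w m x\<bar> + \<bar>\<psi> n x - w m x\<bar> \<partial>torus X)"
    by (rule integral_mono) (use trig_poly_integrable[OF \<psi>(1)] wi f in auto)
  also have "\<dots> = (\<integral>x. \<bar>f x - w m x\<bar> \<partial>torus X) + (\<integral>x. \<bar>\<psi> n x - w m x\<bar> \<partial>torus X)"
    by (rule Bochner_Integration.integral_add) (use trig_poly_integrable[OF \<psi>(1)] wi f in auto)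
  also have "\<dots> < \<eta>" using m n by simp
  finally show ?thesis using \<psi>(1) by blast
qed

section \<open>Translations of the torus\<close>

text \<open>Translation of the torus by \<open>k\<close> in direction \<open>i\<close>, as a map of the cell into itself: the \<open>i\<close>-th
  coordinate is reduced to \<open>[-X\<^sub>i, X\<^sub>i)\<close>. Composition with this map replaces the translation of
  periodic extensions.\<close>

definition torus_shift :: "real^'d \<Rightarrow> 'd \<Rightarrow> real \<Rightarrow> real^'d \<Rightarrow> real^'d" where
  "torus_shift X i k x =
     x + (k - 2 * X $ i * of_int \<lfloor>(x $ i + k + X $ i) / (2 * X $ i)\<rfloor>) *\<^sub>R axis i 1"

lemma torus_shift_nth: "torus_shift X i k x $ j =
    (if j = i then x $ i + k - 2 * X $ i * of_int \<lfloor>(x $ i + k + X $ i) / (2 * X $ i)\<rfloor> else x $ j)"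
  by (simp add: torus_shift_def axis_def)

lemma torus_shift_range:
  assumes "X $ i > 0"
  shows "- X $ i \<le> torus_shift X i k x $ i" "torus_shift X i k x $ i < X $ i"
proof -
  let ?q = "(x $ i + k + X $ i) / (2 * X $ i)"
  have q: "of_int \<lfloor>?q\<rfloor> \<le> ?q" "?q < of_int \<lfloor>?q\<rfloor> + 1" by linarith+
  have X2: "0 < 2 * X $ i" using assms by simp
  have "2 * X $ i * of_int \<lfloor>?q\<rfloor> \<le> x $ i + k + X $ i" "x $ i + k + X $ i < 2 * X $ i * (of_int \<lfloor>?q\<rfloor> + 1)"
    using q(1)[unfolded pos_le_divide_eq[OF X2]] q(2)[unfolded pos_divide_less_eq[OF X2]]
    by (simp_all only: mult.commute)
  then show "- X $ i \<le> torus_shift X i k x $ i" "torus_shift X i k x $ i < X $ i"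
    by (simp_all add: torus_shift_nth distrib_left)
qed

lemma torus_shift_cbox:
  assumes "X $ i > 0" "x \<in> cbox (- X) X"
  shows "torus_shift X i k x \<in> cbox (- X) X"
  unfolding mem_box_cart
proof
  fix j
  show "(- X) $ j \<le> torus_shift X i k x $ j \<and> torus_shift X i k x $ j \<le> X $ j"
  proof (cases "j = i")
    case True
    then show ?thesis using torus_shift_range[OF assms(1), of k x] by simp
  next
    case False
    then show ?thesis using assms(2) by (simp add: torus_shift_nth mem_box_cart)
  qed
qed

lemma torus_shift_unique:
  assumes X: "X $ i > 0" and "- X $ i \<le> x $ i + k - 2 * X $ i * of_int m"
    and "x $ i + k - 2 * X $ i * of_int m < X $ i"
  shows "torus_shift X i k x = x + (k - 2 * X $ i * of_int m) *\<^sub>R axis i 1"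
proof -
  have "\<lfloor>(x $ i + k + X $ i) / (2 * X $ i)\<rfloor> = m"
    using assms by (intro floor_unique) (auto simp: field_simps)
  then show ?thesis by (simp add: torus_shift_def)
qed

lemma torus_shift_shift:
  assumes X: "X $ i > 0"
  shows "torus_shift X i k (torus_shift X i l x) = torus_shift X i (k + l) x"
proof -
  let ?m = "\<lfloor>(x $ i + l + X $ i) / (2 * X $ i)\<rfloor>" and ?y = "torus_shift X i l x"
  let ?n = "\<lfloor>(?y $ i + k + X $ i) / (2 * X $ i)\<rfloor>"
  have 1: "torus_shift X i k ?y $ i = x $ i + (k + l) - 2 * X $ i * of_int (?m + ?n)"
    by (simp add: torus_shift_nth algebra_simps)
  have "torus_shift X i (k + l) x = x + (k + l - 2 * X $ i * of_int (?m + ?n)) *\<^sub>R axis i 1"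
    using torus_shift_range[OF X, of k ?y] unfolding 1 by (intro torus_shift_unique X)
  also have "\<dots> = torus_shift X i k ?y"
    by (simp add: torus_shift_def[of X i k] torus_shift_def[of X i l] algebra_simps)
  finally show ?thesis by simp
qed

lemma torus_shift_0:
  assumes "\<And>i. X $ i > 0" "x \<in> box (- X) X" shows "torus_shift X i 0 x = x"
  using torus_shift_unique[of X i x 0 0] assms by (simp add: mem_box_cart less_imp_le)

lemma periodic_add_int:
  assumes "periodic X \<psi>"
  shows "\<psi> (x + (2 * X $ i * of_int m) *\<^sub>R axis i 1) = \<psi> x"
proof -
  have step: "\<psi> (x + (2 * X $ i) *\<^sub>R axis i 1) = \<psi> x" for x
  proof -
    have "axis i (2 * X $ i) = (2 * X $ i) *\<^sub>R axis i 1" by (simp add: axis_def vec_eq_iff)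
    then show ?thesis using assms[unfolded periodic_def, rule_format, of x i] by simp
  qed
  have nat: "\<psi> (x + (2 * X $ i * of_nat n) *\<^sub>R axis i 1) = \<psi> x" for n x
  proof (induction n)
    case (Suc n)
    have "x + (2 * X $ i * of_nat (Suc n)) *\<^sub>R axis i 1 = (x + (2 * X $ i * of_nat n) *\<^sub>R axis i 1) + (2 * X $ i) *\<^sub>R axis i 1"
      by (simp add: algebra_simps)
    then show ?case by (simp only: step Suc)
  qed simp
  show ?thesis
  proof (cases m)
    case (nonneg n) then show ?thesis using nat by simp
  next
    case (neg n)
    show ?thesis
      using nat[of "x + (2 * X $ i * of_int m) *\<^sub>R axis i 1" "Suc n"] by (simp add: neg algebra_simps)
  qed
qed

lemma periodic_torus_shift:
  assumes "periodic X \<psi>" shows "\<psi> (torus_shift X i k x) = \<psi> (x + k *\<^sub>R axis i 1)"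
proof -
  have "torus_shift X i k x = (x + k *\<^sub>R axis i 1) +
     (2 * X $ i * of_int (- \<lfloor>(x $ i + k + X $ i) / (2 * X $ i)\<rfloor>)) *\<^sub>R axis i 1"
    by (simp add: torus_shift_def algebra_simps)
  then show ?thesis by (simp only: periodic_add_int[OF assms])
qed

lemma torus_shift_period:
  assumes X: "X $ i > 0"
  shows "torus_shift X i (k + 2 * X $ i * of_int m) x = torus_shift X i k x"
proof -
  let ?n = "\<lfloor>(x $ i + k + X $ i) / (2 * X $ i)\<rfloor>"
  have "torus_shift X i (k + 2 * X $ i * of_int m) x
      = x + (k + 2 * X $ i * of_int m - 2 * X $ i * of_int (?n + m)) *\<^sub>R axis i 1"
    using torus_shift_range[OF X, of k x]
    by (intro torus_shift_unique X) (simp_all add: torus_shift_nth algebra_simps)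
  then show ?thesis by (simp add: torus_shift_def algebra_simps)
qed

lemma sets_torus: "A \<in> sets (torus X) \<longleftrightarrow> A \<in> sets lebesgue \<and> A \<subseteq> cbox (- X) X"
  by (auto simp: torus_def sets_restrict_space_iff)

lemma emeasure_lebesgue_translation: "emeasure lebesgue ((+) a ` S) = emeasure lebesgue S"
  for a :: "'a::euclidean_space"
  using emeasure_lebesgue_affine[of 1 a S] by (simp add: add.commute[of _ a] cong: image_cong_simp)

lemma halfspace_lebesgue:
  "{x::real^'d. x $ i \<le> c} \<in> sets lebesgue" "{x::real^'d. c \<le> x $ i} \<in> sets lebesgue"
  "{x::real^'d. x $ i < c} \<in> sets lebesgue" "{x::real^'d. c < x $ i} \<in> sets lebesgue"
proof -
  have "closed {x::real^'d. x $ i \<le> c}" "closed {x::real^'d. c \<le> x $ i}"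
    "open {x::real^'d. x $ i < c}" "open {x::real^'d. c < x $ i}"
    by (intro closed_Collect_le open_Collect_less continuous_intros)+
  then show "{x::real^'d. x $ i \<le> c} \<in> sets lebesgue" "{x::real^'d. c \<le> x $ i} \<in> sets lebesgue"
  "{x::real^'d. x $ i < c} \<in> sets lebesgue" "{x::real^'d. c < x $ i} \<in> sets lebesgue"
    by (simp_all add: borel_closed borel_open)
qed

text \<open>Invariance of Lebesgue measure. After reduction to \<open>0 \<le> r < 2 X\<^sub>i\<close> the map is a translation by
  \<open>r\<close> on one part of the cell and by \<open>r - 2 X\<^sub>i\<close> on the other; \<open>A1\<close> and \<open>A2\<close> are the
  corresponding parts of the image, and they cover \<open>A\<close> and are disjoint up to null sets.\<close>

lemma torus_shift_vimage:
  fixes X :: "real^'d"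
  assumes X: "\<And>i. X $ i > 0" and A: "A \<in> sets (torus X)"
  shows "torus_shift X i k -` A \<inter> cbox (- X) X \<in> sets lebesgue \<and>
    emeasure lebesgue (torus_shift X i k -` A \<inter> cbox (- X) X) = emeasure lebesgue A"
proof -
  let ?e = "axis i (1::real)" and ?Q = "cbox (- X) X"
  define m where "m = \<lfloor>k / (2 * X $ i)\<rfloor>"
  define r where "r = k - 2 * X $ i * of_int m"
  have r: "0 \<le> r" "r < 2 * X $ i"
  proof -
    have "of_int m \<le> k / (2 * X $ i)" "k / (2 * X $ i) < of_int m + 1" unfolding m_def by linarith+
    then show "0 \<le> r" "r < 2 * X $ i" using X[of i] by (simp_all add: r_def field_simps)
  qed
  have sh: "torus_shift X i k = torus_shift X i r"
    using torus_shift_period[OF X, of i r m] by (auto simp: r_def fun_eq_iff)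
  have AQ: "A \<subseteq> ?Q" and Al: "A \<in> sets lebesgue" using A by (auto simp: sets_torus)
  define A1 where "A1 = A \<inter> {y. r - X $ i \<le> y $ i} \<inter> {y. y $ i < X $ i}"
  define A2 where "A2 = A \<inter> {y. y $ i \<le> r - X $ i}"
  let ?v1 = "r *\<^sub>R ?e" and ?v2 = "(r - 2 * X $ i) *\<^sub>R ?e"
  define B1 where "B1 = (+) (- ?v1) ` A1"
  define B2 where "B2 = (+) (- ?v2) ` A2"
  have mem: "x \<in> (+) (- v) ` C \<longleftrightarrow> x + v \<in> C" for x v :: "real^'d" and C by force
  have B1: "x \<in> B1 \<longleftrightarrow> x + ?v1 \<in> A1" and B2: "x \<in> B2 \<longleftrightarrow> x + ?v2 \<in> A2" for x
    unfolding B1_def B2_def by (rule mem)+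
  have AA: "A1 \<in> sets lebesgue" "A2 \<in> sets lebesgue"
    unfolding A1_def A2_def using Al halfspace_lebesgue by (auto intro!: sets.Int)
  then have BB: "B1 \<in> sets lebesgue" "B2 \<in> sets lebesgue"
    unfolding B1_def B2_def by (simp_all only: lebesgue_sets_translation)
  have nth: "(x + c *\<^sub>R ?e) $ j = x $ j + (if j = i then c else 0)" for x :: "real^'d" and c j
    by (simp add: axis_def)
  have case1: "torus_shift X i r x = x + r *\<^sub>R ?e" if "x \<in> ?Q" "x $ i + r < X $ i" for x
  proof -
    have "- X $ i \<le> x $ i" using that by (simp add: mem_box_cart)
    then show ?thesis using torus_shift_unique[OF X, of i x r 0] that r by simp
  qed
  have case2: "torus_shift X i r x = x + (r - 2 * X $ i) *\<^sub>R ?e" if "x \<in> ?Q" "X $ i \<le> x $ i + r" for x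
  proof -
    have "x $ i \<le> X $ i" using that by (simp add: mem_box_cart)
    then show ?thesis using torus_shift_unique[OF X, of i x r 1] that r by simp
  qed
  have A1D: "- X $ i \<le> x $ i" "x $ i + r < X $ i" "x \<in> ?Q" if "x \<in> B1" for x
  proof -
    have y: "x + ?v1 \<in> A1" using that by (simp add: B1)
    then show "- X $ i \<le> x $ i" "x $ i + r < X $ i" unfolding A1_def by (simp_all add: nth)
    have "x + ?v1 \<in> ?Q" using y AQ by (auto simp: A1_def)
    then have yj: "- X $ j \<le> (x + ?v1) $ j \<and> (x + ?v1) $ j \<le> X $ j" for j
      by (simp only: mem_box_cart uminus_vec_def vec_lambda_beta)
    show "x \<in> ?Q" unfolding mem_box_cart
    proof
      fix j show "(- X) $ j \<le> x $ j \<and> x $ j \<le> X $ j"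
        using yj[of j] \<open>- X $ i \<le> x $ i\<close> \<open>x $ i + r < X $ i\<close> r unfolding nth by (cases "j = i") auto
    qed
  qed
  have A2D: "X $ i \<le> x $ i + r" "x \<in> ?Q" if "x \<in> B2" for x
  proof -
    have y: "x + ?v2 \<in> A2" using that by (simp add: B2)
    then have u: "x $ i \<le> X $ i" unfolding A2_def by (simp add: nth)
    have "x + ?v2 \<in> ?Q" using y AQ by (auto simp: A2_def)
    then have yj: "- X $ j \<le> (x + ?v2) $ j \<and> (x + ?v2) $ j \<le> X $ j" for j
      by (simp only: mem_box_cart uminus_vec_def vec_lambda_beta)
    show "X $ i \<le> x $ i + r" using yj[of i] by (simp add: nth)
    show "x \<in> ?Q" unfolding mem_box_cart
    proof
      fix j show "(- X) $ j \<le> x $ j \<and> x $ j \<le> X $ j"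
        using yj[of j] u \<open>X $ i \<le> x $ i + r\<close> r unfolding nth by (cases "j = i") auto
    qed
  qed
  have V: "torus_shift X i r -` A \<inter> ?Q = B1 \<union> B2"
  proof (intro set_eqI iffI)
    fix x assume x: "x \<in> torus_shift X i r -` A \<inter> ?Q"
    then have xi: "- X $ i \<le> x $ i" "x $ i \<le> X $ i" by (auto simp: mem_box_cart)
    show "x \<in> B1 \<union> B2"
    proof (cases "x $ i + r < X $ i")
      case True
      then have "x + ?v1 \<in> A1" using x case1[of x] xi by (simp add: A1_def nth)
      then show ?thesis by (simp add: B1)
    next
      case False
      then have "x + ?v2 \<in> A2" using x case2[of x] xi by (simp add: A2_def nth)
      then show ?thesis by (simp add: B2)
    qed
  next
    fix x assume "x \<in> B1 \<union> B2"
    then show "x \<in> torus_shift X i r -` A \<inter> ?Q"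
    proof
      assume x: "x \<in> B1"
      then have "x + ?v1 \<in> A" by (simp add: B1 A1_def)
      then show ?thesis using case1[of x] A1D[OF x] by simp
    next
      assume x: "x \<in> B2"
      then have "x + ?v2 \<in> A" by (simp add: B2 A2_def)
      then show ?thesis using case2[of x] A2D[OF x] by simp
    qed
  qed
  have disj: "B1 \<inter> B2 = {}"
    using A1D(2) A2D(1) by fastforce
  have null: "A - (A1 \<union> A2) \<in> null_sets lebesgue" "A1 \<inter> A2 \<in> null_sets lebesgue"
  proof -
    have hyp: "negligible {x. x $ i = c}" for c :: real
      using negligible_standard_hyperplane[of "axis i (1::real)" c] by (simp add: cart_eq_inner_axis axis_in_Basis_iff)
    have "A - (A1 \<union> A2) \<subseteq> {x. x $ i = X $ i}"
    proof
      fix x assume x: "x \<in> A - (A1 \<union> A2)"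
      then have "x $ i \<le> X $ i" using AQ by (auto simp: mem_box_cart)
      then show "x \<in> {x. x $ i = X $ i}" using x by (auto simp: A1_def A2_def)
    qed
    then show "A - (A1 \<union> A2) \<in> null_sets lebesgue"
      using negligible_subset[OF hyp] by (simp add: negligible_iff_null_sets)
    have "A1 \<inter> A2 \<subseteq> {x. x $ i = r - X $ i}" by (auto simp: A1_def A2_def)
    then show "A1 \<inter> A2 \<in> null_sets lebesgue"
      using negligible_subset[OF hyp] by (simp add: negligible_iff_null_sets)
  qed
  have "emeasure lebesgue (B1 \<union> B2) = emeasure lebesgue B1 + emeasure lebesgue B2"
    by (rule plus_emeasure[symmetric]) (use BB disj in auto)
  also have "\<dots> = emeasure lebesgue A1 + emeasure lebesgue A2"
    by (simp only: B1_def B2_def emeasure_lebesgue_translation)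
  also have "\<dots> = emeasure lebesgue A1 + emeasure lebesgue (A2 - (A1 \<inter> A2))"
    using emeasure_Diff_null_set[OF null(2) AA(2)] by simp
  also have "\<dots> = emeasure lebesgue (A1 \<union> (A2 - (A1 \<inter> A2)))"
    by (rule plus_emeasure) (use AA in auto)
  also have "A1 \<union> (A2 - (A1 \<inter> A2)) = A - (A - (A1 \<union> A2))"
    by (auto simp: A1_def A2_def)
  also have "emeasure lebesgue \<dots> = emeasure lebesgue A"
    by (rule emeasure_Diff_null_set[OF null(1) Al])
  finally show ?thesis using BB by (simp add: sh V sets.Un)
qed

lemma torus_shift_measurable:
  assumes "\<And>i. X $ i > 0"
  shows "torus_shift X i k \<in> measurable (torus X) (torus X)"
proof (rule measurableI)
  show "torus_shift X i k x \<in> space (torus X)" if "x \<in> space (torus X)" for x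
    using that torus_shift_cbox[of X i x k] assms by simp
  show "torus_shift X i k -` A \<inter> space (torus X) \<in> sets (torus X)" if "A \<in> sets (torus X)" for A
    using torus_shift_vimage[OF assms that, of i k] by (simp add: sets_torus)
qed

lemma distr_torus_shift:
  assumes "\<And>i. X $ i > 0"
  shows "distr (torus X) (torus X) (torus_shift X i k) = torus X"
proof (rule measure_eqI)
  fix A assume "A \<in> sets (distr (torus X) (torus X) (torus_shift X i k))"
  then have A: "A \<in> sets (torus X)" by simp
  have em: "emeasure (torus X) B = emeasure lebesgue B" if "B \<in> sets (torus X)" for B
    using that unfolding torus_def by (intro emeasure_restrict_space) (auto simp: sets_restrict_space_iff)
  show "emeasure (distr (torus X) (torus X) (torus_shift X i k)) A = emeasure (torus X) A"
    using torus_shift_vimage[OF assms A, of i k] A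
    by (simp add: emeasure_distr torus_shift_measurable[OF assms] em sets_torus)
qed simp

lemma AE_torus_shift:
  assumes "\<And>i. X $ i > 0" "AE x in torus X. P x"
  shows "AE x in torus X. P (torus_shift X i k x)"
proof (rule AE_distrD[OF torus_shift_measurable[OF assms(1)]])
  show "AE x in distr (torus X) (torus X) (torus_shift X i k). P x"
    unfolding distr_torus_shift[OF assms(1)] by (rule assms(2))
qed

lemma borel_measurable_torus_shift:
  assumes "\<And>i. X $ i > 0" "f \<in> borel_measurable (torus X)"
  shows "(\<lambda>x. f (torus_shift X i k x)) \<in> borel_measurable (torus X)"
  by (rule measurable_compose[OF torus_shift_measurable[OF assms(1)] assms(2)])

lemma integrable_torus_shift:
  fixes f :: "real^'d \<Rightarrow> real"
  assumes "\<And>i. X $ i > 0" "integrable (torus X) f"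
  shows "integrable (torus X) (\<lambda>x. f (torus_shift X i k x))"
  by (rule integrable_distr[OF torus_shift_measurable[OF assms(1)]])
     (simp add: distr_torus_shift assms)

lemma integral_torus_shift:
  fixes f :: "real^'d \<Rightarrow> real"
  assumes "\<And>i. X $ i > 0" "f \<in> borel_measurable (torus X)"
  shows "(\<integral>x. f (torus_shift X i k x) \<partial>torus X) = (\<integral>x. f x \<partial>torus X)"
  using integral_distr[OF torus_shift_measurable[OF assms(1), of i k] assms(2)]
  by (simp add: distr_torus_shift assms)

section \<open>Weak derivatives and monotone functions\<close>

lemma trig_poly_approx_mult:
  fixes w :: "real^'d \<Rightarrow> real"
  assumes r: "integrable (torus X) r" and w: "w \<in> borel_measurable (torus X)" "AE x in torus X. \<bar>w x\<bar> \<le> B"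
    and \<psi>m: "\<And>n::nat. \<psi> n \<in> borel_measurable (torus X)" and \<psi>B: "\<And>n. AE x in torus X. \<bar>\<psi> n x\<bar> \<le> C"
    and lim: "(\<lambda>n. \<integral>x. \<bar>\<psi> n x - w x\<bar> \<partial>torus X) \<longlonglongrightarrow> 0"
  shows "(\<lambda>n. \<integral>x. r x * \<psi> n x \<partial>torus X) \<longlonglongrightarrow> (\<integral>x. r x * w x \<partial>torus X)"
proof -
  have bd: "AE x in torus X. \<bar>\<psi> n x - w x\<bar> \<le> C + B" for n
    using \<psi>B[of n] w(2) by eventually_elim linarith
  have "(\<lambda>n. \<integral>x. r x * (\<psi> n x - w x) \<partial>torus X) \<longlonglongrightarrow> 0"
    by (rule L1_null_times_integrable[OF r integrable_torus_bounded[OF _ bd] bd lim]) (use \<psi>m w in auto)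
  moreover have "(\<integral>x. r x * (\<psi> n x - w x) \<partial>torus X) = (\<integral>x. r x * \<psi> n x \<partial>torus X) - (\<integral>x. r x * w x \<partial>torus X)" for n
    unfolding right_diff_distrib
    by (rule Bochner_Integration.integral_diff) (use integrable_times_bounded[OF r] \<psi>m \<psi>B w in auto)
  ultimately show ?thesis by (simp add: LIM_zero_iff)
qed

text \<open>Testing with approximations of \<open>sgn f\<close> yields the \<open>L\<^sup>1\<close> norm of \<open>f\<close>.\<close>

lemma AE_zero_of_trig_poly_orthogonal:
  assumes X: "\<And>i. X $ i > 0" and f: "integrable (torus X) f"
    and orth: "\<And>\<psi>. trig_poly X \<psi> \<Longrightarrow> (\<integral>x. f x * \<psi> x \<partial>torus X) = 0"
  shows "AE x in torus X. f x = 0"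
proof -
  have [measurable]: "f \<in> borel_measurable (torus X)" using f by auto
  have w: "(\<lambda>x. sgn (f x)) \<in> borel_measurable (torus X)" by measurable
  have wB: "AE x in torus X. \<bar>sgn (f x)\<bar> \<le> 1" by (simp add: sgn_if)
  obtain \<psi> where \<psi>: "\<And>n::nat. trig_poly X (\<psi> n)" "\<And>n x. x \<in> cbox (- X) X \<Longrightarrow> \<bar>\<psi> n x\<bar> \<le> 1 + 1"
    "(\<lambda>n. \<integral>x. \<bar>\<psi> n x - sgn (f x)\<bar> \<partial>torus X) \<longlonglongrightarrow> 0"
    by (rule trig_poly_dense_bounded[OF X w wB]) blast
  have "(\<lambda>n. \<integral>x. f x * \<psi> n x \<partial>torus X) \<longlonglongrightarrow> (\<integral>x. f x * sgn (f x) \<partial>torus X)"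
    by (rule trig_poly_approx_mult[OF f w wB _ _ \<psi>(3), where C="1 + 1"])
       (use \<psi> in \<open>auto intro: trig_poly_measurable\<close>)
  then have "(\<integral>x. \<bar>f x\<bar> \<partial>torus X) = 0"
    using orth[OF \<psi>(1)] by (simp add: LIMSEQ_const_iff abs_sgn)
  then show ?thesis using integral_nonneg_eq_0_iff_AE[of "torus X" "\<lambda>x. \<bar>f x\<bar>"] f by simp
qed

lemma has_weak_partial_trig_poly:
  assumes X: "\<And>i. X $ i > 0" and "has_weak_partial X i u v" "trig_poly X \<psi>"
  shows "(\<integral>x. u x * partial_deriv i \<psi> x \<partial>torus X) = - (\<integral>x. v x * \<psi> x \<partial>torus X)"
  using assms(2) trig_poly_smooth[OF assms(3)] trig_poly_periodic[OF _ assms(3)] X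
  by (auto simp: has_weak_partial_def less_imp_neq[THEN not_sym])

lemma has_weak_partial_unique:
  assumes X: "\<And>i. X $ i > 0" and "has_weak_partial X i u v" "has_weak_partial X i u v'"
  shows "AE x in torus X. v x = v' x"
proof -
  have v: "integrable (torus X) v" "integrable (torus X) v'" using assms by (auto simp: has_weak_partial_def)
  have "AE x in torus X. v x - v' x = 0"
  proof (rule AE_zero_of_trig_poly_orthogonal[OF X])
    fix \<psi> assume \<psi>: "trig_poly X \<psi>"
    have "(\<integral>x. (v x - v' x) * \<psi> x \<partial>torus X) = (\<integral>x. v x * \<psi> x \<partial>torus X) - (\<integral>x. v' x * \<psi> x \<partial>torus X)"
      unfolding left_diff_distrib
      by (rule Bochner_Integration.integral_diff) (use integrable_times_trig_poly v \<psi> in auto)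
    then show "(\<integral>x. (v x - v' x) * \<psi> x \<partial>torus X) = 0"
      using has_weak_partial_trig_poly[OF X assms(2) \<psi>] has_weak_partial_trig_poly[OF X assms(3) \<psi>] by simp
  qed (use v in auto)
  then show ?thesis by simp
qed

lemma has_weak_partial_cong_AE:
  assumes "has_weak_partial X i u g" "AE x in torus X. u x = u' x" "integrable (torus X) u'"
  shows "has_weak_partial X i u' g"
proof -
  have "(\<integral>x. u x * partial_deriv i \<psi> x \<partial>torus X) = (\<integral>x. u' x * partial_deriv i \<psi> x \<partial>torus X)"
    if "smooth \<psi>" for \<psi>
  proof (rule integral_cong_AE)
    have "partial_deriv i \<psi> \<in> borel_measurable (torus X)"
    proof (rule borel_measurable_torus)
      have "smooth (partial_deriv i \<psi>)"
        using that unfolding partial_deriv_def[abs_def] by (rule smooth.cases) (simp add: axis_in_Basis_iff)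
      then have "\<forall>x. partial_deriv i \<psi> differentiable (at x)" by (rule smooth.cases) simp
      then show "continuous_on UNIV (partial_deriv i \<psi>)"
        by (simp add: differentiable_imp_continuous_within continuous_at_imp_continuous_on)
    qed
    then show "(\<lambda>x. u x * partial_deriv i \<psi> x) \<in> borel_measurable (torus X)"
      "(\<lambda>x. u' x * partial_deriv i \<psi> x) \<in> borel_measurable (torus X)"
      using assms by (auto simp: has_weak_partial_def)
    show "AE x in torus X. u x * partial_deriv i \<psi> x = u' x * partial_deriv i \<psi> x"
      using assms(2) by eventually_elim simp
  qed
  then show ?thesis using assms unfolding has_weak_partial_def by auto
qed

text \<open>A weak partial derivative is a genuine derivative of the pairing with the translates of a test
  function. No differentiation under the integral sign is needed, thanks to the uniform Taylor
  estimate.\<close>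

lemma DERIV_weak_partial_shift:
  assumes X: "\<And>i. X $ i > 0" and uv: "has_weak_partial X i u v" and \<psi>: "trig_poly X \<psi>"
  shows "((\<lambda>k. \<integral>x. u x * \<psi> (x + k *\<^sub>R axis i 1) \<partial>torus X) has_real_derivative
    - (\<integral>x. v x * \<psi> (x + k *\<^sub>R axis i 1) \<partial>torus X)) (at k)"
proof -
  let ?e = "axis i (1::real)"
  have u: "integrable (torus X) u" using uv by (simp add: has_weak_partial_def)
  define J where "J k = (\<integral>x. u x * \<psi> (x + k *\<^sub>R ?e) \<partial>torus X)" for k
  define D where "D = (\<integral>x. u x * partial_deriv i \<psi> (x + k *\<^sub>R ?e) \<partial>torus X)"
  have tk: "trig_poly X (\<lambda>x. \<psi> (x + k *\<^sub>R ?e))" for k by (rule trig_poly_shift[OF \<psi>])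
  have tD: "trig_poly X (\<lambda>x. partial_deriv i \<psi> (x + k *\<^sub>R ?e))"
    by (rule trig_poly_shift[OF trig_poly_partial_deriv[OF \<psi>]])
  have "partial_deriv i (\<lambda>x. \<psi> (x + k *\<^sub>R ?e)) = (\<lambda>x. partial_deriv i \<psi> (x + k *\<^sub>R ?e))"
    using partial_deriv_shift[OF trig_poly_differentiable[OF \<psi>]] by auto
  then have D: "D = - (\<integral>x. v x * \<psi> (x + k *\<^sub>R ?e) \<partial>torus X)"
    using has_weak_partial_trig_poly[OF X uv tk[of k]] by (simp add: D_def)
  obtain C where C: "\<And>x s. \<bar>\<psi> (x + s *\<^sub>R ?e) - \<psi> x - s * partial_deriv i \<psi> x\<bar> \<le> C * s\<^sup>2"
    using trig_poly_taylor[OF \<psi>] by blast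
  have ptw: "\<bar>\<psi> (x + r *\<^sub>R ?e) - \<psi> (x + k *\<^sub>R ?e) - (r - k) * partial_deriv i \<psi> (x + k *\<^sub>R ?e)\<bar> \<le> C * (r - k)\<^sup>2" for r x
    using C[of "x + k *\<^sub>R ?e" "r - k"] by (simp add: algebra_simps)
  define U where "U = (\<integral>x. \<bar>u x\<bar> \<partial>torus X)"
  have "\<bar>(J r - r * D) - (J k - k * D)\<bar> \<le> (C * U) * (r - k)\<^sup>2" for r
  proof -
    have i1: "integrable (torus X) (\<lambda>x. u x * \<psi> (x + r *\<^sub>R ?e))" for r
      by (rule integrable_times_trig_poly[OF u tk])
    have i2: "integrable (torus X) (\<lambda>x. u x * partial_deriv i \<psi> (x + k *\<^sub>R ?e))"
      by (rule integrable_times_trig_poly[OF u tD])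
    have eq: "J r - J k - (r - k) * D = (\<integral>x. u x * \<psi> (x + r *\<^sub>R ?e) - u x * \<psi> (x + k *\<^sub>R ?e)
        - (r - k) * (u x * partial_deriv i \<psi> (x + k *\<^sub>R ?e)) \<partial>torus X)"
      unfolding J_def D_def
      by (simp only: Bochner_Integration.integral_diff[OF Bochner_Integration.integrable_diff[OF i1 i1] integrable_mult_right[OF i2]]
          Bochner_Integration.integral_diff[OF i1 i1] integral_mult_right_zero)
    have "\<bar>J r - J k - (r - k) * D\<bar> \<le> (\<integral>x. \<bar>u x * \<psi> (x + r *\<^sub>R ?e) - u x * \<psi> (x + k *\<^sub>R ?e)
        - (r - k) * (u x * partial_deriv i \<psi> (x + k *\<^sub>R ?e))\<bar> \<partial>torus X)"
      unfolding eq by (rule integral_abs_bound)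
    also have "\<dots> \<le> (\<integral>x. (C * (r - k)\<^sup>2) * \<bar>u x\<bar> \<partial>torus X)"
    proof (rule integral_mono)
      fix x
      have "\<bar>u x * \<psi> (x + r *\<^sub>R ?e) - u x * \<psi> (x + k *\<^sub>R ?e) - (r - k) * (u x * partial_deriv i \<psi> (x + k *\<^sub>R ?e))\<bar>
        = \<bar>u x * (\<psi> (x + r *\<^sub>R ?e) - \<psi> (x + k *\<^sub>R ?e) - (r - k) * partial_deriv i \<psi> (x + k *\<^sub>R ?e))\<bar>"
        by (simp add: algebra_simps)
      also have "\<dots> \<le> (C * (r - k)\<^sup>2) * \<bar>u x\<bar>"
        unfolding abs_mult mult.commute[of "\<bar>u x\<bar>"] by (intro mult_right_mono ptw) simp
      finally show "\<bar>u x * \<psi> (x + r *\<^sub>R ?e) - u x * \<psi> (x + k *\<^sub>R ?e) - (r - k) * (u x * partial_deriv i \<psi> (x + k *\<^sub>R ?e))\<bar>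
        \<le> (C * (r - k)\<^sup>2) * \<bar>u x\<bar>" .
    qed (use i1 i2 u in auto)
    also have "\<dots> = (C * U) * (r - k)\<^sup>2" by (simp add: U_def)
    also have "J r - J k - (r - k) * D = (J r - r * D) - (J k - k * D)" by (simp add: algebra_simps)
    finally show ?thesis .
  qed
  then have "((\<lambda>r. J r - r * D) has_real_derivative 0) (at k)"
    by (rule DERIV_zero_of_quadratic_bound)
  then have "((\<lambda>r. (J r - r * D) + r * D) has_real_derivative 0 + 1 * D) (at k)"
    by (intro DERIV_add DERIV_cmult_right DERIV_ident)
  then show ?thesis by (simp add: J_def[abs_def] D)
qed

lemma second_difference_ge:
  fixes J :: "real \<Rightarrow> real"
  assumes J: "\<And>x. (J has_real_derivative J' x) (at x)" "\<And>x. (J' has_real_derivative A x) (at x)"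
    and A: "\<And>x. \<bar>x\<bar> \<le> k \<Longrightarrow> m \<le> A x" and k: "0 \<le> k"
  shows "m * k\<^sup>2 \<le> J k - 2 * J 0 + J (- k)"
proof -
  let ?p = "\<lambda>x. J' x - J' (- x) - 2 * m * x"
  let ?q = "\<lambda>x. J x + J (- x) - m * x\<^sup>2"
  have Dm: "((\<lambda>x. J' (- x)) has_real_derivative - A (- x)) (at x)" for x
    using DERIV_chain2[OF J(2), of uminus "-1"] by (simp add: DERIV_minus)
  have Dm': "((\<lambda>x. J (- x)) has_real_derivative - J' (- x)) (at x)" for x
    using DERIV_chain2[OF J(1), of uminus "-1"] by (simp add: DERIV_minus)
  have p: "?p 0 \<le> ?p x" if "0 \<le> x" "x \<le> k" for x
  proof (rule DERIV_nonneg_imp_nondecreasing[OF that(1)])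
    fix y assume y: "0 \<le> y" "y \<le> x"
    have "(?p has_real_derivative A y - (- A (- y)) - 2 * m) (at y)"
      by (rule DERIV_cong[OF DERIV_diff[OF DERIV_diff[OF J(2) Dm] DERIV_cmult[OF DERIV_ident]]]) simp
    moreover have "0 \<le> A y - (- A (- y)) - 2 * m" using A[of y] A[of "- y"] y that by simp
    ultimately show "\<exists>d. (?p has_real_derivative d) (at y) \<and> 0 \<le> d" by blast
  qed
  have "?q 0 \<le> ?q k"
  proof (rule DERIV_nonneg_imp_nondecreasing[OF k])
    fix y assume y: "0 \<le> y" "y \<le> k"
    have "(?q has_real_derivative J' y + - J' (- y) - m * (2 * y)) (at y)"
      by (rule DERIV_cong[OF DERIV_diff[OF DERIV_add[OF J(1) Dm'] DERIV_cmult[OF DERIV_pow[of 2]]]]) simp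
    moreover have "0 \<le> J' y + - J' (- y) - m * (2 * y)" using p[OF y] by simp
    ultimately show "\<exists>d. (?q has_real_derivative d) (at y) \<and> 0 \<le> d" by blast
  qed
  then show ?thesis by simp
qed

lemma torus_shift_L1_continuous:
  fixes g :: "real^'d \<Rightarrow> real"
  assumes X: "\<And>i. X $ i > 0" and g: "integrable (torus X) g" and \<eta>: "\<eta> > 0"
  shows "\<exists>d>0. \<forall>\<xi>. \<bar>\<xi>\<bar> < d \<longrightarrow> (\<integral>x. \<bar>g (torus_shift X i \<xi> x) - g x\<bar> \<partial>torus X) \<le> \<eta>"
proof -
  interpret finite_measure "torus X" by (rule finite_measure_torus)
  obtain \<psi> where \<psi>: "trig_poly X \<psi>" "(\<integral>x. \<bar>g x - \<psi> x\<bar> \<partial>torus X) < \<eta> / 3"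
    using trig_poly_dense_L1[OF X g, of "\<eta> / 3"] \<eta> by auto
  have per: "periodic X \<psi>" by (rule trig_poly_periodic[OF _ \<psi>(1)]) (use X in \<open>simp add: less_imp_neq[THEN not_sym]\<close>)
  have \<psi>i: "integrable (torus X) \<psi>" by (rule trig_poly_integrable[OF \<psi>(1)])
  obtain C where C: "\<And>x. \<bar>partial_deriv i \<psi> x\<bar> \<le> C"
    using trig_poly_bounded[OF trig_poly_partial_deriv[OF \<psi>(1)]] by blast
  have lip: "\<bar>\<psi> (torus_shift X i \<xi> x) - \<psi> x\<bar> \<le> C * \<bar>\<xi>\<bar>" for \<xi> x
  proof -
    have "norm (\<psi> (x + \<xi> *\<^sub>R axis i 1) - \<psi> (x + 0 *\<^sub>R axis i 1)) \<le> C * norm (\<xi> - 0)"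
      by (rule field_differentiable_bound[where S=UNIV and f'="\<lambda>s. partial_deriv i \<psi> (x + s *\<^sub>R axis i 1)"
            and f = "\<lambda>s. \<psi> (x + s *\<^sub>R axis i 1)"])
         (use C partial_deriv_line[OF trig_poly_differentiable[OF \<psi>(1)]] in auto)
    then show ?thesis by (simp add: periodic_torus_shift[OF per])
  qed
  have C0: "C \<ge> 0" using C[of 0] by linarith
  define V where "V = measure (torus X) (cbox (- X) X)"
  have V0: "V \<ge> 0" by (simp add: V_def)
  define d where "d = \<eta> / (3 * (C * V + 1))"
  have CV: "C * V \<ge> 0" using C0 V0 by simp
  have d: "d > 0" unfolding d_def using \<eta> CV by (intro divide_pos_pos) auto
  show ?thesis
  proof (intro exI[of _ d] conjI allI impI d)
    fix \<xi> :: real assume \<xi>: "\<bar>\<xi>\<bar> < d"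
    let ?s = "torus_shift X i \<xi>"
    have gs: "integrable (torus X) (\<lambda>x. g (?s x))" by (rule integrable_torus_shift[OF X g])
    have ps: "integrable (torus X) (\<lambda>x. \<psi> (?s x))" by (rule integrable_torus_shift[OF X \<psi>i])
    have "(\<integral>x. \<bar>g (?s x) - g x\<bar> \<partial>torus X) \<le>
      (\<integral>x. \<bar>g (?s x) - \<psi> (?s x)\<bar> + (C * \<bar>\<xi>\<bar> + \<bar>g x - \<psi> x\<bar>) \<partial>torus X)"
    proof (rule integral_mono)
      show "\<bar>g (?s x) - g x\<bar> \<le> \<bar>g (?s x) - \<psi> (?s x)\<bar> + (C * \<bar>\<xi>\<bar> + \<bar>g x - \<psi> x\<bar>)" for x
        using lip[of \<xi> x] by linarith
    qed (use gs ps g \<psi>i in auto)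
    also have "\<dots> = (\<integral>x. \<bar>g (?s x) - \<psi> (?s x)\<bar> \<partial>torus X)
       + (C * \<bar>\<xi>\<bar> * V + (\<integral>x. \<bar>g x - \<psi> x\<bar> \<partial>torus X))"
    proof -
      have "(\<integral>x. C * \<bar>\<xi>\<bar> + \<bar>g x - \<psi> x\<bar> \<partial>torus X) = C * \<bar>\<xi>\<bar> * V + (\<integral>x. \<bar>g x - \<psi> x\<bar> \<partial>torus X)"
        using g \<psi>i by (subst Bochner_Integration.integral_add) (auto simp: V_def)
      then show ?thesis using gs ps g \<psi>i by (subst Bochner_Integration.integral_add) auto
    qed
    also have "(\<integral>x. \<bar>g (?s x) - \<psi> (?s x)\<bar> \<partial>torus X) = (\<integral>x. \<bar>g x - \<psi> x\<bar> \<partial>torus X)"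
      by (rule integral_torus_shift[OF X, of "\<lambda>x. \<bar>g x - \<psi> x\<bar>"]) (use g \<psi>i in auto)
    also have "C * \<bar>\<xi>\<bar> * V \<le> \<eta> / 3"
    proof -
      have "C * \<bar>\<xi>\<bar> * V = (C * V) * \<bar>\<xi>\<bar>" by simp
      also have "\<dots> \<le> (C * V + 1) * d" using \<xi> CV by (intro mult_mono) auto
      also have "\<dots> = \<eta> / 3"
      proof -
        have *: "c * (\<eta> / (3 * c)) = \<eta> / 3" if "c > 0" for c :: real using that by simp
        show ?thesis unfolding d_def by (rule *) (use CV in linarith)
      qed
      finally show ?thesis .
    qed
    finally show "(\<integral>x. \<bar>g (?s x) - g x\<bar> \<partial>torus X) \<le> \<eta>" using \<psi>(2) by linarith
  qed
qed

lemma torus_shift_adjoint: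
  fixes a b :: "real^'d \<Rightarrow> real"
  assumes X: "\<And>i. X $ i > 0" and a: "integrable (torus X) a" and b: "b \<in> borel_measurable (torus X)"
  shows "(\<integral>x. a x * b (torus_shift X i k x) \<partial>torus X) = (\<integral>x. a (torus_shift X i (- k) x) * b x \<partial>torus X)"
proof -
  have m: "(\<lambda>x. a x * b (torus_shift X i k x)) \<in> borel_measurable (torus X)"
    using a borel_measurable_torus_shift[OF X b] by auto
  have "(\<integral>x. a x * b (torus_shift X i k x) \<partial>torus X)
    = (\<integral>x. a (torus_shift X i (- k) x) * b (torus_shift X i k (torus_shift X i (- k) x)) \<partial>torus X)"
    using integral_torus_shift[OF X m, of i "- k"] by simp
  also have "\<dots> = (\<integral>x. a (torus_shift X i (- k) x) * b x \<partial>torus X)"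
  proof (rule integral_cong_AE)
    show "AE x in torus X. a (torus_shift X i (- k) x) * b (torus_shift X i k (torus_shift X i (- k) x)) =
        a (torus_shift X i (- k) x) * b x"
      using AE_torus_box by eventually_elim (simp add: torus_shift_shift[OF X] torus_shift_0[OF X])
    show "(\<lambda>x. a (torus_shift X i (- k) x) * b (torus_shift X i k (torus_shift X i (- k) x))) \<in> borel_measurable (torus X)"
      by (rule borel_measurable_torus_shift[OF X m])
    show "(\<lambda>x. a (torus_shift X i (- k) x) * b x) \<in> borel_measurable (torus X)"
      using borel_measurable_torus_shift[OF X, of a] a b by auto
  qed
  finally show ?thesis .
qed

text \<open>The discrete form of \<open>\<integral> (\<partial>\<^sub>i\<partial>\<^sub>i u) h(u) \<le> 0\<close>: by translation invariance the left-hand side is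
  minus the integral of \<open>(u\<^sub>k - u) (h(u\<^sub>k) - h(u))\<close>.\<close>

lemma monotone_second_difference_nonpos:
  fixes u :: "real^'d \<Rightarrow> real" and h :: "real \<Rightarrow> real"
  assumes X: "\<And>i. X $ i > 0" and u: "integrable (torus X) u"
    and h: "mono h" "h \<in> borel_measurable borel" "\<And>s. \<bar>h s\<bar> \<le> B"
  shows "(\<integral>x. u x * h (u (torus_shift X i k x)) \<partial>torus X) - 2 * (\<integral>x. u x * h (u x) \<partial>torus X)
    + (\<integral>x. u x * h (u (torus_shift X i (- k) x)) \<partial>torus X) \<le> 0"
proof -
  let ?s = "torus_shift X i k"
  have um: "u \<in> borel_measurable (torus X)" using u by auto
  have wm: "(\<lambda>x. h (u x)) \<in> borel_measurable (torus X)" by (rule measurable_compose[OF um h(2)])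
  have us: "integrable (torus X) (\<lambda>x. u (?s x))" by (rule integrable_torus_shift[OF X u])
  have wsm: "(\<lambda>x. h (u (?s x))) \<in> borel_measurable (torus X)" by (rule borel_measurable_torus_shift[OF X wm])
  have int: "integrable (torus X) (\<lambda>x. u x * h (u x))" "integrable (torus X) (\<lambda>x. u x * h (u (?s x)))"
    "integrable (torus X) (\<lambda>x. u (?s x) * h (u x))" "integrable (torus X) (\<lambda>x. u (?s x) * h (u (?s x)))"
    by (rule integrable_times_bounded[where B=B]; use u us wm wsm h in auto)+
  have e1: "(\<integral>x. u x * h (u (torus_shift X i (- k) x)) \<partial>torus X) = (\<integral>x. u (?s x) * h (u x) \<partial>torus X)"
    using torus_shift_adjoint[OF X u wm, of i "- k"] by simp
  have e2: "(\<integral>x. u x * h (u x) \<partial>torus X) = (\<integral>x. u (?s x) * h (u (?s x)) \<partial>torus X)"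
    using integral_torus_shift[OF X, of "\<lambda>x. u x * h (u x)" i k] um wm by simp
  have "0 \<le> (\<integral>x. (u (?s x) - u x) * (h (u (?s x)) - h (u x)) \<partial>torus X)"
  proof (rule integral_nonneg_AE, rule AE_I2)
    fix x
    show "0 \<le> (u (?s x) - u x) * (h (u (?s x)) - h (u x))"
      using monoD[OF h(1), of "u x" "u (?s x)"] monoD[OF h(1), of "u (?s x)" "u x"]
      by (cases "u x \<le> u (?s x)") (auto intro: mult_nonneg_nonneg mult_nonpos_nonpos)
  qed
  also have "(\<integral>x. (u (?s x) - u x) * (h (u (?s x)) - h (u x)) \<partial>torus X)
    = (\<integral>x. u (?s x) * h (u (?s x)) - u (?s x) * h (u x) - (u x * h (u (?s x)) - u x * h (u x)) \<partial>torus X)"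
    by (simp add: left_diff_distrib right_diff_distrib algebra_simps)
  also have "\<dots> = (\<integral>x. u (?s x) * h (u (?s x)) \<partial>torus X) - (\<integral>x. u (?s x) * h (u x) \<partial>torus X)
     - ((\<integral>x. u x * h (u (?s x)) \<partial>torus X) - (\<integral>x. u x * h (u x) \<partial>torus X))"
    using int by simp
  finally show ?thesis using e1 e2 by simp
qed

text \<open>With \<open>\<psi>\<^sub>n\<close> approximating \<open>w = h(u)\<close>, the pairing \<open>J n k\<close> of \<open>u\<close> with the translate of \<open>\<psi>\<^sub>n\<close> has
  the second derivative \<open>A n k\<close>, the corresponding pairing of \<open>g\<close>. The oscillation of \<open>A n\<close> near
  \<open>0\<close> is bounded uniformly in \<open>n\<close> by the modulus of continuity of the translations of \<open>g\<close>; hence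
  \<open>n \<longlonglongrightarrow> \<infinity>\<close> can precede \<open>k \<longlonglongrightarrow> 0\<close>.\<close>

lemma weak_second_partial_monotone:
  fixes h :: "real \<Rightarrow> real"
  assumes X: "\<And>i. X $ i > 0" and uv: "has_weak_partial X i u v" and vg: "has_weak_partial X i v g"
    and h: "mono h" "h \<in> borel_measurable borel" "\<And>s. \<bar>h s\<bar> \<le> B"
  shows "(\<integral>x. g x * h (u x) \<partial>torus X) \<le> 0"
proof -
  let ?e = "axis i (1::real)"
  have u: "integrable (torus X) u" and g: "integrable (torus X) g"
    using uv vg by (auto simp: has_weak_partial_def)
  have um: "u \<in> borel_measurable (torus X)" using u by auto
  define w where "w x = h (u x)" for x
  have wm: "w \<in> borel_measurable (torus X)" unfolding w_def by (rule measurable_compose[OF um h(2)])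
  have wB: "AE x in torus X. \<bar>w x\<bar> \<le> B" by (simp add: w_def h)
  have B0: "B \<ge> 0" using h(3)[of 0] by linarith
  obtain \<psi> where \<psi>: "\<And>n::nat. trig_poly X (\<psi> n)" "\<And>n x. x \<in> cbox (- X) X \<Longrightarrow> \<bar>\<psi> n x\<bar> \<le> B + 1"
    "(\<lambda>n. \<integral>x. \<bar>\<psi> n x - w x\<bar> \<partial>torus X) \<longlonglongrightarrow> 0"
    by (rule trig_poly_dense_bounded[OF X wm wB]) blast
  have per: "periodic X (\<psi> n)" for n
    by (rule trig_poly_periodic[OF _ \<psi>(1)]) (use X in \<open>simp add: less_imp_neq[THEN not_sym]\<close>)
  have \<psi>m: "\<psi> n \<in> borel_measurable (torus X)" for n by (rule trig_poly_measurable[OF \<psi>(1)])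
  have \<psi>B: "AE x in torus X. \<bar>\<psi> n x\<bar> \<le> B + 1" for n by (rule AE_I2) (simp add: \<psi>(2))
  define J where "J n k = (\<integral>x. u x * \<psi> n (x + k *\<^sub>R ?e) \<partial>torus X)" for n k
  define A where "A n k = (\<integral>x. g x * \<psi> n (x + k *\<^sub>R ?e) \<partial>torus X)" for n k
  have J1: "(J n has_real_derivative - (\<integral>x. v x * \<psi> n (x + k *\<^sub>R ?e) \<partial>torus X)) (at k)" for n k
    unfolding J_def by (rule DERIV_weak_partial_shift[OF X uv \<psi>(1)])
  have J2: "((\<lambda>k. - (\<integral>x. v x * \<psi> n (x + k *\<^sub>R ?e) \<partial>torus X)) has_real_derivative A n k) (at k)" for n k
    unfolding A_def using DERIV_minus[OF DERIV_weak_partial_shift[OF X vg \<psi>(1)], of n k] by simp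
  have gw: "(\<lambda>n. \<integral>x. g x * \<psi> n x \<partial>torus X) \<longlonglongrightarrow> (\<integral>x. g x * w x \<partial>torus X)"
    by (rule trig_poly_approx_mult[OF g wm wB \<psi>m \<psi>B \<psi>(3)])
  have Jlim: "(\<lambda>n. J n k) \<longlonglongrightarrow> (\<integral>x. u x * w (torus_shift X i k x) \<partial>torus X)" for k
  proof -
    have "(\<lambda>n. \<integral>x. u x * \<psi> n (torus_shift X i k x) \<partial>torus X) \<longlonglongrightarrow> (\<integral>x. u x * w (torus_shift X i k x) \<partial>torus X)"
    proof (rule trig_poly_approx_mult[OF u, where B=B and C="B + 1"])
      have "(\<integral>x. \<bar>\<psi> n (torus_shift X i k x) - w (torus_shift X i k x)\<bar> \<partial>torus X) = (\<integral>x. \<bar>\<psi> n x - w x\<bar> \<partial>torus X)" for n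
        by (rule integral_torus_shift[OF X, of "\<lambda>x. \<bar>\<psi> n x - w x\<bar>"]) (use \<psi>m wm in auto)
      then show "(\<lambda>n. \<integral>x. \<bar>\<psi> n (torus_shift X i k x) - w (torus_shift X i k x)\<bar> \<partial>torus X) \<longlonglongrightarrow> 0"
        using \<psi>(3) by simp
    qed (rule borel_measurable_torus_shift[OF X wm] borel_measurable_torus_shift[OF X \<psi>m]
          AE_torus_shift[OF X wB] AE_torus_shift[OF X \<psi>B])+
    then show ?thesis by (simp add: J_def periodic_torus_shift[OF per])
  qed
  have small: "(\<integral>x. g x * w x \<partial>torus X) \<le> (B + 1) * \<eta>" if \<eta>: "\<eta> > 0" for \<eta>
  proof -
    obtain d where d: "d > 0" "\<And>\<xi>. \<bar>\<xi>\<bar> < d \<Longrightarrow> (\<integral>x. \<bar>g (torus_shift X i \<xi> x) - g x\<bar> \<partial>torus X) \<le> \<eta>"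
      using torus_shift_L1_continuous[OF X g \<eta>] by blast
    define k where "k = d / 2"
    have k: "0 < k" "k < d" using d by (auto simp: k_def)
    have Age: "(\<integral>x. g x * \<psi> n x \<partial>torus X) - (B + 1) * \<eta> \<le> A n \<xi>" if "\<bar>\<xi>\<bar> \<le> k" for n \<xi>
    proof -
      have gs: "integrable (torus X) (\<lambda>x. g (torus_shift X i (- \<xi>) x))" by (rule integrable_torus_shift[OF X g])
      have i1: "integrable (torus X) (\<lambda>x. g x * \<psi> n x)" "integrable (torus X) (\<lambda>x. g (torus_shift X i (- \<xi>) x) * \<psi> n x)"
        by (rule integrable_times_trig_poly[OF _ \<psi>(1)]; use g gs in auto)+
      have "A n \<xi> = (\<integral>x. g x * \<psi> n (torus_shift X i \<xi> x) \<partial>torus X)"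
        by (simp add: A_def periodic_torus_shift[OF per])
      also have "\<dots> = (\<integral>x. g (torus_shift X i (- \<xi>) x) * \<psi> n x \<partial>torus X)"
        by (rule torus_shift_adjoint[OF X g \<psi>m])
      finally have "(\<integral>x. g x * \<psi> n x \<partial>torus X) - A n \<xi> = (\<integral>x. g x * \<psi> n x - g (torus_shift X i (- \<xi>) x) * \<psi> n x \<partial>torus X)"
        by (simp only: Bochner_Integration.integral_diff[OF i1])
      also have "\<dots> \<le> (\<integral>x. (B + 1) * \<bar>g (torus_shift X i (- \<xi>) x) - g x\<bar> \<partial>torus X)"
      proof (rule integral_mono)
        fix x assume "x \<in> space (torus X)"
        then have "\<bar>\<psi> n x\<bar> \<le> B + 1" using \<psi>(2) by simp
        then have "\<bar>\<psi> n x\<bar> * \<bar>g (torus_shift X i (- \<xi>) x) - g x\<bar> \<le> (B + 1) * \<bar>g (torus_shift X i (- \<xi>) x) - g x\<bar>"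
          by (rule mult_right_mono) simp
        moreover have "g x * \<psi> n x - g (torus_shift X i (- \<xi>) x) * \<psi> n x \<le> \<bar>\<psi> n x\<bar> * \<bar>g (torus_shift X i (- \<xi>) x) - g x\<bar>"
        proof -
          have "g x * \<psi> n x - g (torus_shift X i (- \<xi>) x) * \<psi> n x = - (\<psi> n x * (g (torus_shift X i (- \<xi>) x) - g x))"
            by (simp add: algebra_simps)
          then show ?thesis unfolding abs_mult[symmetric] by linarith
        qed
        ultimately show "g x * \<psi> n x - g (torus_shift X i (- \<xi>) x) * \<psi> n x \<le> (B + 1) * \<bar>g (torus_shift X i (- \<xi>) x) - g x\<bar>"
          by linarith
      qed (use i1 gs g in auto)
      also have "\<dots> \<le> (B + 1) * \<eta>"
      proof -
        have "(\<integral>x. \<bar>g (torus_shift X i (- \<xi>) x) - g x\<bar> \<partial>torus X) \<le> \<eta>"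
          by (rule d(2)) (use that k in simp)
        then show ?thesis using B0 by (simp only: integral_mult_right_zero) (intro mult_left_mono; simp)
      qed
      finally show ?thesis by linarith
    qed
    have le: "((\<integral>x. g x * \<psi> n x \<partial>torus X) - (B + 1) * \<eta>) * k\<^sup>2 \<le> J n k - 2 * J n 0 + J n (- k)" for n
      by (rule second_difference_ge[OF J1 J2 Age]) (use k in auto)
    have "((\<integral>x. g x * w x \<partial>torus X) - (B + 1) * \<eta>) * k\<^sup>2 \<le>
      (\<integral>x. u x * w (torus_shift X i k x) \<partial>torus X) - 2 * (\<integral>x. u x * w (torus_shift X i 0 x) \<partial>torus X)
       + (\<integral>x. u x * w (torus_shift X i (- k) x) \<partial>torus X)"
    proof (rule LIMSEQ_le)
      show "(\<lambda>n. ((\<integral>x. g x * \<psi> n x \<partial>torus X) - (B + 1) * \<eta>) * k\<^sup>2) \<longlonglongrightarrow> ((\<integral>x. g x * w x \<partial>torus X) - (B + 1) * \<eta>) * k\<^sup>2"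
        by (intro tendsto_intros gw)
      show "(\<lambda>n. J n k - 2 * J n 0 + J n (- k)) \<longlonglongrightarrow> (\<integral>x. u x * w (torus_shift X i k x) \<partial>torus X) - 2 * (\<integral>x. u x * w (torus_shift X i 0 x) \<partial>torus X)
       + (\<integral>x. u x * w (torus_shift X i (- k) x) \<partial>torus X)"
        by (intro tendsto_intros Jlim)
    qed (use le in auto)
    also have "(\<integral>x. u x * w (torus_shift X i 0 x) \<partial>torus X) = (\<integral>x. u x * w x \<partial>torus X)"
    proof (rule integral_cong_AE)
      show "AE x in torus X. u x * w (torus_shift X i 0 x) = u x * w x"
        using AE_torus_box by eventually_elim (simp add: torus_shift_0[OF X])
    qed (use um wm borel_measurable_torus_shift[OF X wm] in auto)
    also have "(\<integral>x. u x * w (torus_shift X i k x) \<partial>torus X) - 2 * (\<integral>x. u x * w x \<partial>torus X)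
       + (\<integral>x. u x * w (torus_shift X i (- k) x) \<partial>torus X) \<le> 0"
      unfolding w_def by (rule monotone_second_difference_nonpos[OF X u h])
    finally show ?thesis using k by (simp add: mult_le_0_iff)
  qed
  have "(\<integral>x. g x * w x \<partial>torus X) \<le> 0 + e" if "e > 0" for e
    using small[of "e / (B + 1)"] that B0 by simp
  then show ?thesis unfolding w_def[symmetric] by (rule field_le_epsilon)
qed

section \<open>Smooth step functions on the real line\<close>

text \<open>The functions \<open>x\<^sup>-\<^sup>k exp (-1/x)\<close>, extended by zero to \<open>x \<le> 0\<close>. The linear span of the family is
  closed under differentiation.\<close>

definition flat :: "nat \<Rightarrow> real \<Rightarrow> real" where
  "flat k x = (if x > 0 then (1 / x) ^ k * exp (- (1 / x)) else 0)"

lemma flat_bound: "\<bar>flat k x\<bar> \<le> fact (k + 2) * x\<^sup>2"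
proof (cases "x > 0")
  case True
  define y where "y = 1 / x"
  have y: "y > 0" using True by (simp add: y_def)
  have "(\<Sum>n\<in>{k + 2}. y ^ n /\<^sub>R fact n) \<le> exp y"
    using sum_le_suminf[OF sums_summable[OF exp_converges[of y]], of "{k + 2}"] y
      sums_unique[OF exp_converges[of y]] by simp
  then have "y ^ (k + 2) / fact (k + 2) \<le> exp y" 
    by (simp del: fact_Suc add: divide_inverse mult.commute)
  then have "y ^ (k + 2) \<le> fact (k + 2) * exp y"
    by (simp only: pos_divide_le_eq[OF fact_gt_zero] mult.commute)
  then have "y ^ (k + 2) * exp (- y) \<le> fact (k + 2) * exp y * exp (- y)"
    by (rule mult_right_mono) simp
  then have *: "y ^ (k + 2) * exp (- y) \<le> fact (k + 2)" by (simp add: exp_minus field_simps del: fact_Suc)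
  have "y ^ k * exp (- y) = (y ^ (k + 2) * exp (- y)) * x\<^sup>2"
    using True by (simp add: y_def power_divide power2_eq_square)
  also have "\<dots> \<le> fact (k + 2) * x\<^sup>2" using * by (rule mult_right_mono) simp
  finally have "y ^ k * exp (- y) \<le> fact (k + 2) * x\<^sup>2" .
  then show ?thesis using True by (simp add: flat_def y_def abs_mult)
qed (simp add: flat_def)

lemma DERIV_flat:
  "(flat k has_real_derivative (flat (k + 2) x - real k * flat (k + 1) x)) (at x)"
proof -
  consider "x < 0" | "x = 0" | "x > 0" by linarith
  then show ?thesis
  proof cases
    case 1
    have "((\<lambda>_. 0) has_real_derivative 0) (at x)" by simp
    then have "(flat k has_real_derivative 0) (at x)"
      by (rule has_field_derivative_transform_within_open[where S="{..<0}"]) (use 1 in \<open>auto simp: flat_def\<close>)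
    then show ?thesis using 1 by (simp add: flat_def)
  next
    case 2
    have "(flat k has_real_derivative 0) (at 0)"
      by (rule DERIV_zero_of_quadratic_bound[where C="fact (k+2)"])
         (use flat_bound[of k] in \<open>simp add: flat_def[of k 0]\<close>)
    then show ?thesis using 2 by (simp add: flat_def)
  next
    case 3
    have g: "((\<lambda>x. 1 / x) has_real_derivative - (1 / x) * (1 / x)) (at x)"
      using 3 by (auto intro!: derivative_eq_intros)
    have h: "((\<lambda>x. exp (- (1 / x))) has_real_derivative exp (- (1 / x)) * ((1 / x) * (1 / x))) (at x)"
      using DERIV_chain2[OF DERIV_exp DERIV_minus[OF g]] by simp
    have "((\<lambda>x. (1 / x) ^ k * exp (- (1 / x))) has_real_derivative
        (flat (k + 2) x - real k * flat (k + 1) x)) (at x)"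
    proof (cases k)
      case 0
      show ?thesis using h 3 unfolding 0 by (simp add: flat_def power2_eq_square mult_ac)
    next
      case (Suc j)
      show ?thesis unfolding Suc
        by (rule DERIV_cong[OF DERIV_mult[OF DERIV_power_Suc[OF g] h]])
           (use 3 in \<open>simp add: flat_def algebra_simps del: power_one_over\<close>)
    qed
    then show ?thesis
      by (rule has_field_derivative_transform_within_open[where S="{0<..}"]) (use 3 in \<open>auto simp: flat_def\<close>)
  qed
qed

text \<open>An algebra that is closed under differentiation and contains the bump \<open>exp (-1/x) exp
  (-1/(1-x))\<close> supported on \<open>[0,1]\<close>.\<close>

inductive bump_algebra :: "(real \<Rightarrow> real) \<Rightarrow> bool" where
  bump_const: "bump_algebra (\<lambda>x. c)"
| bump_left: "bump_algebra (\<lambda>x. flat k x)"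
| bump_right: "bump_algebra (\<lambda>x. flat k (1 - x))"
| bump_add: "bump_algebra u \<Longrightarrow> bump_algebra v \<Longrightarrow> bump_algebra (\<lambda>x. u x + v x)"
| bump_mult: "bump_algebra u \<Longrightarrow> bump_algebra v \<Longrightarrow> bump_algebra (\<lambda>x. u x * v x)"

lemma bump_algebra_DERIV:
  assumes "bump_algebra u"
  shows "\<exists>u'. bump_algebra u' \<and> (\<forall>x. (u has_real_derivative u' x) (at x))"
  using assms
proof induction
  case (bump_const c)
  show ?case by (rule exI[of _ "\<lambda>x. 0"]) (simp add: bump_algebra.bump_const)
next
  case (bump_left k)
  have "bump_algebra (\<lambda>x. flat (k + 2) x + (- real k) * flat (k + 1) x)"
    by (simp only: bump_algebra.intros)
  then show ?case using DERIV_flat[of k] by (intro exI conjI) auto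
next
  case (bump_right k)
  have "bump_algebra (\<lambda>x. (- 1) * flat (k + 2) (1 - x) + real k * flat (k + 1) (1 - x))"
    by (simp only: bump_algebra.intros)
  moreover have "((\<lambda>x. flat k (1 - x)) has_real_derivative
      ((- 1) * flat (k + 2) (1 - x) + real k * flat (k + 1) (1 - x))) (at x)" for x
    by (rule DERIV_cong[OF DERIV_chain2[OF DERIV_flat, of "\<lambda>x. 1 - x" "- 1"]])
       (auto intro!: derivative_eq_intros)
  ultimately show ?case by (intro exI[of _ "\<lambda>x. (- 1) * flat (k + 2) (1 - x) + real k * flat (k + 1) (1 - x)"] conjI allI)
next
  case (bump_add u v)
  then obtain u' v' where 1: "bump_algebra u'" "\<forall>x. (u has_real_derivative u' x) (at x)"
    "bump_algebra v'" "\<forall>x. (v has_real_derivative v' x) (at x)" by auto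
  then show ?case
    by (intro exI[of _ "\<lambda>x. u' x + v' x"]) (auto intro!: derivative_intros bump_algebra.bump_add)
next
  case (bump_mult u v)
  then obtain u' v' where 1: "bump_algebra u'" "\<forall>x. (u has_real_derivative u' x) (at x)"
    "bump_algebra v'" "\<forall>x. (v has_real_derivative v' x) (at x)" by auto
  have "bump_algebra (\<lambda>x. u' x * v x + v' x * u x)"
    using bump_mult 1 by (simp only: bump_algebra.intros)
  then show ?case using 1
    by (intro exI[of _ "\<lambda>x. u' x * v x + v' x * u x"]) (auto intro!: DERIV_mult)
qed

lemma frechet_derivative_real:
  "(u has_real_derivative D) (at x) \<Longrightarrow> frechet_derivative u (at x) 1 = D"
  unfolding has_field_derivative_def by (drule frechet_derivative_at, drule fun_cong[of _ _ 1]) simp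

lemma smooth_realI:
  fixes u :: "real \<Rightarrow> real"
  assumes "\<And>x. (u has_real_derivative u' x) (at x)" and "smooth u'"
  shows "smooth u"
proof (rule smooth.intros)
  show "\<forall>x. u differentiable (at x)"
    using assms(1) by (auto simp: real_differentiable_def)
  show "\<forall>b\<in>Basis. smooth (\<lambda>x. frechet_derivative u (at x) b)"
    using assms frechet_derivative_real[OF assms(1)] by simp
qed

lemma smooth_realD:
  fixes u :: "real \<Rightarrow> real"
  assumes "smooth u" shows "(u has_real_derivative deriv u x) (at x)" "smooth (deriv u)"
proof -
  show D: "(u has_real_derivative deriv u x) (at x)" for x
    using assms by (cases rule: smooth.cases)
      (auto simp: real_differentiable_def dest!: spec[of _ x] intro: DERIV_imp_deriv[THEN ssubst])
  have "(\<lambda>x. frechet_derivative u (at x) 1) = deriv u"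
    using frechet_derivative_real[OF D] by auto
  then show "smooth (deriv u)"
    using assms by (auto elim: smooth.cases)
qed

lemma smooth_real_coinduct:
  assumes "P u" and "\<And>u. P u \<Longrightarrow> \<exists>u'. P u' \<and> (\<forall>x. (u has_real_derivative u' x) (at x))"
  shows "smooth (u :: real \<Rightarrow> real)"
  using assms(1)
proof (coinduction arbitrary: u)
  case (smooth u)
  then obtain u' where u': "P u'" "\<forall>x. (u has_real_derivative u' x) (at x)" using assms(2) by auto
  then have "(\<lambda>x. frechet_derivative u (at x) 1) = u'"
    using frechet_derivative_real by auto
  then show ?case using u' by (auto simp: real_differentiable_def)
qed

lemma smooth_bump_algebra: "bump_algebra u \<Longrightarrow> smooth u"
  using smooth_real_coinduct[of bump_algebra] bump_algebra_DERIV by simp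

lemma smooth_real_lincomb:
  fixes u v :: "real \<Rightarrow> real"
  assumes "smooth u" "smooth v"
  shows "smooth (\<lambda>x. c * u (a * x + b) + d * v (p * x + q))"
proof (rule smooth_real_coinduct[where P="\<lambda>f. \<exists>u v c d. smooth u \<and> smooth v \<and> f = (\<lambda>x. c * u (a * x + b) + d * v (p * x + q))"])
  show "\<exists>u' v' c' d'. smooth u' \<and> smooth v' \<and> (\<lambda>x. c * u (a * x + b) + d * v (p * x + q)) =
      (\<lambda>x. c' * u' (a * x + b) + d' * v' (p * x + q))" using assms by blast
  fix f assume "\<exists>u v c d. smooth u \<and> smooth v \<and> f = (\<lambda>x. c * u (a * x + b) + d * v (p * x + q))"
  then obtain u v c d where *: "smooth u" "smooth v" "f = (\<lambda>x. c * u (a * x + b) + d * v (p * x + q))"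
    by auto
  let ?f' = "\<lambda>x. (c * a) * deriv u (a * x + b) + (d * p) * deriv v (p * x + q)"
  have "(f has_real_derivative ?f' x) (at x)" for x
    unfolding *(3)
    by (rule derivative_eq_intros DERIV_chain2[OF smooth_realD(1)[OF *(1)]] DERIV_chain2[OF smooth_realD(1)[OF *(2)]] refl | simp)+
  moreover have "smooth (deriv u)" "smooth (deriv v)" using smooth_realD * by auto
  ultimately show "\<exists>u'. (\<exists>u v c d. smooth u \<and> smooth v \<and> u' = (\<lambda>x. c * u (a * x + b) + d * v (p * x + q))) \<and>
      (\<forall>x. (f has_real_derivative u' x) (at x))"
    by (intro exI[of _ ?f'] conjI exI[of _ "deriv u"] exI[of _ "deriv v"] exI[of _ "c * a"] exI[of _ "d * p"]) auto
qed

text \<open>The normalised antiderivative of the bump is a smooth step from \<open>0\<close> to \<open>1\<close>.\<close>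

lemma smooth_step_exists:
  obtains S S' :: "real \<Rightarrow> real" where "smooth S" "\<And>x. (S has_real_derivative S' x) (at x)"
    "continuous_on UNIV S'" "\<And>x. 0 \<le> S' x" "\<And>x. x \<le> 0 \<or> 1 \<le> x \<Longrightarrow> S' x = 0"
    "\<And>x. x \<le> 0 \<Longrightarrow> S x = 0" "\<And>x. 1 \<le> x \<Longrightarrow> S x = 1" "mono S"
proof -
  define \<beta> where "\<beta> x = flat 0 x * flat 0 (1 - x)" for x
  have "bump_algebra \<beta>" unfolding \<beta>_def[abs_def] by (simp only: bump_algebra.intros)
  then have sm: "smooth \<beta>" by (rule smooth_bump_algebra)
  have cont: "isCont \<beta> x" for x using smooth_realD(1)[OF sm] by (rule DERIV_isCont)
  have pos: "\<beta> x > 0" if "0 < x" "x < 1" for x using that by (simp add: \<beta>_def flat_def)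
  have nonneg: "\<beta> x \<ge> 0" for x by (simp add: \<beta>_def flat_def)
  have zero: "\<beta> x = 0" if "x \<le> 0 \<or> 1 \<le> x" for x using that by (auto simp: \<beta>_def flat_def)
  obtain F where "\<And>x. (F has_vector_derivative \<beta> x) (at x)"
    using einterval_antiderivative[of "-\<infinity>" \<infinity> \<beta>] cont by auto
  then have F: "(F has_real_derivative \<beta> x) (at x)" for x
    by (simp add: has_real_derivative_iff_has_vector_derivative)
  have monoF: "F x \<le> F y" if "x \<le> y" for x y
    by (rule DERIV_nonneg_imp_nondecreasing[OF that]) (use F nonneg in blast)
  have lt: "F 0 < F 1"
  proof -
    obtain z where "0 < z" "z < 1" "F 1 - F 0 = (1 - 0) * \<beta> z"
      using MVT2[of 0 1 F \<beta>] F by auto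
    then show ?thesis using pos[of z] by simp
  qed
  have left: "F x = F 0" if "x \<le> 0" for x
  proof (cases "x = 0")
    case False
    then have "x < 0" using that by simp
    then obtain z where "x < z" "z < 0" "F 0 - F x = (0 - x) * \<beta> z"
      using MVT2[OF \<open>x < 0\<close> F] by blast
    then show ?thesis using zero[of z] by simp
  qed simp
  have right: "F x = F 1" if "1 \<le> x" for x
  proof (cases "x = 1")
    case False
    then have "1 < x" using that by simp
    then obtain z where "1 < z" "z < x" "F x - F 1 = (x - 1) * \<beta> z"
      using MVT2[OF \<open>1 < x\<close> F] by blast
    then show ?thesis using zero[of z] by simp
  qed simp
  define d where "d = 1 / (F 1 - F 0)"
  have d: "d > 0" using lt by (simp add: d_def)
  let ?S = "\<lambda>x. d * (F x - F 0)" and ?S' = "\<lambda>x. d * \<beta> x"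
  have D: "(?S has_real_derivative ?S' x) (at x)" for x
    by (auto intro!: derivative_eq_intros F)
  have smS': "smooth ?S'" using smooth_real_lincomb[OF sm sm, of d 1 0 0] by simp
  show ?thesis
  proof
    show "smooth ?S" by (rule smooth_realI[OF D smS'])
    show "(?S has_real_derivative ?S' x) (at x)" for x by (rule D)
    show "continuous_on UNIV ?S'" using cont by (intro continuous_intros) (simp add: continuous_at_imp_continuous_on)
    show "0 \<le> ?S' x" for x using d nonneg by simp
    show "?S' x = 0" if "x \<le> 0 \<or> 1 \<le> x" for x using zero[OF that] by simp
    show "?S x = 0" if "x \<le> 0" for x using left[OF that] by simp
    show "?S x = 1" if "1 \<le> x" for x using right[OF that] lt by (simp add: d_def)
    show "mono ?S" using monoF d by (auto intro!: monoI)
  qed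
qed

section \<open>Increments of functions with a distributional derivative\<close>

lemma integrable_lebesgue_on_Ioo_continuous:
  fixes f :: "real \<Rightarrow> real"
  assumes "continuous_on {a..b} f" shows "integrable (lebesgue_on {a<..<b}) f"
proof -
  have "set_integrable lebesgue {a..b} f" by (rule absolutely_integrable_continuous_real[OF assms])
  then have "set_integrable lebesgue {a<..<b} f" by (rule set_integrable_subset) auto
  then show ?thesis by (simp add: set_integrable_def integrable_restrict_space)
qed

text \<open>The rescaled derivatives \<open>\<rho> n\<close> of the step are mollifiers supported to the right of \<open>s\<close>.\<close>

lemma bump_mean_tendsto:
  fixes S S' G :: "real \<Rightarrow> real" and \<delta> :: "nat \<Rightarrow> real"
  assumes S: "\<And>x. (S has_real_derivative S' x) (at x)" and S'c: "continuous_on UNIV S'"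
    and S'0: "\<And>x. 0 \<le> S' x" and S'z: "\<And>x. x \<le> 0 \<or> 1 \<le> x \<Longrightarrow> S' x = 0"
    and S0: "\<And>x. x \<le> 0 \<Longrightarrow> S x = 0" and S1: "\<And>x. 1 \<le> x \<Longrightarrow> S x = 1"
    and G: "continuous_on {0..T} G" and s: "0 < s" and \<delta>: "\<And>n. 0 < \<delta> n" "\<And>n. s + \<delta> n \<le> T"
    and \<delta>lim: "\<delta> \<longlonglongrightarrow> 0"
  defines "\<rho> \<equiv> \<lambda>n x. S' ((x - s) / \<delta> n) / \<delta> n"
  shows "\<And>n. integrable (lebesgue_on {0<..<T}) (\<lambda>x. G x * \<rho> n x)"
    and "(\<lambda>n. \<integral>x. G x * \<rho> n x \<partial>lebesgue_on {0<..<T}) \<longlonglongrightarrow> G s"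
proof -
  have sT: "s < T" using \<delta>[of 0] by linarith
  have \<rho>c: "continuous_on A (\<rho> n)" for n A
    unfolding \<rho>_def
    by (intro continuous_intros continuous_on_compose2[OF S'c]) (use \<delta>(1)[of n] in auto)
  have \<rho>0: "\<rho> n x \<ge> 0" for n x unfolding \<rho>_def using S'0 \<delta>(1)[of n] by simp
  have \<rho>z: "\<rho> n x = 0" if "x \<le> s \<or> s + \<delta> n \<le> x" for n x
  proof -
    have "(x - s) / \<delta> n \<le> 0 \<or> 1 \<le> (x - s) / \<delta> n"
      using that \<delta>(1)[of n] by (auto simp: field_simps)
    then show ?thesis using S'z by (simp add: \<rho>_def)
  qed
  show int: "integrable (lebesgue_on {0<..<T}) (\<lambda>x. G x * \<rho> n x)" for n
    by (intro integrable_lebesgue_on_Ioo_continuous continuous_intros G \<rho>c)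
  have \<rho>i: "integrable (lebesgue_on {0<..<T}) (\<rho> n)" for n
    by (intro integrable_lebesgue_on_Ioo_continuous \<rho>c)
  have one: "(\<integral>x. \<rho> n x \<partial>lebesgue_on {0<..<T}) = 1" for n
  proof -
    let ?P = "\<lambda>x. S ((x - s) / \<delta> n)"
    have "(?P has_real_derivative \<rho> n x) (at x)" for x
      unfolding \<rho>_def using \<delta>(1)[of n]
      by (auto intro!: DERIV_cong[OF DERIV_chain2[OF S]] derivative_eq_intros)
    then have "(\<rho> n has_integral ?P T - ?P 0) {0..T}"
      using s sT by (intro fundamental_theorem_of_calculus)
        (auto simp: has_real_derivative_iff_has_vector_derivative[symmetric] intro: DERIV_subset)
    moreover have "?P 0 = 0" using s \<delta>(1)[of n] by (intro S0) (simp add: field_simps)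
    moreover have "?P T = 1" using \<delta>[of n] by (intro S1) (simp add: field_simps)
    ultimately have "(\<rho> n has_integral 1) {0<..<T}" by (simp add: has_integral_Icc_iff_Ioo)
    then show ?thesis
      using lebesgue_integral_eq_integral[OF \<rho>i] by (simp add: integral_unique)
  qed
  show "(\<lambda>n. \<integral>x. G x * \<rho> n x \<partial>lebesgue_on {0<..<T}) \<longlonglongrightarrow> G s"
  proof (rule LIMSEQ_I)
    fix \<epsilon> :: real assume \<epsilon>: "\<epsilon> > 0"
    have "s \<in> {0..T}" using s sT by auto
    with G \<epsilon> obtain d where d: "d > 0"
      "\<And>x. x \<in> {0..T} \<Longrightarrow> dist x s < d \<Longrightarrow> dist (G x) (G s) < \<epsilon> / 2"
      unfolding continuous_on_iff using half_gt_zero[OF \<epsilon>] by blast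
    from LIMSEQ_D[OF \<delta>lim d(1)] obtain N where N: "\<And>n. n \<ge> N \<Longrightarrow> \<delta> n < d" by force
    have "norm ((\<integral>x. G x * \<rho> n x \<partial>lebesgue_on {0<..<T}) - G s) < \<epsilon>" if n: "n \<ge> N" for n
    proof -
      let ?M = "lebesgue_on {0<..<T}"
      have "(\<integral>x. G x * \<rho> n x \<partial>?M) - G s = (\<integral>x. G x * \<rho> n x \<partial>?M) - (\<integral>x. G s * \<rho> n x \<partial>?M)"
        using one[of n] by simp
      also have "\<dots> = (\<integral>x. G x * \<rho> n x - G s * \<rho> n x \<partial>?M)"
        by (rule Bochner_Integration.integral_diff[symmetric]) (use int \<rho>i in auto)
      also have "\<bar>\<dots>\<bar> \<le> (\<integral>x. \<bar>G x * \<rho> n x - G s * \<rho> n x\<bar> \<partial>?M)" by (rule integral_abs_bound)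
      also have "\<dots> \<le> (\<integral>x. (\<epsilon> / 2) * \<rho> n x \<partial>?M)"
      proof (rule integral_mono)
        show "integrable ?M (\<lambda>x. \<bar>G x * \<rho> n x - G s * \<rho> n x\<bar>)" using int[of n] \<rho>i[of n] by auto
        show "integrable ?M (\<lambda>x. (\<epsilon> / 2) * \<rho> n x)" using \<rho>i[of n] by auto
        fix x assume "x \<in> space ?M"
        then have x: "x \<in> {0..T}" by auto
        show "\<bar>G x * \<rho> n x - G s * \<rho> n x\<bar> \<le> (\<epsilon> / 2) * \<rho> n x"
        proof (cases "\<rho> n x = 0")
          case False
          then have "s < x" "x < s + \<delta> n" using \<rho>z[of x n] by (meson not_le)+
          then have "dist x s < d" using N[OF n] by (simp add: dist_real_def)
          then have "\<bar>G x - G s\<bar> \<le> \<epsilon> / 2" using d(2)[OF x] by (simp add: dist_real_def)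
          then have "\<bar>G x - G s\<bar> * \<rho> n x \<le> (\<epsilon> / 2) * \<rho> n x" using \<rho>0 by (rule mult_right_mono)
          then show ?thesis using \<rho>0[of n x] by (simp add: left_diff_distrib[symmetric] abs_mult)
        qed simp
      qed
      also have "\<dots> = \<epsilon> / 2" using one[of n] by simp
      finally show ?thesis using \<epsilon> by simp
    qed
    then show "\<exists>N. \<forall>n\<ge>N. norm ((\<integral>x. G x * \<rho> n x \<partial>lebesgue_on {0<..<T}) - G s) < \<epsilon>" by blast
  qed
qed

lemma test_function_step:
  fixes S :: "real \<Rightarrow> real"
  assumes S: "smooth S" "\<And>x. x \<le> 0 \<Longrightarrow> S x = 0" "\<And>x. 1 \<le> x \<Longrightarrow> S x = 1"
    and ab: "0 < a" "a \<le> b" "0 < \<alpha>" "0 < \<beta>" "a + \<alpha> < T" "b + \<beta> < T"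
  shows "test_function T (\<lambda>x. S ((x - a) / \<alpha>) - S ((x - b) / \<beta>))" (is "test_function T ?\<eta>")
proof -
  let ?m = "max (a + \<alpha>) (b + \<beta>)"
  have sm: "smooth ?\<eta>"
    using smooth_real_lincomb[OF S(1) S(1), of 1 "1 / \<alpha>" "- a / \<alpha>" "-1" "1 / \<beta>" "- b / \<beta>"]
    by (simp add: diff_divide_distrib)
  have "{t. ?\<eta> t \<noteq> 0} \<subseteq> {a..?m}"
  proof (clarify, rule ccontr)
    fix t assume t: "?\<eta> t \<noteq> 0" "t \<notin> {a..?m}"
    then consider "t < a" | "?m < t" by fastforce
    then show False
    proof cases
      case 1
      then have "(t - a) / \<alpha> \<le> 0" "(t - b) / \<beta> \<le> 0" using ab by (auto simp: field_simps)
      then show False using t(1) S(2) by simp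
    next
      case 2
      then have "1 \<le> (t - a) / \<alpha>" "1 \<le> (t - b) / \<beta>" using ab by (auto simp: field_simps)
      then show False using t(1) S(3) by simp
    qed
  qed
  then have cl: "closure {t. ?\<eta> t \<noteq> 0} \<subseteq> {a..?m}" by (rule closure_minimal) simp
  then have "compact (closure {t. ?\<eta> t \<noteq> 0})"
    by (meson bounded_closed_interval bounded_subset closed_closure compact_eq_bounded_closed)
  moreover have "closure {t. ?\<eta> t \<noteq> 0} \<subseteq> {0<..<T}" using cl ab by (intro order_trans[OF cl]) auto
  ultimately show ?thesis using sm by (simp add: test_function_def)
qed

text \<open>Test with the smooth approximations \<open>\<eta> n\<close> of the indicator function of \<open>(s,t]\<close>, differences of
  two steps of width \<open>\<delta> n\<close>: their derivatives concentrate at \<open>s\<close> and \<open>t\<close>.\<close>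

lemma distributional_deriv_increment:
  assumes D: "distributional_deriv T G R" and G: "continuous_on {0..T} G"
    and st: "0 < s" "s < t" "t < T"
  shows "set_integrable lebesgue {s<..t} R"
    and "(\<integral>x\<in>{s<..t}. R x \<partial>lebesgue) = G t - G s"
proof -
  obtain S S' :: "real \<Rightarrow> real" where S: "smooth S" and DS: "\<And>x. (S has_real_derivative S' x) (at x)"
    and S'c: "continuous_on UNIV S'" and S'0: "\<And>x. 0 \<le> S' x"
    and S'z: "\<And>x. x \<le> 0 \<or> 1 \<le> x \<Longrightarrow> S' x = 0"
    and S0: "\<And>x. x \<le> 0 \<Longrightarrow> S x = 0" and S1: "\<And>x. 1 \<le> x \<Longrightarrow> S x = 1" and mono: "mono S"
    by (rule smooth_step_exists) blast
  have S01: "0 \<le> S x" "S x \<le> 1" for x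
    using monoD[OF mono, of "min 0 x" x] monoD[OF mono, of x "max 1 x"] S0[of "min 0 x"] S1[of "max 1 x"] by auto
  let ?M = "lebesgue_on {0<..<T}"
  have test: "integrable ?M (\<lambda>x. R x * \<eta> x)"
      "- (\<integral>t. G t * deriv \<eta> t \<partial>?M) = (\<integral>t. R t * \<eta> t \<partial>?M)" if "test_function T \<eta>" for \<eta>
    using D that by (auto simp: distributional_deriv_def)
  define b where "b = (t + T) / 2"
  have b: "t < b" "b < T" using st by (auto simp: b_def)
  \<comment> \<open>A test function equal to \<open>1\<close> on \<open>{s..b}\<close> shows that \<open>R\<close> itself is integrable there.\<close>
  define \<eta>0 where "\<eta>0 x = S ((x - s / 2) / (s / 2)) - S ((x - b) / ((T - b) / 2))" for x
  have \<eta>0: "test_function T \<eta>0"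
    unfolding \<eta>0_def using b st by (intro test_function_step S S0 S1) (auto simp: field_simps)
  have \<eta>01: "\<eta>0 x = 1" if "x \<in> {s..b}" for x
  proof -
    have "1 \<le> (x - s / 2) / (s / 2)" using that st by (simp add: field_simps)
    moreover have "(x - b) / ((T - b) / 2) \<le> 0" using that b by (simp add: field_simps)
    ultimately show ?thesis using S0 S1 by (simp add: \<eta>0_def)
  qed
  have Rb: "integrable ?M (\<lambda>x. indicator {s..b} x * R x)"
  proof -
    have "integrable ?M (\<lambda>x. indicator {s..b} x *\<^sub>R (R x * \<eta>0 x))"
      by (rule integrable_mult_indicator[OF _ test(1)[OF \<eta>0]]) (use st b in \<open>auto simp: sets_restrict_space_iff\<close>)
    also have "(\<lambda>x. indicator {s..b} x *\<^sub>R (R x * \<eta>0 x)) = (\<lambda>x. indicator {s..b} x * R x)"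
      using \<eta>01 by (auto simp: fun_eq_iff indicator_def)
    finally show ?thesis .
  qed
  have Rb': "integrable ?M (\<lambda>x. indicator {s<..t} x * R x)"
  proof -
    have "integrable ?M (\<lambda>x. indicator {s<..t} x *\<^sub>R (indicator {s..b} x * R x))"
      by (rule integrable_mult_indicator[OF _ Rb]) (use st b in \<open>auto simp: sets_restrict_space_iff\<close>)
    also have "(\<lambda>x. indicator {s<..t} x *\<^sub>R (indicator {s..b} x * R x)) = (\<lambda>x. indicator {s<..t} x * R x)"
      using b by (auto simp: fun_eq_iff indicator_def)
    finally show ?thesis .
  qed
  have ind: "indicator {0<..<T} x * (indicator {s<..t} x * R x) = indicator {s<..t} x * R x" for x
    using st by (auto simp: indicator_def)
  show "set_integrable lebesgue {s<..t} R"
    using Rb' by (simp add: integrable_restrict_space ind set_integrable_def)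
  have eqI: "(\<integral>x. indicator {s<..t} x * R x \<partial>?M) = (\<integral>x\<in>{s<..t}. R x \<partial>lebesgue)"
    by (simp add: integral_restrict_space ind set_lebesgue_integral_def)
  define \<delta> where "\<delta> n = (b - t) * inverse (real (Suc n))" for n
  have \<delta>0: "\<delta> n > 0" for n using b by (simp add: \<delta>_def)
  have \<delta>b: "\<delta> n \<le> b - t" for n using b by (simp add: \<delta>_def mult_left_le inverse_le_1_iff)
  have \<delta>lim: "\<delta> \<longlonglongrightarrow> 0"
    using tendsto_mult_left[OF LIMSEQ_inverse_real_of_nat, of "b - t"] by (simp add: \<delta>_def[abs_def])
  define \<eta> where "\<eta> n x = S ((x - s) / \<delta> n) - S ((x - t) / \<delta> n)" for n x
  have tf: "test_function T (\<eta> n)" for n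
    unfolding \<eta>_def using b st \<delta>0[of n] \<delta>b[of n] by (intro test_function_step S S0 S1) auto
  have \<eta>B: "\<bar>\<eta> n x\<bar> \<le> 1" for n x
    using S01[of "(x - s) / \<delta> n"] S01[of "(x - t) / \<delta> n"] by (auto simp: \<eta>_def)
  have \<eta>z: "\<eta> n x = 0" if "x \<le> s \<or> b \<le> x" for n x
  proof -
    have "((x - s) / \<delta> n \<le> 0 \<and> (x - t) / \<delta> n \<le> 0) \<or> (1 \<le> (x - s) / \<delta> n \<and> 1 \<le> (x - t) / \<delta> n)"
      using that \<delta>0[of n] \<delta>b[of n] st by (auto simp: field_simps)
    then show ?thesis using S0 S1 by (auto simp: \<eta>_def)
  qed
  have \<eta>lim: "(\<lambda>n. \<eta> n x) \<longlonglongrightarrow> indicator {s<..t} x" for x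
  proof -
    have far: "\<forall>\<^sub>F n in sequentially. S ((x - a) / \<delta> n) = 1" if "a < x" for a
    proof -
      have "\<forall>\<^sub>F n in sequentially. \<delta> n < x - a"
        using order_tendstoD(2)[OF \<delta>lim, of "x - a"] that by simp
      then show ?thesis
        by eventually_elim (use \<delta>0 S1 in \<open>simp add: field_simps\<close>)
    qed
    have near: "S ((x - a) / \<delta> n) = 0" if "x \<le> a" for a n
      using that \<delta>0[of n] by (intro S0) (simp add: field_simps)
    consider "x \<le> s" | "s < x" "x \<le> t" | "t < x" by linarith
    then have "\<forall>\<^sub>F n in sequentially. \<eta> n x = indicator {s<..t} x"
    proof cases
      case 1 then show ?thesis using near[of s] near[of t] st by (simp add: \<eta>_def)
    next
      case 2 then show ?thesis using far[of s] near[of t] by (simp add: \<eta>_def)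
    next
      case 3 then show ?thesis using far[of s] far[of t] st
        by (auto simp: \<eta>_def elim: eventually_elim2)
    qed
    then show ?thesis by (rule tendsto_eventually)
  qed
  have Sc: "continuous_on UNIV S" using DS DERIV_isCont continuous_at_imp_continuous_on by blast
  have \<eta>m: "\<eta> n \<in> borel_measurable ?M" for n
  proof -
    have "continuous_on UNIV (\<eta> n)"
      unfolding \<eta>_def by (intro continuous_intros continuous_on_compose2[OF Sc]) (use \<delta>0[of n] in auto)
    then show ?thesis
      by (intro continuous_imp_measurable_on_sets_lebesgue) (auto intro: continuous_on_subset)
  qed
  have lim1: "(\<lambda>n. \<integral>x. R x * \<eta> n x \<partial>?M) \<longlonglongrightarrow> (\<integral>x. indicator {s<..t} x * R x \<partial>?M)"
  proof (rule integral_dominated_convergence[where w = "\<lambda>x. \<bar>indicator {s..b} x * R x\<bar>"])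
    show "(\<lambda>x. R x * \<eta> n x) \<in> borel_measurable ?M" for n using test(1)[OF tf] by auto
    show "(\<lambda>x. indicator {s<..t} x * R x) \<in> borel_measurable ?M" using Rb' by auto
    show "integrable ?M (\<lambda>x. \<bar>indicator {s..b} x * R x\<bar>)" using Rb by auto
    show "AE x in ?M. (\<lambda>n. R x * \<eta> n x) \<longlonglongrightarrow> indicator {s<..t} x * R x"
      using tendsto_mult_left[OF \<eta>lim] by (auto simp: mult.commute)
    show "AE x in ?M. norm (R x * \<eta> n x) \<le> \<bar>indicator {s..b} x * R x\<bar>" for n
    proof (rule AE_I2)
      fix x
      show "norm (R x * \<eta> n x) \<le> \<bar>indicator {s..b} x * R x\<bar>"
      proof (cases "x \<in> {s..b}")
        case True
        then show ?thesis using \<eta>B[of n x] mult_left_mono[OF \<eta>B[of n x], of "\<bar>R x\<bar>"] by (simp add: abs_mult)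
      next
        case False then show ?thesis using \<eta>z[of x n] by auto
      qed
    qed
  qed
  have der: "deriv (\<eta> n) x = S' ((x - s) / \<delta> n) / \<delta> n - S' ((x - t) / \<delta> n) / \<delta> n" for n x
    unfolding \<eta>_def using \<delta>0[of n]
    by (intro DERIV_imp_deriv) (auto intro!: derivative_eq_intros DERIV_cong[OF DERIV_chain2[OF DS]])
  note bm = bump_mean_tendsto[OF DS S'c S'0 S'z S0 S1 G, of _ \<delta>]
  have s': "0 < s" "\<And>n. s + \<delta> n \<le> T" and t': "0 < t" "\<And>n. t + \<delta> n \<le> T"
  proof -
    fix n show "s + \<delta> n \<le> T" "t + \<delta> n \<le> T" using st b \<delta>b[of n] by linarith+
  qed (use st in auto)
  have lim2: "(\<lambda>n. (\<integral>x. G x * (S' ((x - s) / \<delta> n) / \<delta> n) \<partial>?M) - (\<integral>x. G x * (S' ((x - t) / \<delta> n) / \<delta> n) \<partial>?M)) \<longlonglongrightarrow> G s - G t"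
    by (intro tendsto_diff bm(2) s' t' \<delta>0 \<delta>lim)
  have "(\<integral>x. R x * \<eta> n x \<partial>?M) = - ((\<integral>x. G x * (S' ((x - s) / \<delta> n) / \<delta> n) \<partial>?M) - (\<integral>x. G x * (S' ((x - t) / \<delta> n) / \<delta> n) \<partial>?M))" for n
  proof -
    have "(\<integral>x. G x * (S' ((x - s) / \<delta> n) / \<delta> n) \<partial>?M) - (\<integral>x. G x * (S' ((x - t) / \<delta> n) / \<delta> n) \<partial>?M)
       = (\<integral>x. G x * deriv (\<eta> n) x \<partial>?M)"
      unfolding der right_diff_distrib
      by (rule Bochner_Integration.integral_diff[symmetric]; intro bm(1) s' t' \<delta>0 \<delta>lim)
    then show ?thesis using test(2)[OF tf, of n] by simp
  qed
  then have "(\<lambda>n. \<integral>x. R x * \<eta> n x \<partial>?M) \<longlonglongrightarrow> - (G s - G t)"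
    using tendsto_minus[OF lim2] by simp
  then show "(\<integral>x\<in>{s<..t}. R x \<partial>lebesgue) = G t - G s"
    using LIMSEQ_unique[OF lim1] eqI by simp
qed

section \<open>The nonlinearities and the Laplacian\<close>

lemma deriv_W_pot: "deriv W_pot s = 36 * (s\<^sup>2 - s) * (2 * s - 1)"
proof (rule DERIV_imp_deriv)
  have "((\<lambda>s. 18 * (s\<^sup>2 - s)\<^sup>2) has_real_derivative 36 * (s\<^sup>2 - s) * (2 * s - 1)) (at s)"
    by (auto intro!: derivative_eq_intros simp: algebra_simps power2_eq_square)
  then show "(W_pot has_real_derivative 36 * (s\<^sup>2 - s) * (2 * s - 1)) (at s)"
    by (simp add: W_pot_def[abs_def])
qed

lemma abs_deriv_W_pot_le: "\<bar>deriv W_pot s\<bar> \<le> 216 * (1 + \<bar>s\<bar> ^ 3)"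
proof -
  define a where "a = \<bar>s\<bar>"
  have a: "a \<ge> 0" by (simp add: a_def)
  have low: "a \<le> 1 + a ^ 3" "a\<^sup>2 \<le> 1 + a ^ 3"
  proof -
    have "a ^ 1 \<le> 1 + a ^ 3 \<and> a ^ 2 \<le> 1 + a ^ 3"
    proof (cases "a \<le> 1")
      case True
      then show ?thesis using power_le_one[OF a True, of 2] power_le_one[OF a True, of 1] a by (auto intro: add_increasing2)
    next
      case False
      then have "1 \<le> a" by simp
      then have "a ^ 1 \<le> a ^ 3" "a ^ 2 \<le> a ^ 3" by (intro power_increasing; simp)+
      then show ?thesis by simp
    qed
    then show "a \<le> 1 + a ^ 3" "a\<^sup>2 \<le> 1 + a ^ 3" by auto
  qed
  have "\<bar>s\<^sup>2 - s\<bar> \<le> a\<^sup>2 + a" using abs_triangle_ineq4[of "s\<^sup>2" s] by (simp add: a_def)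
  moreover have "\<bar>2 * s - 1\<bar> \<le> 2 * a + 1" by (simp add: a_def abs_if)
  ultimately have "\<bar>s\<^sup>2 - s\<bar> * \<bar>2 * s - 1\<bar> \<le> (a\<^sup>2 + a) * (2 * a + 1)"
    using a by (intro mult_mono) auto
  also have "\<dots> = 2 * a ^ 3 + 3 * a\<^sup>2 + a" by (simp add: algebra_simps power2_eq_square power3_eq_cube)
  also have "\<dots> \<le> 6 * (1 + a ^ 3)" using low a by simp
  finally have "36 * (\<bar>s\<^sup>2 - s\<bar> * \<bar>2 * s - 1\<bar>) \<le> 36 * (6 * (1 + a ^ 3))" by (rule mult_left_mono) simp
  then show ?thesis unfolding deriv_W_pot abs_mult a_def by (simp add: mult.assoc)
qed

lemma deriv_f_ext: "deriv f_ext s = (if 0 \<le> s \<and> s \<le> 1 then 6 * s * (1 - s) else 0)"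
proof (rule DERIV_imp_deriv)
  have q: "0 \<le> f_ext s \<and> f_ext s \<le> 3 * s\<^sup>2" for s
  proof -
    have "0 \<le> s\<^sup>2 * (3 - 2 * s)" "s\<^sup>2 * (3 - 2 * s) \<le> s\<^sup>2 * 3" if "0 \<le> s" "s \<le> 1"
      using that by (auto intro: mult_left_mono)
    moreover have "s\<^sup>2 * (3 - 2 * s) = 3 * s\<^sup>2 - 2 * s ^ 3" by (simp add: algebra_simps power2_eq_square power3_eq_cube)
    moreover have "1 \<le> 3 * s\<^sup>2" if "1 < s" using one_le_power[of s 2] that by linarith
    ultimately show ?thesis by (auto simp: f_ext_def)
  qed
  have sym: "f_ext s = 1 - f_ext (1 - s)" for s
    by (auto simp: f_ext_def power2_eq_square power3_eq_cube algebra_simps)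
  consider "s < 0" | "s = 0" | "0 < s" "s < 1" | "s = 1" | "1 < s" by linarith
  then show "(f_ext has_real_derivative (if 0 \<le> s \<and> s \<le> 1 then 6 * s * (1 - s) else 0)) (at s)"
  proof cases
    case 1
    have "((\<lambda>_. 0) has_real_derivative 0) (at s)" by simp
    then have "(f_ext has_real_derivative 0) (at s)"
      by (rule has_field_derivative_transform_within_open[where S="{..<0}"]) (use 1 in \<open>auto simp: f_ext_def\<close>)
    then show ?thesis using 1 by simp
  next
    case 2
    have "(f_ext has_real_derivative 0) (at 0)"
      by (rule DERIV_zero_of_quadratic_bound[where C=3]) (use q in \<open>simp add: f_ext_def[of 0]\<close>)
    then show ?thesis using 2 by simp
  next
    case 3
    have "((\<lambda>s. 3 * s\<^sup>2 - 2 * s ^ 3) has_real_derivative 6 * s * (1 - s)) (at s)"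
      by (auto intro!: derivative_eq_intros simp: algebra_simps power2_eq_square)
    then have "(f_ext has_real_derivative 6 * s * (1 - s)) (at s)"
      by (rule has_field_derivative_transform_within_open[where S="{0<..<1}"]) (use 3 in \<open>auto simp: f_ext_def\<close>)
    then show ?thesis using 3 by simp
  next
    case 4
    have "\<bar>f_ext x - f_ext 1\<bar> \<le> 3 * (x - 1)\<^sup>2" for x
      using q[of "1 - x"] sym[of x] by (simp add: f_ext_def[of 1] power2_commute)
    then have "(f_ext has_real_derivative 0) (at 1)"
      by (rule DERIV_zero_of_quadratic_bound)
    then show ?thesis using 4 by simp
  next
    case 5
    have "((\<lambda>_. 1) has_real_derivative 0) (at s)" by simp
    then have "(f_ext has_real_derivative 0) (at s)"
      by (rule has_field_derivative_transform_within_open[where S="{1<..}"]) (use 5 in \<open>auto simp: f_ext_def\<close>)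
    then show ?thesis using 5 by simp
  qed
qed

lemma abs_deriv_f_ext_le: "\<bar>deriv f_ext s\<bar> \<le> 6"
proof -
  have "\<bar>s\<bar> * \<bar>1 - s\<bar> \<le> 1 * 1" if "0 \<le> s" "s \<le> 1" using that by (intro mult_mono) auto
  then show ?thesis by (auto simp: deriv_f_ext abs_mult)
qed

lemma f_ext_range: "0 \<le> f_ext s" "f_ext s \<le> 1"
proof -
  have "f_ext s = s\<^sup>2 * (3 - 2 * s)" "1 - f_ext s = (1 - s)\<^sup>2 * (1 + 2 * s)" if "0 \<le> s" "s \<le> 1"
    using that by (simp_all add: f_ext_def algebra_simps power2_eq_square power3_eq_cube)
  moreover have "0 \<le> s\<^sup>2 * (3 - 2 * s)" "0 \<le> (1 - s)\<^sup>2 * (1 + 2 * s)" if "0 \<le> s" "s \<le> 1"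
    using that by (intro mult_nonneg_nonneg; simp)+
  ultimately have "0 \<le> f_ext s \<and> 0 \<le> 1 - f_ext s" if "0 \<le> s" "s \<le> 1"
    using that by simp
  then have "0 \<le> f_ext s \<and> f_ext s \<le> 1"
    by (cases "0 \<le> s \<and> s \<le> 1") (auto simp: f_ext_def)
  then show "0 \<le> f_ext s" "f_ext s \<le> 1" by auto
qed

lemma measurable_potentials:
  "f_ext \<in> borel_measurable borel" "deriv f_ext \<in> borel_measurable borel" "deriv W_pot \<in> borel_measurable borel"
proof -
  show "f_ext \<in> borel_measurable borel" unfolding f_ext_def[abs_def] by measurable
  show "deriv f_ext \<in> borel_measurable borel" unfolding deriv_f_ext[abs_def] by measurable
  show "deriv W_pot \<in> borel_measurable borel" unfolding deriv_W_pot[abs_def] by measurable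
qed

lemma abs_powr_two: "\<bar>a\<bar> powr 2 = (a::real)\<^sup>2"
  by (cases "a = 0") (simp_all add: powr_numeral)

lemma abs_powr_three: "\<bar>a\<bar> powr 3 = \<bar>a::real\<bar> ^ 3"
  by (cases "a = 0") (simp_all add: powr_numeral)

lemma Lp_norm_two_squared: "(Lp_norm 2 M u)\<^sup>2 = (\<integral>x. (u x)\<^sup>2 \<partial>M)"
proof -
  have "0 \<le> (\<integral>x. (u x)\<^sup>2 \<partial>M)" by simp
  then show ?thesis by (simp add: Lp_norm_def abs_powr_two powr_half_sqrt)
qed

text \<open>The lower bound on the norm uses that the torus is not a null set; on a null space the
  essential supremum would be \<open>- \<infinity>\<close>.\<close>

lemma Linf_norm_le_one:
  assumes X: "\<And>i. X $ i > 0" and w: "w \<in> borel_measurable (torus X)" "\<And>x. \<bar>w x\<bar> \<le> 1"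
  shows "w \<in> Linf_space (torus X)" "\<bar>Linf_norm (torus X) w\<bar> \<le> 1"
proof -
  let ?E = "esssup (torus X) (\<lambda>x. ereal \<bar>w x\<bar>)"
  have E1: "?E \<le> 1"
    by (rule esssup_I) (use w in auto)
  then show "w \<in> Linf_space (torus X)" using w by (auto simp: Linf_space_def)
  have "0 \<le> ?E"
  proof (rule ccontr)
    assume neg: "\<not> 0 \<le> ?E"
    have "AE x in torus X. ereal \<bar>w x\<bar> \<le> ?E" by (rule esssup_AE)
    then have "AE x in torus X. False"
    proof eventually_elim
      case (elim x)
      have "0 \<le> ereal \<bar>w x\<bar>" by simp
      with elim have "0 \<le> ?E" by (rule order_trans[rotated])
      with neg show False by simp
    qed
    then show False using torus_not_null[OF X] by simp
  qed
  with E1 show "\<bar>Linf_norm (torus X) w\<bar> \<le> 1"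
    unfolding Linf_norm_def by (cases ?E) (auto simp: one_ereal_def)
qed

lemma Linf_space_AE_bound:
  assumes "w \<in> Linf_space M" shows "AE x in M. \<bar>w x\<bar> \<le> Linf_norm M w"
  using esssup_AE[of "\<lambda>x. ereal \<bar>w x\<bar>" M]
proof eventually_elim
  case (elim x)
  have lt: "esssup M (\<lambda>x. ereal \<bar>w x\<bar>) < \<infinity>" using assms by (simp add: Linf_space_def)
  show ?case
    using elim lt unfolding Linf_norm_def by (cases "esssup M (\<lambda>x. ereal \<bar>w x\<bar>)") auto
qed

lemma has_weak_partial_weak_partial:
  "has_weak_partial X i u g \<Longrightarrow> has_weak_partial X i u (weak_partial X i u)"
  unfolding weak_partial_def by (rule someI[of "has_weak_partial X i u"])

text \<open>Membership in \<open>H\<^sup>2\<close> provides some first weak derivative with square integrable weak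
  derivatives. Uniqueness transfers this to the chosen representatives, which enter the norm and
  the Laplacian.\<close>

lemma H2_second_partials:
  fixes X :: "real^'d"
  assumes X: "\<And>i. X $ i > 0" and u: "u \<in> Hk_space 2 X"
  shows "has_weak_partial X i u (weak_partial X i u)"
    and "has_weak_partial X i (weak_partial X i u) (weak_partial X i (weak_partial X i u))"
    and "integrable (torus X) (\<lambda>x. (weak_partial X i (weak_partial X i u) x)\<^sup>2)"
proof -
  obtain g where g: "g \<in> Hk_space 1 X" "has_weak_partial X i u g"
    using u unfolding numeral_2_eq_2 Hk_space.simps(2)[of "Suc 0"] One_nat_def by blast
  obtain g' where g': "g' \<in> Lp_space 2 (torus X)" "has_weak_partial X i g g'"
    using g(1) by (auto simp: One_nat_def)
  show 1: "has_weak_partial X i u (weak_partial X i u)"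
    by (rule has_weak_partial_weak_partial[OF g(2)])
  have "has_weak_partial X i (weak_partial X i u) g'"
    by (rule has_weak_partial_cong_AE[OF g'(2) has_weak_partial_unique[OF X g(2) 1]])
       (use 1 in \<open>simp add: has_weak_partial_def\<close>)
  then show 2: "has_weak_partial X i (weak_partial X i u) (weak_partial X i (weak_partial X i u))"
    by (rule has_weak_partial_weak_partial)
  have ae: "AE x in torus X. g' x = weak_partial X i (weak_partial X i u) x"
    by (rule has_weak_partial_unique[OF X \<open>has_weak_partial X i (weak_partial X i u) g'\<close> 2])
  have "integrable (torus X) (\<lambda>x. (g' x)\<^sup>2)" using g'(1) by (simp add: Lp_space_def abs_powr_two)
  then show "integrable (torus X) (\<lambda>x. (weak_partial X i (weak_partial X i u) x)\<^sup>2)"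
  proof (rule integrable_cong_AE_imp)
    show "(\<lambda>x. (weak_partial X i (weak_partial X i u) x)\<^sup>2) \<in> borel_measurable (torus X)"
      using 2 by (auto simp: has_weak_partial_def)
    show "AE x in torus X. (g' x)\<^sup>2 = (weak_partial X i (weak_partial X i u) x)\<^sup>2"
      using ae by eventually_elim simp
  qed
qed

lemma sum_second_partials_le_H2_norm:
  fixes X :: "real^'d"
  shows "(\<Sum>i\<in>UNIV. \<integral>x. (weak_partial X i (weak_partial X i u) x)\<^sup>2 \<partial>torus X) \<le> (Hk_norm 2 X u)\<^sup>2"
proof -
  have H1: "(Hk_norm 1 X v)\<^sup>2 = (Lp_norm 2 (torus X) v)\<^sup>2 + (\<Sum>i\<in>UNIV. (Lp_norm 2 (torus X) (weak_partial X i v))\<^sup>2)" for v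
    by (simp add: One_nat_def sum_nonneg)
  have H2: "(Hk_norm 2 X u)\<^sup>2 = (Lp_norm 2 (torus X) u)\<^sup>2 + (\<Sum>i\<in>UNIV. (Hk_norm 1 X (weak_partial X i u))\<^sup>2)"
    unfolding numeral_2_eq_2 Hk_norm.simps(2)[of "Suc 0"] One_nat_def by (simp add: sum_nonneg del: Hk_norm.simps)
  have "(\<Sum>i\<in>UNIV. \<integral>x. (weak_partial X i (weak_partial X i u) x)\<^sup>2 \<partial>torus X) \<le> (\<Sum>i\<in>UNIV. (Hk_norm 1 X (weak_partial X i u))\<^sup>2)"
  proof (rule sum_mono)
    fix i :: 'd
    have "(Lp_norm 2 (torus X) (weak_partial X i (weak_partial X i u)))\<^sup>2
      \<le> (\<Sum>j\<in>UNIV. (Lp_norm 2 (torus X) (weak_partial X j (weak_partial X i u)))\<^sup>2)"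
      by (rule member_le_sum) auto
    also have "\<dots> \<le> (Hk_norm 1 X (weak_partial X i u))\<^sup>2" unfolding H1 by simp
    finally show "(\<integral>x. (weak_partial X i (weak_partial X i u) x)\<^sup>2 \<partial>torus X) \<le> (Hk_norm 1 X (weak_partial X i u))\<^sup>2"
      by (simp only: Lp_norm_two_squared)
  qed
  then show ?thesis unfolding H2 using zero_le_power2[of "Lp_norm 2 (torus X) u"] by linarith
qed

lemma weak_laplacian_L1:
  fixes X :: "real^'d"
  assumes X: "\<And>i. X $ i > 0" and u: "u \<in> Hk_space 2 X"
  shows "integrable (torus X) (weak_laplacian X u)"
    and "(\<integral>x. \<bar>weak_laplacian X u x\<bar> \<partial>torus X) \<le> real CARD('d) * measure (torus X) (cbox (- X) X) + (Hk_norm 2 X u)\<^sup>2"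
proof -
  interpret finite_measure "torus X" by (rule finite_measure_torus)
  let ?D = "\<lambda>i. weak_partial X i (weak_partial X i u)"
  have D: "integrable (torus X) (?D i)" for i
    using H2_second_partials(2)[OF X u, of i] by (simp add: has_weak_partial_def)
  note D2 = H2_second_partials(3)[OF X u]
  show int: "integrable (torus X) (weak_laplacian X u)"
    unfolding weak_laplacian_def[abs_def] by (rule Bochner_Integration.integrable_sum) (rule D)
  have "(\<integral>x. \<bar>weak_laplacian X u x\<bar> \<partial>torus X) \<le> (\<integral>x. (\<Sum>i\<in>UNIV. 1 + (?D i x)\<^sup>2) \<partial>torus X)"
  proof (rule integral_mono)
    fix x
    have "\<bar>a\<bar> \<le> 1 + a\<^sup>2" for a :: real
    proof -
      have "0 \<le> (\<bar>a\<bar> - 1)\<^sup>2" by simp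
      then have "2 * \<bar>a\<bar> \<le> 1 + a\<^sup>2" by (simp add: power2_diff)
      then show ?thesis by linarith
    qed
    then have "(\<Sum>i\<in>UNIV. \<bar>?D i x\<bar>) \<le> (\<Sum>i\<in>UNIV. 1 + (?D i x)\<^sup>2)" by (intro sum_mono)
    then show "\<bar>weak_laplacian X u x\<bar> \<le> (\<Sum>i\<in>UNIV. 1 + (?D i x)\<^sup>2)"
      unfolding weak_laplacian_def by (rule order_trans[OF sum_abs])
  next
    show "integrable (torus X) (\<lambda>x. \<bar>weak_laplacian X u x\<bar>)" using int by simp
    show "integrable (torus X) (\<lambda>x. \<Sum>i\<in>UNIV. 1 + (?D i x)\<^sup>2)" using D2 by simp
  qed
  also have "\<dots> = (\<Sum>i\<in>UNIV. measure (torus X) (cbox (- X) X) + (\<integral>x. (?D i x)\<^sup>2 \<partial>torus X))"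
    using D2 by (subst Bochner_Integration.integral_sum) auto
  also have "\<dots> = real CARD('d) * measure (torus X) (cbox (- X) X) + (\<Sum>i\<in>UNIV. \<integral>x. (?D i x)\<^sup>2 \<partial>torus X)"
    by (simp add: sum.distrib)
  also have "\<dots> \<le> real CARD('d) * measure (torus X) (cbox (- X) X) + (Hk_norm 2 X u)\<^sup>2"
    using sum_second_partials_le_H2_norm[of X u] by simp
  finally show "(\<integral>x. \<bar>weak_laplacian X u x\<bar> \<partial>torus X) \<le> real CARD('d) * measure (torus X) (cbox (- X) X) + (Hk_norm 2 X u)\<^sup>2" .
qed

lemma weak_laplacian_monotone:
  fixes X :: "real^'d"
  assumes X: "\<And>i. X $ i > 0" and u: "u \<in> Hk_space 2 X"
    and h: "mono h" "h \<in> borel_measurable borel" "\<And>s. \<bar>h s\<bar> \<le> B"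
  shows "(\<integral>x. weak_laplacian X u x * h (u x) \<partial>torus X) \<le> 0"
proof -
  let ?D = "\<lambda>i. weak_partial X i (weak_partial X i u)"
  have D: "integrable (torus X) (?D i)" for i
    using H2_second_partials(2)[OF X u, of i] by (simp add: has_weak_partial_def)
  have um: "u \<in> borel_measurable (torus X)" using u by (auto simp: numeral_2_eq_2 Lp_space_def)
  have hm: "(\<lambda>x. h (u x)) \<in> borel_measurable (torus X)" by (rule measurable_compose[OF um h(2)])
  have "(\<integral>x. weak_laplacian X u x * h (u x) \<partial>torus X) = (\<integral>x. (\<Sum>i\<in>UNIV. ?D i x * h (u x)) \<partial>torus X)"
    by (simp add: weak_laplacian_def sum_distrib_right)
  also have "\<dots> = (\<Sum>i\<in>UNIV. \<integral>x. ?D i x * h (u x) \<partial>torus X)"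
    by (rule Bochner_Integration.integral_sum) (rule integrable_times_bounded[OF D hm, where B=B], simp add: h)
  also have "\<dots> \<le> 0"
    by (intro sum_nonpos weak_second_partial_monotone[OF X H2_second_partials(1,2)[OF X u] h])
  finally show ?thesis .
qed

section \<open>Energies decreasing along partitions\<close>

text \<open>For the equidistant partition, the step function picks the value of \<open>K\<close> at the first node \<open>r\<close>
  at or after \<open>\<tau>\<close>.\<close>

lemma sum_partition_indicator:
  fixes K :: "real \<Rightarrow> real"
  assumes st: "s < t" and N: "N > 0"
  defines "p \<equiv> \<lambda>j::nat. s + (t - s) * real j / real N"
  shows "\<tau> \<notin> {s<..t} \<Longrightarrow> (\<Sum>j<N. indicator {p j<..p (Suc j)} \<tau> * K (p (Suc j))) = 0"
    and "\<tau> \<in> {s<..t} \<Longrightarrow> \<exists>r. \<tau> \<le> r \<and> r \<le> t \<and> r \<le> \<tau> + (t - s) / real N \<and>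
      (\<Sum>j<N. indicator {p j<..p (Suc j)} \<tau> * K (p (Suc j))) = K r"
proof -
  have mono: "p i \<le> p j" if "i \<le> j" for i j
    using that st N unfolding p_def by (intro add_left_mono divide_right_mono mult_left_mono) auto
  have p0: "p 0 = s" and pN: "p N = t" using N by (auto simp: p_def)
  {
    assume \<tau>: "\<tau> \<notin> {s<..t}"
    have "indicator {p j<..p (Suc j)} \<tau> = (0::real)" if "j < N" for j
      using \<tau> mono[of 0 j] mono[of "Suc j" N] that p0 pN by (auto simp: indicator_def)
    then show "(\<Sum>j<N. indicator {p j<..p (Suc j)} \<tau> * K (p (Suc j))) = 0" by simp
  }
  assume \<tau>: "\<tau> \<in> {s<..t}"
  define i where "i = (LEAST j. \<tau> \<le> p j)"
  have ex: "\<tau> \<le> p N" using \<tau> pN by simp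
  have i: "\<tau> \<le> p i" unfolding i_def by (rule LeastI[of "\<lambda>j. \<tau> \<le> p j", OF ex])
  have iN: "i \<le> N" unfolding i_def by (rule Least_le[of "\<lambda>j. \<tau> \<le> p j", OF ex])
  have "i \<noteq> 0" using i \<tau> p0 by (cases "i = 0") auto
  then obtain k where k: "i = Suc k" using not0_implies_Suc by blast
  have pk: "p k < \<tau>" using not_less_Least[of k "\<lambda>j. \<tau> \<le> p j"] k by (auto simp: i_def)
  have ind: "indicator {p j<..p (Suc j)} \<tau> * K (p (Suc j)) = (if j = k then K (p (Suc k)) else 0)" for j
  proof -
    consider "j < k" | "j = k" | "k < j" by linarith
    then show ?thesis
    proof cases
      case 1 then show ?thesis using mono[of "Suc j" k] pk by (auto simp: indicator_def)
    next
      case 2 then show ?thesis using pk i k by (auto simp: indicator_def)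
    next
      case 3 then show ?thesis using mono[of "Suc k" j] i k by (auto simp: indicator_def)
    qed
  qed
  have "(\<Sum>j<N. indicator {p j<..p (Suc j)} \<tau> * K (p (Suc j))) = K (p i)"
    unfolding ind using iN k by simp
  moreover have "p i \<le> \<tau> + (t - s) / real N"
  proof -
    have "p i = p k + (t - s) / real N" using N by (simp add: p_def k field_simps)
    then show ?thesis using pk by simp
  qed
  moreover have "p i \<le> t" using mono[OF iN] pN by simp
  ultimately show "\<exists>r. \<tau> \<le> r \<and> r \<le> t \<and> r \<le> \<tau> + (t - s) / real N \<and>
      (\<Sum>j<N. indicator {p j<..p (Suc j)} \<tau> * K (p (Suc j))) = K r" using i by blast
qed

text \<open>Only an upper bound in the limit is available on the diagonal, so dominated convergence is
  applied to the positive part of the step functions \<open>I n\<close>; this also makes the measurability of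
  \<open>K \<tau> \<tau>\<close> in \<open>\<tau>\<close> irrelevant.\<close>

lemma nonincreasing_by_partition:
  fixes E :: "real \<Rightarrow> real" and K :: "real \<Rightarrow> real \<Rightarrow> real" and g :: "real \<Rightarrow> real"
  assumes st: "s < t"
    and int: "\<And>a b. s \<le> a \<Longrightarrow> a < b \<Longrightarrow> b \<le> t \<Longrightarrow> set_integrable lebesgue {a<..b} (\<lambda>\<tau>. K \<tau> b)"
    and step: "\<And>a b. s \<le> a \<Longrightarrow> a < b \<Longrightarrow> b \<le> t \<Longrightarrow> E b - E a \<le> (\<integral>\<tau>\<in>{a<..b}. K \<tau> b \<partial>lebesgue)"
    and g: "integrable lebesgue g"
    and bd: "AE \<tau> in lebesgue. \<tau> \<in> {s<..t} \<longrightarrow> (\<forall>r\<in>{s..t}. \<bar>K \<tau> r\<bar> \<le> g \<tau>)"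
    and lim: "AE \<tau> in lebesgue. \<tau> \<in> {s<..t} \<longrightarrow>
      (\<forall>r. (\<forall>n. \<tau> \<le> r n \<and> r n \<le> t) \<longrightarrow> r \<longlonglongrightarrow> \<tau> \<longrightarrow> (\<lambda>n::nat. max (K \<tau> (r n)) 0) \<longlonglongrightarrow> 0)"
  shows "E t \<le> E s"
proof -
  define p where "p n j = s + (t - s) * real j / real (Suc n)" for n j :: nat
  define I where "I n \<tau> = (\<Sum>j<Suc n. indicator {p n j<..p n (Suc j)} \<tau> * K \<tau> (p n (Suc j)))" for n \<tau>
  have p: "s \<le> p n j" "p n j < p n (Suc j)" "p n (Suc j) \<le> t" if "j < Suc n" for n j
  proof -
    have "0 \<le> (t - s) * real j / real (Suc n)" using st by simp
    then show "s \<le> p n j" by (simp add: p_def)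
    have "(t - s) * real j / real (Suc n) < (t - s) * real (Suc j) / real (Suc n)"
      using st by (intro divide_strict_right_mono mult_strict_left_mono) auto
    then show "p n j < p n (Suc j)" by (simp add: p_def)
    have "(t - s) * real (Suc j) / real (Suc n) \<le> (t - s) * real (Suc n) / real (Suc n)"
      using st that by (intro divide_right_mono mult_left_mono) auto
    then show "p n (Suc j) \<le> t" by (simp add: p_def)
  qed
  have piece: "integrable lebesgue (\<lambda>\<tau>. indicator {p n j<..p n (Suc j)} \<tau> * K \<tau> (p n (Suc j)))" if "j < Suc n" for n j
    using int[OF p[OF that]] by (simp add: set_integrable_def)
  have Ii: "integrable lebesgue (I n)" for n
    unfolding I_def[abs_def] by (rule Bochner_Integration.integrable_sum) (use piece in auto)
  have lower: "E t - E s \<le> (\<integral>\<tau>. I n \<tau> \<partial>lebesgue)" for n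
  proof -
    have "E t - E s = (\<Sum>j<Suc n. E (p n (Suc j)) - E (p n j))"
      by (subst sum_lessThan_telescope) (simp add: p_def)
    also have "\<dots> \<le> (\<Sum>j<Suc n. \<integral>\<tau>. indicator {p n j<..p n (Suc j)} \<tau> * K \<tau> (p n (Suc j)) \<partial>lebesgue)"
    proof (rule sum_mono)
      fix j assume "j \<in> {..<Suc n}"
      then have j: "j < Suc n" by simp
      show "E (p n (Suc j)) - E (p n j) \<le> (\<integral>\<tau>. indicator {p n j<..p n (Suc j)} \<tau> * K \<tau> (p n (Suc j)) \<partial>lebesgue)"
        using step[OF p[OF j]] by (simp add: set_lebesgue_integral_def)
    qed
    also have "\<dots> = (\<integral>\<tau>. I n \<tau> \<partial>lebesgue)"
      unfolding I_def by (rule Bochner_Integration.integral_sum[symmetric]) (use piece in auto)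
    finally show ?thesis .
  qed
  have out: "I n \<tau> = 0" if "\<tau> \<notin> {s<..t}" for n \<tau>
    using sum_partition_indicator(1)[OF st _ that, of "Suc n" "K \<tau>"] by (simp add: I_def p_def)
  have inn: "\<exists>r. \<tau> \<le> r \<and> r \<le> t \<and> r \<le> \<tau> + (t - s) / real (Suc n) \<and> I n \<tau> = K \<tau> r" if "\<tau> \<in> {s<..t}" for n \<tau>
    using sum_partition_indicator(2)[OF st _ that, of "Suc n" "K \<tau>"] unfolding I_def p_def by simp
  have "(\<lambda>n. \<integral>\<tau>. max (I n \<tau>) 0 \<partial>lebesgue) \<longlonglongrightarrow> (\<integral>\<tau>. 0 \<partial>(lebesgue::real measure))"
  proof (rule integral_dominated_convergence[where w = "\<lambda>\<tau>. \<bar>g \<tau>\<bar>"])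
    show "(\<lambda>\<tau>. max (I n \<tau>) 0) \<in> borel_measurable lebesgue" for n using Ii[of n] by auto
    show "integrable lebesgue (\<lambda>\<tau>. \<bar>g \<tau>\<bar>)" using g by simp
    show "AE \<tau> in lebesgue. norm (max (I n \<tau>) 0) \<le> \<bar>g \<tau>\<bar>" for n
      using bd
    proof eventually_elim
      case (elim \<tau>)
      show ?case
      proof (cases "\<tau> \<in> {s<..t}")
        case True
        then obtain r where "\<tau> \<le> r" "r \<le> t" "I n \<tau> = K \<tau> r" using inn by blast
        then show ?thesis using elim True by (auto dest!: bspec[of _ _ r])
      next
        case False then show ?thesis using out by simp
      qed
    qed
    show "AE \<tau> in lebesgue. (\<lambda>n. max (I n \<tau>) 0) \<longlonglongrightarrow> 0"
      using lim
    proof eventually_elim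
      case (elim \<tau>)
      show ?case
      proof (cases "\<tau> \<in> {s<..t}")
        case True
        have "\<forall>n. \<exists>r. \<tau> \<le> r \<and> r \<le> t \<and> r \<le> \<tau> + (t - s) / real (Suc n) \<and> I n \<tau> = K \<tau> r"
          using inn[OF True] by (rule allI)
        from choice[OF this] obtain r where
          r: "\<forall>n. \<tau> \<le> r n \<and> r n \<le> t \<and> r n \<le> \<tau> + (t - s) / real (Suc n) \<and> I n \<tau> = K \<tau> (r n)"
          by (rule exE)
        have "(\<lambda>n. \<tau> + (t - s) * inverse (real (Suc n))) \<longlonglongrightarrow> \<tau> + (t - s) * 0"
          by (intro tendsto_intros LIMSEQ_inverse_real_of_nat)
        then have "(\<lambda>n. \<tau> + (t - s) / real (Suc n)) \<longlonglongrightarrow> \<tau>" by (simp add: divide_inverse)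
        then have "r \<longlonglongrightarrow> \<tau>"
          by (rule tendsto_sandwich[OF _ _ tendsto_const, rotated 2]) (use r in auto)
        moreover have "\<forall>n. \<tau> \<le> r n \<and> r n \<le> t" using r by simp
        ultimately have "(\<lambda>n. max (K \<tau> (r n)) 0) \<longlonglongrightarrow> 0" using elim True by simp
        then show ?thesis using r by simp
      next
        case False then show ?thesis using out by simp
      qed
    qed
  qed auto
  then have "(\<lambda>n. \<integral>\<tau>. max (I n \<tau>) 0 \<partial>lebesgue) \<longlonglongrightarrow> 0" by simp
  moreover have "E t - E s \<le> (\<integral>\<tau>. max (I n \<tau>) 0 \<partial>lebesgue)" for n
    by (rule order_trans[OF lower[of n] integral_mono]) (use Ii[of n] in auto)
  ultimately have "E t - E s \<le> 0" by (intro LIMSEQ_le_const) auto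
  then show ?thesis by simp
qed

section \<open>Integrability and dissipation of the right-hand side\<close>

text \<open>The constants do not depend on \<open>u\<close>. The nonlocal term is bounded because \<open>f - \<omega>\<close> takes values
  in \<open>[-1,1]\<close>.\<close>

lemma flow_rhs_L1_bound:
  fixes X :: "real^'d"
  assumes X: "\<And>i. X $ i > 0" and eps: "\<epsilon> > 0" and omega: "0 < \<omega>" "\<omega> < 1"
    and L: "Linf_bounded_linear (torus X) L"
  shows "\<exists>A B C. \<forall>u. u \<in> Hk_space 2 X \<longrightarrow> u \<in> Lp_space 3 (torus X) \<longrightarrow>
      integrable (torus X) (flow_rhs X \<epsilon> \<omega> Mt L u) \<and>
      (\<integral>x. \<bar>flow_rhs X \<epsilon> \<omega> Mt L u x\<bar> \<partial>torus X) \<le> A + B * (Hk_norm 2 X u)\<^sup>2 + C * (\<integral>x. \<bar>u x\<bar> ^ 3 \<partial>torus X)"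
proof -
  interpret finite_measure "torus X" by (rule finite_measure_torus)
  define V where "V = measure (torus X) (cbox (- X) X)"
  have V: "V \<ge> 0" by (simp add: V_def)
  have LL: "\<forall>u\<in>Linf_space (torus X). L u \<in> Linf_space (torus X)"
    "\<exists>K. \<forall>u\<in>Linf_space (torus X). Linf_norm (torus X) (L u) \<le> K * Linf_norm (torus X) u"
    using L unfolding Linf_bounded_linear_def by simp_all
  obtain K where K: "\<And>w. w \<in> Linf_space (torus X) \<Longrightarrow> Linf_norm (torus X) (L w) \<le> K * Linf_norm (torus X) w"
    using LL(2) by blast
  define c where "c = 6 * \<bar>K\<bar> + 6 * (\<bar>Mt\<bar> * V)"
  let ?A = "\<epsilon> * (real CARD('d) * V) + 216 / \<epsilon> * V + c * V"
  have "integrable (torus X) (flow_rhs X \<epsilon> \<omega> Mt L u) \<and>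
      (\<integral>x. \<bar>flow_rhs X \<epsilon> \<omega> Mt L u x\<bar> \<partial>torus X) \<le> ?A + \<epsilon> * (Hk_norm 2 X u)\<^sup>2 + 216 / \<epsilon> * (\<integral>x. \<bar>u x\<bar> ^ 3 \<partial>torus X)"
    if u: "u \<in> Hk_space 2 X" "u \<in> Lp_space 3 (torus X)" for u
  proof -
    have um: "u \<in> borel_measurable (torus X)" and u3: "integrable (torus X) (\<lambda>x. \<bar>u x\<bar> ^ 3)"
      using u(2) by (auto simp: Lp_space_def abs_powr_three)
    note meas = measurable_compose[OF um measurable_potentials(1)] measurable_compose[OF um measurable_potentials(2)]
      measurable_compose[OF um measurable_potentials(3)]
    define w where "w y = f_ext (u y) - \<omega>" for y
    have wm: "w \<in> borel_measurable (torus X)" unfolding w_def[abs_def] using meas(1) by simp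
    have w1: "\<bar>w y\<bar> \<le> 1" for y using f_ext_range[of "u y"] omega by (auto simp: w_def)
    have wL: "w \<in> Linf_space (torus X)" "\<bar>Linf_norm (torus X) w\<bar> \<le> 1" by (rule Linf_norm_le_one[OF X wm w1])+
    have LwL: "L w \<in> Linf_space (torus X)" using LL(1) wL(1) by (rule bspec)
    then have Lm: "L w \<in> borel_measurable (torus X)" by (simp add: Linf_space_def)
    have LB: "AE x in torus X. \<bar>L w x\<bar> \<le> \<bar>K\<bar>"
      using Linf_space_AE_bound[OF LwL]
    proof eventually_elim
      case (elim x)
      have "K * Linf_norm (torus X) w \<le> \<bar>K\<bar> * 1"
        using mult_left_mono[OF wL(2) abs_ge_zero[of K]] abs_ge_self[of "K * Linf_norm (torus X) w"]
        by (simp only: abs_mult)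
      then show ?case using elim K[OF wL(1)] by linarith
    qed
    define m where "m = (\<integral>y. w y \<partial>torus X)"
    have mB: "\<bar>m\<bar> \<le> V"
    proof -
      have wi: "integrable (torus X) w" by (rule integrable_torus_bounded[OF wm, where B=1]) (simp add: w1)
      have "\<bar>m\<bar> \<le> (\<integral>y. \<bar>w y\<bar> \<partial>torus X)" unfolding m_def by (rule integral_abs_bound)
      also have "\<dots> \<le> (\<integral>y. 1 \<partial>torus X)" by (rule integral_mono) (use wi w1 in auto)
      finally show ?thesis by (simp add: V_def)
    qed
    let ?R = "flow_rhs X \<epsilon> \<omega> Mt L u"
    have R: "?R x = \<epsilon> * weak_laplacian X u x - 1 / \<epsilon> * deriv W_pot (u x) - L w x * deriv f_ext (u x) - Mt * m * deriv f_ext (u x)" for x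
      by (simp add: flow_rhs_def w_def[abs_def] m_def)
    have lap: "integrable (torus X) (weak_laplacian X u)" by (rule weak_laplacian_L1(1)[OF X u(1)])
    have Rm: "?R \<in> borel_measurable (torus X)"
      unfolding R[abs_def] using lap Lm meas by (intro borel_measurable_diff borel_measurable_times borel_measurable_const) auto
    let ?b = "\<lambda>x. \<epsilon> * \<bar>weak_laplacian X u x\<bar> + 216 / \<epsilon> * (1 + \<bar>u x\<bar> ^ 3) + c"
    have bi: "integrable (torus X) ?b" using lap u3 by simp
    have Rb: "AE x in torus X. \<bar>?R x\<bar> \<le> ?b x"
      using LB
    proof eventually_elim
      case (elim x)
      have 1: "\<bar>\<epsilon> * weak_laplacian X u x\<bar> = \<epsilon> * \<bar>weak_laplacian X u x\<bar>" using eps by (simp add: abs_mult)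
      have 2: "\<bar>1 / \<epsilon> * deriv W_pot (u x)\<bar> \<le> 216 / \<epsilon> * (1 + \<bar>u x\<bar> ^ 3)"
      proof -
        have "1 / \<epsilon> * \<bar>deriv W_pot (u x)\<bar> \<le> 1 / \<epsilon> * (216 * (1 + \<bar>u x\<bar> ^ 3))"
          using eps by (intro mult_left_mono abs_deriv_W_pot_le) auto
        then show ?thesis using eps by (simp add: abs_mult)
      qed
      have 3: "\<bar>L w x * deriv f_ext (u x)\<bar> \<le> \<bar>K\<bar> * 6"
        unfolding abs_mult using elim abs_deriv_f_ext_le by (intro mult_mono) auto
      have 4: "\<bar>Mt * m * deriv f_ext (u x)\<bar> \<le> (\<bar>Mt\<bar> * V) * 6"
        unfolding abs_mult using mB abs_deriv_f_ext_le V by (intro mult_mono) auto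
      show ?case unfolding R c_def using 1 2 3 4 by linarith
    qed
    have Ri: "integrable (torus X) ?R"
      by (rule Bochner_Integration.integrable_bound[OF bi Rm]) (use Rb in eventually_elim, auto)
    have "(\<integral>x. \<bar>?R x\<bar> \<partial>torus X) \<le> (\<integral>x. ?b x \<partial>torus X)"
      by (rule integral_mono_AE) (use Ri bi Rb in auto)
    also have "\<dots> = \<epsilon> * (\<integral>x. \<bar>weak_laplacian X u x\<bar> \<partial>torus X) + 216 / \<epsilon> * (V + (\<integral>x. \<bar>u x\<bar> ^ 3 \<partial>torus X)) + c * V"
      using lap u3 by (simp add: V_def)
    also have "\<dots> \<le> \<epsilon> * (real CARD('d) * V + (Hk_norm 2 X u)\<^sup>2) + 216 / \<epsilon> * (V + (\<integral>x. \<bar>u x\<bar> ^ 3 \<partial>torus X)) + c * V"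
      using weak_laplacian_L1(2)[OF X u(1)] eps by (simp add: V_def mult_left_mono)
    also have "\<dots> = ?A + \<epsilon> * (Hk_norm 2 X u)\<^sup>2 + 216 / \<epsilon> * (\<integral>x. \<bar>u x\<bar> ^ 3 \<partial>torus X)"
      by (simp only: distrib_left)
    finally show ?thesis using Ri by simp
  qed
  then show ?thesis by (intro exI[of _ ?A] exI[of _ \<epsilon>] exI[of _ "216 / \<epsilon>"]) simp
qed

lemma flow_rhs_dissipation:
  fixes X :: "real^'d"
  assumes X: "\<And>i. X $ i > 0" and eps: "\<epsilon> > 0"
    and u: "u \<in> Hk_space 2 X" and R: "integrable (torus X) (flow_rhs X \<epsilon> \<omega> Mt L u)"
    and h: "mono h" "h \<in> borel_measurable borel" "\<And>s. \<bar>h s\<bar> \<le> B"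
    and h0: "\<And>s. 0 \<le> s \<Longrightarrow> s \<le> 1 \<Longrightarrow> h s = 0"
    and hW: "\<And>s. 0 \<le> deriv W_pot s * h s"
  shows "(\<integral>x. flow_rhs X \<epsilon> \<omega> Mt L u x * h (u x) \<partial>torus X) \<le> 0"
proof -
  have um: "u \<in> borel_measurable (torus X)" using u by (auto simp: numeral_2_eq_2 Lp_space_def)
  have hm: "(\<lambda>x. h (u x)) \<in> borel_measurable (torus X)" by (rule measurable_compose[OF um h(2)])
  have li: "integrable (torus X) (\<lambda>x. weak_laplacian X u x * h (u x))"
    by (rule integrable_times_bounded[OF weak_laplacian_L1(1)[OF X u] hm, where B=B]) (simp add: h)
  have fh: "deriv f_ext s * h s = 0" for s using h0[of s] by (auto simp: deriv_f_ext)
  have "flow_rhs X \<epsilon> \<omega> Mt L u x * h (u x) \<le> \<epsilon> * (weak_laplacian X u x * h (u x))" for x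
  proof -
    have "flow_rhs X \<epsilon> \<omega> Mt L u x * h (u x) = \<epsilon> * (weak_laplacian X u x * h (u x)) - 1 / \<epsilon> * (deriv W_pot (u x) * h (u x))
      - (L (\<lambda>y. f_ext (u y) - \<omega>) x + Mt * (\<integral>y. (f_ext (u y) - \<omega>) \<partial>torus X)) * (deriv f_ext (u x) * h (u x))"
      by (simp add: flow_rhs_def algebra_simps)
    also have "\<dots> \<le> \<epsilon> * (weak_laplacian X u x * h (u x))" using hW[of "u x"] eps by (simp add: fh)
    finally show ?thesis .
  qed
  then have "(\<integral>x. flow_rhs X \<epsilon> \<omega> Mt L u x * h (u x) \<partial>torus X) \<le> (\<integral>x. \<epsilon> * (weak_laplacian X u x * h (u x)) \<partial>torus X)"
    by (intro integral_mono integrable_times_bounded[OF R hm, where B=B]) (use li h in auto)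
  also have "\<dots> = \<epsilon> * (\<integral>x. weak_laplacian X u x * h (u x) \<partial>torus X)" by simp
  also have "\<dots> \<le> 0" using weak_laplacian_monotone[OF X u h] eps by (simp add: mult_nonneg_nonpos)
  finally show ?thesis .
qed

section \<open>Continuity in time\<close>

lemma C_Lp_two_seq_L1:
  assumes \<phi>: "\<phi> \<in> C_Lp T 2 (torus X)" and r: "\<And>n. r n \<in> {0..T}" "r \<longlonglongrightarrow> \<tau>" "\<tau> \<in> {0..T}"
  shows "(\<lambda>n. \<integral>x. \<bar>\<phi> (r n) x - \<phi> \<tau> x\<bar> \<partial>torus X) \<longlonglongrightarrow> 0"
proof -
  have sp: "\<phi> t \<in> borel_measurable (torus X)" "integrable (torus X) (\<lambda>x. (\<phi> t x)\<^sup>2)" if "t \<in> {0..T}" for t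
    using \<phi> that by (auto simp: C_Lp_def Lp_space_def abs_powr_two)
  have lim: "((\<lambda>s. Lp_norm 2 (torus X) (\<lambda>x. \<phi> s x - \<phi> \<tau> x)) \<longlongrightarrow> 0) (at \<tau> within {0..T})"
    using \<phi> r(3) by (simp add: C_Lp_def)
  have L2: "(\<lambda>n. Lp_norm 2 (torus X) (\<lambda>x. \<phi> (r n) x - \<phi> \<tau> x)) \<longlonglongrightarrow> 0"
  proof -
    have "continuous (at \<tau> within {0..T}) (\<lambda>s. Lp_norm 2 (torus X) (\<lambda>x. \<phi> s x - \<phi> \<tau> x))"
      using lim by (simp add: continuous_within Lp_norm_def)
    from continuous_within_tendsto_compose'[OF this r(1) r(2)] show ?thesis by (simp add: Lp_norm_def)
  qed
  have sq: "integrable (torus X) (\<lambda>x. (\<phi> (r n) x - \<phi> \<tau> x)\<^sup>2)" for n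
  proof (rule Bochner_Integration.integrable_bound)
    show "integrable (torus X) (\<lambda>x. 2 * (\<phi> (r n) x)\<^sup>2 + 2 * (\<phi> \<tau> x)\<^sup>2)" using sp r by simp
    show "(\<lambda>x. (\<phi> (r n) x - \<phi> \<tau> x)\<^sup>2) \<in> borel_measurable (torus X)" using sp(1) r by auto
    have "(a - b)\<^sup>2 \<le> 2 * a\<^sup>2 + 2 * b\<^sup>2" for a b :: real
      using zero_le_power2[of "a + b"] by (simp add: power2_sum power2_diff)
    then show "AE x in torus X. norm ((\<phi> (r n) x - \<phi> \<tau> x)\<^sup>2) \<le> norm (2 * (\<phi> (r n) x)\<^sup>2 + 2 * (\<phi> \<tau> x)\<^sup>2)"
      by simp
  qed
  show ?thesis
  proof (rule L2_null_imp_L1_null[OF finite_measure_torus _ sq])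
    show "(\<lambda>x. \<phi> (r n) x - \<phi> \<tau> x) \<in> borel_measurable (torus X)" for n using sp(1) r by auto
    have "(\<lambda>n. (Lp_norm 2 (torus X) (\<lambda>x. \<phi> (r n) x - \<phi> \<tau> x))\<^sup>2) \<longlonglongrightarrow> 0\<^sup>2"
      by (intro tendsto_power L2)
    then show "(\<lambda>n. \<integral>x. (\<phi> (r n) x - \<phi> \<tau> x)\<^sup>2 \<partial>torus X) \<longlonglongrightarrow> 0"
      by (simp add: Lp_norm_two_squared)
  qed
qed

lemma C_Lp_two_integrable:
  assumes "\<phi> \<in> C_Lp T 2 (torus X)" "t \<in> {0..T}"
  shows "integrable (torus X) (\<phi> t)"
proof -
  interpret finite_measure "torus X" by (rule finite_measure_torus)
  have m: "\<phi> t \<in> borel_measurable (torus X)" and s: "integrable (torus X) (\<lambda>x. (\<phi> t x)\<^sup>2)"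
    using assms by (auto simp: C_Lp_def Lp_space_def abs_powr_two)
  show ?thesis by (rule square_integrable_imp_integrable[OF m s])
qed

lemma cube_sum_le:
  fixes a b :: real assumes "0 \<le> a" "0 \<le> b" shows "(a + b) ^ 3 \<le> 4 * a ^ 3 + 4 * b ^ 3"
proof -
  have "0 \<le> 3 * ((a + b) * (a - b)\<^sup>2)" using assms by simp
  also have "\<dots> = 4 * a ^ 3 + 4 * b ^ 3 - (a + b) ^ 3"
    by (simp add: power2_eq_square power3_eq_cube algebra_simps)
  finally show ?thesis by simp
qed

text \<open>Continuity in time makes the \<open>L\<^sup>3\<close> norms bounded on \<open>[0,T]\<close>, by sequential compactness.\<close>

lemma C_Lp_three_bounded:
  assumes \<phi>: "\<phi> \<in> C_Lp T 3 (torus X)"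
  shows "\<exists>B. \<forall>t\<in>{0..T}. (\<integral>x. \<bar>\<phi> t x\<bar> ^ 3 \<partial>torus X) \<le> B"
proof (rule ccontr)
  assume "\<not> ?thesis"
  then have "\<forall>n::nat. \<exists>t. t \<in> {0..T} \<and> real n < (\<integral>x. \<bar>\<phi> t x\<bar> ^ 3 \<partial>torus X)" by (meson not_le)
  from choice[OF this] obtain t where t: "\<And>n. t n \<in> {0..T}" "\<And>n. real n < (\<integral>x. \<bar>\<phi> (t n) x\<bar> ^ 3 \<partial>torus X)"
    by auto
  have "seq_compact {0..T}" by (simp add: compact_imp_seq_compact)
  then obtain \<tau> \<sigma> where \<tau>: "\<tau> \<in> {0..T}" and \<sigma>: "strict_mono \<sigma>" and lim: "(t \<circ> \<sigma>) \<longlonglongrightarrow> \<tau>"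
    using t(1) unfolding seq_compact_def by blast
  have sp: "\<phi> t \<in> borel_measurable (torus X)" "integrable (torus X) (\<lambda>x. \<bar>\<phi> t x\<bar> ^ 3)" if "t \<in> {0..T}" for t
    using \<phi> that by (auto simp: C_Lp_def Lp_space_def abs_powr_three)
  let ?d = "\<lambda>n x. \<phi> (t (\<sigma> n)) x - \<phi> \<tau> x"
  have "((\<lambda>s. Lp_norm 3 (torus X) (\<lambda>x. \<phi> s x - \<phi> \<tau> x)) \<longlongrightarrow> 0) (at \<tau> within {0..T})"
    using \<phi> \<tau> by (simp add: C_Lp_def)
  then have "continuous (at \<tau> within {0..T}) (\<lambda>s. Lp_norm 3 (torus X) (\<lambda>x. \<phi> s x - \<phi> \<tau> x))"
    by (simp add: continuous_within Lp_norm_def)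
  from continuous_within_tendsto_compose'[OF this _ lim] t(1)
  have L3: "(\<lambda>n. Lp_norm 3 (torus X) (?d n)) \<longlonglongrightarrow> 0" by (simp add: Lp_norm_def o_def)
  have d3: "(\<integral>x. \<bar>?d n x\<bar> ^ 3 \<partial>torus X) = (Lp_norm 3 (torus X) (?d n)) ^ 3" for n
  proof -
    have "0 \<le> (\<integral>x. \<bar>?d n x\<bar> ^ 3 \<partial>torus X)" by simp
    then show ?thesis
      by (cases "(\<integral>x. \<bar>?d n x\<bar> ^ 3 \<partial>torus X) = 0") (simp_all add: Lp_norm_def abs_powr_three powr_power)
  qed
  have "(\<lambda>n. (Lp_norm 3 (torus X) (?d n)) ^ 3) \<longlonglongrightarrow> 0 ^ 3" by (intro tendsto_power L3)
  then have "(\<lambda>n. \<integral>x. \<bar>?d n x\<bar> ^ 3 \<partial>torus X) \<longlonglongrightarrow> 0" by (simp add: d3)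
  from LIMSEQ_D[OF this, of 1] obtain N where N: "\<And>n. n \<ge> N \<Longrightarrow> (\<integral>x. \<bar>?d n x\<bar> ^ 3 \<partial>torus X) < 1" by force
  define C where "C = 4 + 4 * (\<integral>x. \<bar>\<phi> \<tau> x\<bar> ^ 3 \<partial>torus X)"
  have up: "(\<integral>x. \<bar>\<phi> (t (\<sigma> n)) x\<bar> ^ 3 \<partial>torus X) \<le> C" if "n \<ge> N" for n
  proof -
    have di: "integrable (torus X) (\<lambda>x. \<bar>?d n x\<bar> ^ 3)"
    proof (rule Bochner_Integration.integrable_bound)
      show "integrable (torus X) (\<lambda>x. 4 * \<bar>\<phi> (t (\<sigma> n)) x\<bar> ^ 3 + 4 * \<bar>\<phi> \<tau> x\<bar> ^ 3)" using sp t \<tau> by simp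
      show "(\<lambda>x. \<bar>?d n x\<bar> ^ 3) \<in> borel_measurable (torus X)" using sp(1) t \<tau> by auto
      have "\<bar>a - b\<bar> ^ 3 \<le> 4 * \<bar>a\<bar> ^ 3 + 4 * \<bar>b\<bar> ^ 3" for a b :: real
        by (rule order_trans[OF power_mono[OF abs_triangle_ineq4] cube_sum_le]) auto
      then show "AE x in torus X. norm (\<bar>?d n x\<bar> ^ 3) \<le> norm (4 * \<bar>\<phi> (t (\<sigma> n)) x\<bar> ^ 3 + 4 * \<bar>\<phi> \<tau> x\<bar> ^ 3)"
        by simp
    qed
    have "(\<integral>x. \<bar>\<phi> (t (\<sigma> n)) x\<bar> ^ 3 \<partial>torus X) \<le> (\<integral>x. 4 * \<bar>?d n x\<bar> ^ 3 + 4 * \<bar>\<phi> \<tau> x\<bar> ^ 3 \<partial>torus X)"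
    proof (rule integral_mono)
      fix x
      have "\<bar>\<phi> (t (\<sigma> n)) x\<bar> \<le> \<bar>?d n x\<bar> + \<bar>\<phi> \<tau> x\<bar>" by linarith
      then show "\<bar>\<phi> (t (\<sigma> n)) x\<bar> ^ 3 \<le> 4 * \<bar>?d n x\<bar> ^ 3 + 4 * \<bar>\<phi> \<tau> x\<bar> ^ 3"
        by (rule order_trans[OF power_mono cube_sum_le]) auto
    qed (use sp t \<tau> di in auto)
    also have "\<dots> = 4 * (\<integral>x. \<bar>?d n x\<bar> ^ 3 \<partial>torus X) + 4 * (\<integral>x. \<bar>\<phi> \<tau> x\<bar> ^ 3 \<partial>torus X)"
      using di sp[OF \<tau>] by simp
    also have "\<dots> \<le> C" using N[OF that] by (simp add: C_def)
    finally show ?thesis .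
  qed
  obtain m :: nat where m: "C \<le> real m" using real_arch_simple by blast
  let ?n = "max N m"
  have "real m \<le> real (\<sigma> ?n)" using seq_suble[OF \<sigma>, of ?n] by simp
  also have "\<dots> < (\<integral>x. \<bar>\<phi> (t (\<sigma> ?n)) x\<bar> ^ 3 \<partial>torus X)" by (rule t(2))
  also have "\<dots> \<le> C" by (rule up) simp
  finally show False using m by simp
qed

section \<open>Decay of the convex energies\<close>

lemma subgradient_imp_lipschitz:
  fixes h H :: "real \<Rightarrow> real"
  assumes "\<And>s. \<bar>h s\<bar> \<le> 1" and H: "\<And>a b. H a - H b \<le> h a * (a - b)"
  shows "\<bar>H a - H b\<bar> \<le> \<bar>a - b\<bar>"
proof -
  have "h a * (a - b) \<le> \<bar>a - b\<bar>" for a b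
  proof -
    have "\<bar>h a\<bar> * \<bar>a - b\<bar> \<le> 1 * \<bar>a - b\<bar>" by (intro mult_right_mono assms) simp
    then show ?thesis using abs_ge_self[of "h a * (a - b)"] by (simp add: abs_mult)
  qed
  from order_trans[OF H this, of a b] order_trans[OF H this, of b a] show ?thesis by linarith
qed

lemma integrable_torus_lipschitz:
  fixes H :: "real \<Rightarrow> real"
  assumes H: "\<And>a b. \<bar>H a - H b\<bar> \<le> \<bar>a - b\<bar>" and Hm: "H \<in> borel_measurable borel"
    and u: "integrable (torus X) u"
  shows "integrable (torus X) (\<lambda>x. H (u x))"
proof (rule Bochner_Integration.integrable_bound)
  interpret finite_measure "torus X" by (rule finite_measure_torus)
  show "integrable (torus X) (\<lambda>x. \<bar>u x\<bar> + \<bar>H 0\<bar>)" using u by simp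
  show "(\<lambda>x. H (u x)) \<in> borel_measurable (torus X)"
    by (rule measurable_compose[OF _ Hm]) (use u in auto)
  have "\<bar>H a\<bar> \<le> \<bar>a\<bar> + \<bar>H 0\<bar>" for a using H[of a 0] by linarith
  then show "AE x in torus X. norm (H (u x)) \<le> norm (\<bar>u x\<bar> + \<bar>H 0\<bar>)" by simp
qed

text \<open>Here \<open>K \<tau> r\<close> is the right-hand side at time \<open>\<tau>\<close> tested with \<open>h(\<phi>(r))\<close>, and \<open>g\<close> is the
  integrable majorant of its \<open>L\<^sup>1\<close> norm. The hypothesis on \<open>H\<close> says that \<open>h\<close> is a subgradient of
  \<open>H\<close>.\<close>

lemma energy_nonincreasing:
  fixes X :: "real^'d" and h H :: "real \<Rightarrow> real"
  assumes X: "\<And>i. X $ i > 0" and eps: "\<epsilon> > 0" and omega: "0 < \<omega>" "\<omega> < 1"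
    and L: "Linf_bounded_linear (torus X) L"
    and sol: "global_weak_solution X \<epsilon> \<omega> Mt L \<phi>0 \<phi>"
    and h: "mono h" "\<And>s. \<bar>h s\<bar> \<le> 1" and hlip: "\<And>a b. \<bar>h a - h b\<bar> \<le> \<bar>a - b\<bar>"
    and h0: "\<And>s. 0 \<le> s \<Longrightarrow> s \<le> 1 \<Longrightarrow> h s = 0" and hW: "\<And>s. 0 \<le> deriv W_pot s * h s"
    and H: "\<And>a b. H a - H b \<le> h a * (a - b)" and Hm: "H \<in> borel_measurable borel"
    and st: "0 < s" "s < t"
  shows "(\<integral>x. H (\<phi> t x) \<partial>torus X) \<le> (\<integral>x. H (\<phi> s x) \<partial>torus X)"
proof -
  let ?R = "\<lambda>\<tau>. flow_rhs X \<epsilon> \<omega> Mt L (\<phi> \<tau>)"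
  interpret finite_measure "torus X" by (rule finite_measure_torus)
  define T where "T = t + 1"
  have T: "0 < T" "t < T" using st by (auto simp: T_def)
  have hm: "h \<in> borel_measurable borel" by (rule borel_measurable_mono[OF h(1)])
  have sol': "(\<forall>p. 2 \<le> p \<and> p < 6 \<longrightarrow> \<phi> \<in> C_Lp T p (torus X)) \<and> \<phi> \<in> Linf_Hk T 1 X \<and> \<phi> \<in> L2_Hk T 2 X \<and>
      (\<forall>w\<in>Lp_space 2 (torus X). distributional_deriv T (\<lambda>t. \<integral>x. \<phi> t x * w x \<partial>torus X)
                 (\<lambda>t. \<integral>x. flow_rhs X \<epsilon> \<omega> Mt L (\<phi> t) x * w x \<partial>torus X))"
    using sol T(1) unfolding global_weak_solution_def by simp
  then have C2: "\<phi> \<in> C_Lp T 2 (torus X)" and C3: "\<phi> \<in> C_Lp T 3 (torus X)" and H2: "\<phi> \<in> L2_Hk T 2 X"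
    and dist: "\<And>w. w \<in> Lp_space 2 (torus X) \<Longrightarrow> distributional_deriv T (\<lambda>t. \<integral>x. \<phi> t x * w x \<partial>torus X)
                 (\<lambda>t. \<integral>x. flow_rhs X \<epsilon> \<omega> Mt L (\<phi> t) x * w x \<partial>torus X)" by simp_all
  have \<phi>i: "integrable (torus X) (\<phi> r)" if "r \<in> {0..T}" for r by (rule C_Lp_two_integrable[OF C2 that])
  then have \<phi>m: "\<phi> r \<in> borel_measurable (torus X)" if "r \<in> {0..T}" for r using that by auto
  have hpm: "(\<lambda>x. h (\<phi> r x)) \<in> borel_measurable (torus X)" if "r \<in> {0..T}" for r
    by (rule measurable_compose[OF \<phi>m[OF that] hm])
  have hpL: "(\<lambda>x. h (\<phi> r x)) \<in> Lp_space 2 (torus X)" if "r \<in> {0..T}" for r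
  proof -
    have "integrable (torus X) (\<lambda>x. (h (\<phi> r x))\<^sup>2)"
      by (rule integrable_torus_bounded[where B=1]) (use hpm[OF that] h(2) in \<open>auto simp: abs_square_le_1\<close>)
    then show ?thesis using hpm[OF that] by (simp add: Lp_space_def abs_powr_two)
  qed
  have Hi: "integrable (torus X) (\<lambda>x. H (\<phi> r x))" if "r \<in> {0..T}" for r
    by (rule integrable_torus_lipschitz[OF subgradient_imp_lipschitz[OF h(2) H] Hm \<phi>i[OF that]])
  define K where "K \<tau> r = (\<integral>x. ?R \<tau> x * h (\<phi> r x) \<partial>torus X)" for \<tau> r
  have contG: "continuous_on {0..T} (\<lambda>\<tau>. \<integral>x. \<phi> \<tau> x * h (\<phi> r x) \<partial>torus X)" if r: "r \<in> {0..T}" for r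
    unfolding continuous_on_sequentially
  proof (intro allI ballI impI, elim conjE)
    fix a \<tau> assume a: "\<tau> \<in> {0..T}" "\<forall>n. a n \<in> {0..T}" "a \<longlonglongrightarrow> \<tau>"
    have lim0: "(\<lambda>n. \<integral>x. \<bar>\<phi> (a n) x - \<phi> \<tau> x\<bar> \<partial>torus X) \<longlonglongrightarrow> 0"
      by (rule C_Lp_two_seq_L1[OF C2]) (use a in auto)
    have bd: "\<bar>(\<integral>x. \<phi> (a n) x * h (\<phi> r x) \<partial>torus X) - (\<integral>x. \<phi> \<tau> x * h (\<phi> r x) \<partial>torus X)\<bar>
        \<le> (\<integral>x. \<bar>\<phi> (a n) x - \<phi> \<tau> x\<bar> \<partial>torus X)" for n
    proof -
      have i: "integrable (torus X) (\<lambda>x. \<phi> q x * h (\<phi> r x))" if "q \<in> {0..T}" for q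
        by (rule integrable_times_bounded[OF \<phi>i[OF that] hpm[OF r], where B=1]) (simp add: h)
      have an: "a n \<in> {0..T}" using a by simp
      have "(\<integral>x. \<phi> (a n) x * h (\<phi> r x) \<partial>torus X) - (\<integral>x. \<phi> \<tau> x * h (\<phi> r x) \<partial>torus X)
        = (\<integral>x. \<phi> (a n) x * h (\<phi> r x) - \<phi> \<tau> x * h (\<phi> r x) \<partial>torus X)"
        by (rule Bochner_Integration.integral_diff[symmetric, OF i[OF an] i[OF a(1)]])
      moreover have "\<bar>\<integral>x. \<phi> (a n) x * h (\<phi> r x) - \<phi> \<tau> x * h (\<phi> r x) \<partial>torus X\<bar>
        \<le> (\<integral>x. \<bar>\<phi> (a n) x * h (\<phi> r x) - \<phi> \<tau> x * h (\<phi> r x)\<bar> \<partial>torus X)" by (rule integral_abs_bound)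
      moreover have "(\<integral>x. \<bar>\<phi> (a n) x * h (\<phi> r x) - \<phi> \<tau> x * h (\<phi> r x)\<bar> \<partial>torus X) \<le> (\<integral>x. \<bar>\<phi> (a n) x - \<phi> \<tau> x\<bar> \<partial>torus X)"
      proof (rule integral_mono)
        show "integrable (torus X) (\<lambda>x. \<bar>\<phi> (a n) x * h (\<phi> r x) - \<phi> \<tau> x * h (\<phi> r x)\<bar>)"
          by (intro integrable_abs Bochner_Integration.integrable_diff i an a(1))
        show "integrable (torus X) (\<lambda>x. \<bar>\<phi> (a n) x - \<phi> \<tau> x\<bar>)"
          by (intro integrable_abs Bochner_Integration.integrable_diff \<phi>i an a(1))
        fix x
        have "\<bar>\<phi> (a n) x - \<phi> \<tau> x\<bar> * \<bar>h (\<phi> r x)\<bar> \<le> \<bar>\<phi> (a n) x - \<phi> \<tau> x\<bar> * 1"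
          by (intro mult_left_mono h) simp
        then show "\<bar>\<phi> (a n) x * h (\<phi> r x) - \<phi> \<tau> x * h (\<phi> r x)\<bar> \<le> \<bar>\<phi> (a n) x - \<phi> \<tau> x\<bar>"
          by (simp add: left_diff_distrib[symmetric] abs_mult)
      qed
      ultimately show ?thesis by linarith
    qed
    show "((\<lambda>\<tau>. \<integral>x. \<phi> \<tau> x * h (\<phi> r x) \<partial>torus X) \<circ> a) \<longlonglongrightarrow> (\<integral>x. \<phi> \<tau> x * h (\<phi> r x) \<partial>torus X)"
      unfolding o_def
      by (rule LIM_zero_cancel, rule Lim_null_comparison[OF always_eventually lim0]) (use bd in simp)
  qed
  have incr: "set_integrable lebesgue {a<..b} (\<lambda>\<tau>. K \<tau> r)"
      "(\<integral>\<tau>\<in>{a<..b}. K \<tau> r \<partial>lebesgue) = (\<integral>x. \<phi> b x * h (\<phi> r x) \<partial>torus X) - (\<integral>x. \<phi> a x * h (\<phi> r x) \<partial>torus X)"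
    if "s \<le> a" "a < b" "b \<le> t" "r \<in> {0..T}" for a b r
    using distributional_deriv_increment[OF dist[OF hpL[OF that(4)]] contG[OF that(4)], of a b] that st T
    unfolding K_def by simp_all
  from flow_rhs_L1_bound[OF X eps omega L, of Mt] obtain A B C where
    "\<forall>u. u \<in> Hk_space 2 X \<longrightarrow> u \<in> Lp_space 3 (torus X) \<longrightarrow>
      integrable (torus X) (flow_rhs X \<epsilon> \<omega> Mt L u) \<and>
      (\<integral>x. \<bar>flow_rhs X \<epsilon> \<omega> Mt L u x\<bar> \<partial>torus X) \<le> A + B * (Hk_norm 2 X u)\<^sup>2 + C * (\<integral>x. \<bar>u x\<bar> ^ 3 \<partial>torus X)"
    by (elim exE)
  note ABC = this[rule_format]
  from C_Lp_three_bounded[OF C3] obtain M3 where "\<forall>r\<in>{0..T}. (\<integral>x. \<bar>\<phi> r x\<bar> ^ 3 \<partial>torus X) \<le> M3"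
    by (elim exE)
  note M3 = this[rule_format]
  define g where "g \<tau> = indicator {0<..<T} \<tau> * (A + B * (Hk_norm 2 X (\<phi> \<tau>))\<^sup>2 + \<bar>C\<bar> * M3)" for \<tau>
  have gi: "integrable lebesgue g"
  proof -
    have "integrable (lebesgue_on {0<..<T}) (\<lambda>\<tau>. (Hk_norm 2 X (\<phi> \<tau>))\<^sup>2)" using H2 by (simp add: L2_Hk_def)
    moreover have "integrable (lebesgue_on {0<..<T}) (\<lambda>\<tau>. A + \<bar>C\<bar> * M3)"
      by (rule integrable_lebesgue_on_Ioo_continuous) simp
    ultimately have "integrable (lebesgue_on {0<..<T}) (\<lambda>\<tau>. (A + \<bar>C\<bar> * M3) + B * (Hk_norm 2 X (\<phi> \<tau>))\<^sup>2)"
      by (rule Bochner_Integration.integrable_add[rotated, OF integrable_mult_right])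
    then show ?thesis
      unfolding g_def by (simp add: integrable_restrict_space add_ac)
  qed
  have good: "AE \<tau> in lebesgue. \<tau> \<in> {0<..<T} \<longrightarrow> \<phi> \<tau> \<in> Hk_space 2 X"
    using H2 by (simp add: L2_Hk_def bochner_measurable_def AE_restrict_space_iff)
  have RI: "integrable (torus X) (?R \<tau>)"
      "(\<integral>x. \<bar>?R \<tau> x\<bar> \<partial>torus X) \<le> g \<tau>"
    if "\<tau> \<in> {0<..<T}" "\<phi> \<tau> \<in> Hk_space 2 X" for \<tau>
  proof -
    have \<tau>: "\<tau> \<in> {0..T}" using that by auto
    then have "\<phi> \<tau> \<in> Lp_space 3 (torus X)" using C3 by (simp add: C_Lp_def)
    note R = ABC[OF that(2) this]
    then show "integrable (torus X) (?R \<tau>)" by simp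
    have "C * (\<integral>x. \<bar>\<phi> \<tau> x\<bar> ^ 3 \<partial>torus X) \<le> \<bar>C\<bar> * M3"
      using M3[OF \<tau>] by (intro mult_mono) auto
    then show "(\<integral>x. \<bar>?R \<tau> x\<bar> \<partial>torus X) \<le> g \<tau>"
      using R that(1) by (simp add: g_def)
  qed
  show ?thesis
  proof (rule nonincreasing_by_partition[OF st(2), where K=K and g=g and E="\<lambda>r. \<integral>x. H (\<phi> r x) \<partial>torus X"])
    show "set_integrable lebesgue {a<..b} (\<lambda>\<tau>. K \<tau> b)" if "s \<le> a" "a < b" "b \<le> t" for a b
      by (rule incr(1)[OF that]) (use that st T in auto)
    show "(\<integral>x. H (\<phi> b x) \<partial>torus X) - (\<integral>x. H (\<phi> a x) \<partial>torus X) \<le> (\<integral>\<tau>\<in>{a<..b}. K \<tau> b \<partial>lebesgue)"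
      if ab: "s \<le> a" "a < b" "b \<le> t" for a b
    proof -
      have a: "a \<in> {0..T}" and b: "b \<in> {0..T}" using ab st T by auto
      have i: "integrable (torus X) (\<lambda>x. \<phi> q x * h (\<phi> b x))" if "q \<in> {0..T}" for q
        by (rule integrable_times_bounded[OF \<phi>i[OF that] hpm[OF b], where B=1]) (simp add: h)
      have e1: "(\<integral>x. H (\<phi> b x) \<partial>torus X) - (\<integral>x. H (\<phi> a x) \<partial>torus X) = (\<integral>x. H (\<phi> b x) - H (\<phi> a x) \<partial>torus X)"
        by (rule Bochner_Integration.integral_diff[symmetric, OF Hi[OF b] Hi[OF a]])
      have e2: "(\<integral>x. H (\<phi> b x) - H (\<phi> a x) \<partial>torus X) \<le> (\<integral>x. \<phi> b x * h (\<phi> b x) - \<phi> a x * h (\<phi> b x) \<partial>torus X)"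
      proof (rule integral_mono)
        show "integrable (torus X) (\<lambda>x. H (\<phi> b x) - H (\<phi> a x))"
          by (rule Bochner_Integration.integrable_diff[OF Hi[OF b] Hi[OF a]])
        show "integrable (torus X) (\<lambda>x. \<phi> b x * h (\<phi> b x) - \<phi> a x * h (\<phi> b x))"
          by (rule Bochner_Integration.integrable_diff[OF i[OF b] i[OF a]])
        show "H (\<phi> b x) - H (\<phi> a x) \<le> \<phi> b x * h (\<phi> b x) - \<phi> a x * h (\<phi> b x)" for x
          using H[of "\<phi> b x" "\<phi> a x"] by (simp add: algebra_simps)
      qed
      have e3: "(\<integral>x. \<phi> b x * h (\<phi> b x) - \<phi> a x * h (\<phi> b x) \<partial>torus X) = (\<integral>x. \<phi> b x * h (\<phi> b x) \<partial>torus X) - (\<integral>x. \<phi> a x * h (\<phi> b x) \<partial>torus X)"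
        by (rule Bochner_Integration.integral_diff[OF i[OF b] i[OF a]])
      show ?thesis using e1 e2 e3 incr(2)[OF ab b] by linarith
    qed
    show "integrable lebesgue g" by (rule gi)
    show "AE \<tau> in lebesgue. \<tau> \<in> {s<..t} \<longrightarrow> (\<forall>r\<in>{s..t}. \<bar>K \<tau> r\<bar> \<le> g \<tau>)"
      using good
    proof eventually_elim
      case (elim \<tau>)
      show ?case
      proof (intro impI ballI)
        fix r assume \<tau>: "\<tau> \<in> {s<..t}" and r: "r \<in> {s..t}"
        have \<tau>T: "\<tau> \<in> {0<..<T}" and rT: "r \<in> {0..T}" using \<tau> r st T by auto
        have u: "\<phi> \<tau> \<in> Hk_space 2 X" using elim \<tau>T by simp
        note R = RI[OF \<tau>T u]
        have "\<bar>K \<tau> r\<bar> \<le> (\<integral>x. \<bar>?R \<tau> x * h (\<phi> r x)\<bar> \<partial>torus X)"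
          unfolding K_def by (rule integral_abs_bound)
        also have "\<dots> \<le> (\<integral>x. \<bar>?R \<tau> x\<bar> \<partial>torus X)"
        proof (rule integral_mono)
          show "integrable (torus X) (\<lambda>x. \<bar>?R \<tau> x * h (\<phi> r x)\<bar>)"
            by (intro integrable_abs integrable_times_bounded[OF R(1) hpm[OF rT], where B=1]) (simp add: h)
          show "integrable (torus X) (\<lambda>x. \<bar>?R \<tau> x\<bar>)" using R(1) by (rule integrable_abs)
          show "\<bar>?R \<tau> x * h (\<phi> r x)\<bar> \<le> \<bar>?R \<tau> x\<bar>" for x
            using h(2) by (simp add: abs_mult mult_left_le)
        qed
        also have "\<dots> \<le> g \<tau>" by (rule R(2))
        finally show "\<bar>K \<tau> r\<bar> \<le> g \<tau>" .
      qed
    qed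
    show "AE \<tau> in lebesgue. \<tau> \<in> {s<..t} \<longrightarrow>
      (\<forall>r. (\<forall>n. \<tau> \<le> r n \<and> r n \<le> t) \<longrightarrow> r \<longlonglongrightarrow> \<tau> \<longrightarrow> (\<lambda>n::nat. max (K \<tau> (r n)) 0) \<longlonglongrightarrow> 0)"
      using good
    proof eventually_elim
      case (elim \<tau>)
      show ?case
      proof (intro impI allI)
        fix r :: "nat \<Rightarrow> real"
        assume \<tau>: "\<tau> \<in> {s<..t}" and r: "\<forall>n. \<tau> \<le> r n \<and> r n \<le> t" "r \<longlonglongrightarrow> \<tau>"
        have \<tau>T: "\<tau> \<in> {0<..<T}" and \<tau>T': "\<tau> \<in> {0..T}" using \<tau> st T by auto
        have rT: "r n \<in> {0..T}" for n using r(1)[rule_format, of n] \<tau>T T by auto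
        have u: "\<phi> \<tau> \<in> Hk_space 2 X" using elim \<tau>T by simp
        note R = RI(1)[OF \<tau>T u]
        have neg: "K \<tau> \<tau> \<le> 0"
          unfolding K_def by (rule flow_rhs_dissipation[OF X eps u R h(1) hm h(2) h0 hW])
        let ?e = "\<lambda>n x. h (\<phi> (r n) x) - h (\<phi> \<tau> x)"
        have em: "?e n \<in> borel_measurable (torus X)" for n using hpm[OF rT] hpm[OF \<tau>T'] by auto
        have e2: "\<bar>?e n x\<bar> \<le> 2" for n x using h(2)[of "\<phi> (r n) x"] h(2)[of "\<phi> \<tau> x"] by linarith
        have ei: "integrable (torus X) (?e n)" for n
          by (rule integrable_torus_bounded[OF em, where B=2]) (simp add: e2)
        have "(\<lambda>n. \<integral>x. ?R \<tau> x * ?e n x \<partial>torus X) \<longlonglongrightarrow> 0"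
        proof (rule L1_null_times_integrable[OF R ei, where B=2])
          show "AE x in torus X. \<bar>?e n x\<bar> \<le> 2" for n by (simp add: e2)
          have l: "(\<lambda>n. \<integral>x. \<bar>\<phi> (r n) x - \<phi> \<tau> x\<bar> \<partial>torus X) \<longlonglongrightarrow> 0"
            by (rule C_Lp_two_seq_L1[OF C2 rT r(2) \<tau>T'])
          have "(\<integral>x. \<bar>?e n x\<bar> \<partial>torus X) \<le> (\<integral>x. \<bar>\<phi> (r n) x - \<phi> \<tau> x\<bar> \<partial>torus X)" for n
          proof (rule integral_mono)
            show "integrable (torus X) (\<lambda>x. \<bar>?e n x\<bar>)" by (rule integrable_abs[OF ei])
            show "integrable (torus X) (\<lambda>x. \<bar>\<phi> (r n) x - \<phi> \<tau> x\<bar>)"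
              by (intro integrable_abs Bochner_Integration.integrable_diff \<phi>i rT \<tau>T')
            show "\<bar>?e n x\<bar> \<le> \<bar>\<phi> (r n) x - \<phi> \<tau> x\<bar>" for x by (rule hlip)
          qed
          then show "(\<lambda>n. \<integral>x. \<bar>?e n x\<bar> \<partial>torus X) \<longlonglongrightarrow> 0"
            by (intro Lim_null_comparison[OF always_eventually l] allI) simp
        qed
        moreover have "(\<integral>x. ?R \<tau> x * ?e n x \<partial>torus X) = K \<tau> (r n) - K \<tau> \<tau>" for n
          unfolding right_diff_distrib K_def
          by (intro Bochner_Integration.integral_diff integrable_times_bounded[OF R hpm, where B=1] rT \<tau>T') (simp_all add: h)
        ultimately have "(\<lambda>n. K \<tau> (r n)) \<longlonglongrightarrow> K \<tau> \<tau>" by (simp add: LIM_zero_iff)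
        then have "(\<lambda>n. max (K \<tau> (r n)) 0) \<longlonglongrightarrow> max (K \<tau> \<tau>) 0" by (intro tendsto_max tendsto_const)
        then show "(\<lambda>n. max (K \<tau> (r n)) 0) \<longlonglongrightarrow> 0" using neg by (simp add: max_absorb2)
      qed
    qed
  qed
qed

section \<open>The two energies and the maximum principle\<close>

lemma energy_le_initial:
  fixes X :: "real^'d" and h H :: "real \<Rightarrow> real"
  assumes X: "\<And>i. X $ i > 0" and eps: "\<epsilon> > 0" and omega: "0 < \<omega>" "\<omega> < 1"
    and L: "Linf_bounded_linear (torus X) L"
    and sol: "global_weak_solution X \<epsilon> \<omega> Mt L \<phi>0 \<phi>"
    and h: "mono h" "\<And>s. \<bar>h s\<bar> \<le> 1" and hlip: "\<And>a b. \<bar>h a - h b\<bar> \<le> \<bar>a - b\<bar>"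
    and h0: "\<And>s. 0 \<le> s \<Longrightarrow> s \<le> 1 \<Longrightarrow> h s = 0" and hW: "\<And>s. 0 \<le> deriv W_pot s * h s"
    and H: "\<And>a b. H a - H b \<le> h a * (a - b)" and Hm: "H \<in> borel_measurable borel"
    and t: "0 < t"
  shows "integrable (torus X) (\<lambda>x. H (\<phi> t x))" and "(\<integral>x. H (\<phi> t x) \<partial>torus X) \<le> (\<integral>x. H (\<phi> 0 x) \<partial>torus X)"
proof -
  have C2: "\<phi> \<in> C_Lp t 2 (torus X)" using sol t by (simp add: global_weak_solution_def)
  have \<phi>i: "integrable (torus X) (\<phi> r)" if "r \<in> {0..t}" for r by (rule C_Lp_two_integrable[OF C2 that])
  note Hdiff = subgradient_imp_lipschitz[OF h(2) H]
  have Hi: "integrable (torus X) (\<lambda>x. H (\<phi> r x))" if "r \<in> {0..t}" for r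
    by (rule integrable_torus_lipschitz[OF Hdiff Hm \<phi>i[OF that]])
  show "integrable (torus X) (\<lambda>x. H (\<phi> t x))" using Hi t by simp
  define r where "r n = t * inverse (real (Suc (Suc n)))" for n
  have inv: "0 < inverse (real (Suc (Suc n)))" "inverse (real (Suc (Suc n))) < 1" for n
    by (simp_all add: inverse_less_1_iff)
  have r: "0 < r n" "r n < t" for n
    using t inv[of n] mult_strict_left_mono[OF inv(2) t, of n] by (simp_all add: r_def)
  have rT: "r n \<in> {0..t}" for n using r[of n] by simp
  have r0: "r \<longlonglongrightarrow> 0"
    using tendsto_mult_left[OF LIMSEQ_Suc[OF LIMSEQ_inverse_real_of_nat], of t] by (simp add: r_def[abs_def])
  have lim: "(\<lambda>n. (\<integral>x. H (\<phi> 0 x) \<partial>torus X) + (\<integral>x. \<bar>\<phi> (r n) x - \<phi> 0 x\<bar> \<partial>torus X)) \<longlonglongrightarrow> (\<integral>x. H (\<phi> 0 x) \<partial>torus X) + 0"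
    by (intro tendsto_intros C_Lp_two_seq_L1[OF C2 rT r0]) (use t in simp)
  have le: "(\<integral>x. H (\<phi> t x) \<partial>torus X) \<le> (\<integral>x. H (\<phi> 0 x) \<partial>torus X) + (\<integral>x. \<bar>\<phi> (r n) x - \<phi> 0 x\<bar> \<partial>torus X)" for n
  proof -
    have 0: "0 \<in> {0..t}" using t by simp
    have a: "integrable (torus X) (\<lambda>x. \<bar>\<phi> (r n) x - \<phi> 0 x\<bar>)"
      by (intro integrable_abs Bochner_Integration.integrable_diff \<phi>i rT 0)
    have "(\<integral>x. H (\<phi> t x) \<partial>torus X) \<le> (\<integral>x. H (\<phi> (r n) x) \<partial>torus X)"
      by (rule energy_nonincreasing[OF X eps omega L sol h hlip h0 hW H Hm r])
    moreover have "(\<integral>x. H (\<phi> (r n) x) \<partial>torus X) \<le> (\<integral>x. H (\<phi> 0 x) + \<bar>\<phi> (r n) x - \<phi> 0 x\<bar> \<partial>torus X)"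
    proof (rule integral_mono[OF Hi[OF rT] Bochner_Integration.integrable_add[OF Hi[OF 0] a]])
      show "H (\<phi> (r n) x) \<le> H (\<phi> 0 x) + \<bar>\<phi> (r n) x - \<phi> 0 x\<bar>" for x
        using Hdiff[of "\<phi> (r n) x" "\<phi> 0 x"] by linarith
    qed
    moreover have "(\<integral>x. H (\<phi> 0 x) + \<bar>\<phi> (r n) x - \<phi> 0 x\<bar> \<partial>torus X) = (\<integral>x. H (\<phi> 0 x) \<partial>torus X) + (\<integral>x. \<bar>\<phi> (r n) x - \<phi> 0 x\<bar> \<partial>torus X)"
      by (rule Bochner_Integration.integral_add[OF Hi[OF 0] a])
    ultimately show ?thesis by linarith
  qed
  from LIMSEQ_le_const[OF lim, of "\<integral>x. H (\<phi> t x) \<partial>torus X"] le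
  show "(\<integral>x. H (\<phi> t x) \<partial>torus X) \<le> (\<integral>x. H (\<phi> 0 x) \<partial>torus X)" by simp
qed

text \<open>The derivative \<open>h\<close> of the energy density \<open>upper_energy\<close>: the excess over \<open>1\<close>, truncated at \<open>1\<close>
  in order to be bounded.\<close>

definition upper_excess :: "real \<Rightarrow> real" where
  "upper_excess s = max 0 (min 1 (s - 1))"

text \<open>The antiderivative of \<open>upper_excess\<close> (a Huber function of \<open>s - 1\<close> for \<open>s \<ge> 1\<close>, zero below),
  written as the Legendre transform of \<open>y\<^sup>2 / 2\<close> on \<open>[0,1]\<close> at \<open>s - 1\<close>; convexity is then
  immediate.\<close>

definition upper_energy :: "real \<Rightarrow> real" where
  "upper_energy s = upper_excess s * (s - 1) - (upper_excess s)\<^sup>2 / 2"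

lemma upper_excess_range: "0 \<le> upper_excess s" "upper_excess s \<le> 1"
  by (auto simp: upper_excess_def)

text \<open>The supremum defining the Legendre transform is attained at \<open>y = upper_excess b\<close>.\<close>

lemma upper_energy_legendre:
  assumes "0 \<le> y" "y \<le> 1" shows "y * (b - 1) - y\<^sup>2 / 2 \<le> upper_energy b"
proof -
  define c where "c = upper_excess b"
  have "0 \<le> (c - y) * ((b - 1) - (c + y) / 2)"
  proof -
    consider "b \<le> 1" | "1 < b" "b < 2" | "2 \<le> b" by linarith
    then show ?thesis
    proof cases
      case 1
      then have "c = 0" by (simp add: c_def upper_excess_def)
      then show ?thesis using 1 assms by (intro mult_nonpos_nonpos) auto
    next
      case 2
      then have b: "b - 1 = c" by (simp add: c_def upper_excess_def)
      have "c - (c + y) / 2 = (c - y) / 2" by (simp add: field_simps)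
      then have "(c - y) * ((b - 1) - (c + y) / 2) = (c - y)\<^sup>2 / 2"
        by (simp only: b power2_eq_square times_divide_eq_right)
      then show ?thesis by (simp only:) simp
    next
      case 3
      then have "c = 1" by (simp add: c_def upper_excess_def)
      then show ?thesis using 3 assms by (intro mult_nonneg_nonneg) auto
    qed
  qed
  also have "(c - y) * ((b - 1) - (c + y) / 2) = (c * (b - 1) - c\<^sup>2 / 2) - (y * (b - 1) - y\<^sup>2 / 2)"
    by (simp add: field_simps power2_eq_square)
  finally show ?thesis by (simp add: upper_energy_def c_def)
qed

lemma upper_energy_convex: "upper_energy a - upper_energy b \<le> upper_excess a * (a - b)"
  using upper_energy_legendre[OF upper_excess_range, of a b]
  by (simp add: upper_energy_def[of a] algebra_simps)

lemma upper_energy_nonneg: "0 \<le> upper_energy s"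
  using upper_energy_legendre[of 0 s] by simp

lemma upper_energy_eq_0_iff: "upper_energy s = 0 \<longleftrightarrow> s \<le> 1"
proof
  assume z: "upper_energy s = 0"
  show "s \<le> 1"
  proof (rule ccontr)
    assume "\<not> s \<le> 1"
    define y where "y = min 1 (s - 1)"
    have y: "0 < y" "y \<le> 1" "y \<le> s - 1" using \<open>\<not> s \<le> 1\<close> by (auto simp: y_def)
    have "y * y \<le> y * (s - 1)" using y by (intro mult_left_mono) auto
    moreover have "0 < y * y" using y by simp
    ultimately show False using upper_energy_legendre[of y s] y z by (simp add: power2_eq_square)
  qed
next
  assume "s \<le> 1" then show "upper_energy s = 0" by (simp add: upper_energy_def upper_excess_def)
qed

lemma upper_excess_lipschitz: "\<bar>upper_excess a - upper_excess b\<bar> \<le> \<bar>a - b\<bar>"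
  by (auto simp: upper_excess_def)

lemma mono_upper_excess: "mono upper_excess"
  by (rule monoI) (auto simp: upper_excess_def)

lemma measurable_upper_energy: "upper_energy \<in> borel_measurable borel"
  unfolding upper_energy_def[abs_def] upper_excess_def[abs_def] by measurable

lemma deriv_W_pot_upper_excess: "0 \<le> deriv W_pot s * upper_excess s"
proof (cases "s \<le> 1")
  case False
  then have "0 \<le> s * (s - 1)" "0 \<le> 2 * s - 1" by (auto intro: mult_nonneg_nonneg)
  moreover have "s\<^sup>2 - s = s * (s - 1)" by (simp add: power2_eq_square algebra_simps)
  ultimately show ?thesis using upper_excess_range(1)[of s]
    unfolding deriv_W_pot by (intro mult_nonneg_nonneg) simp_all
qed (simp add: upper_excess_def)

lemma deriv_W_pot_reflect: "deriv W_pot (1 - s) = - deriv W_pot s"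
  by (simp add: deriv_W_pot algebra_simps power2_eq_square)

lemma AE_of_zero_energy:
  assumes "integrable M (\<lambda>x. H (u x))" "(\<integral>x. H (u x) \<partial>M) \<le> (\<integral>x. H (v x) \<partial>M)" "AE x in M. H (v x) = 0"
    and nn: "\<And>s. 0 \<le> H s"
  shows "AE x in M. H (u x) = (0::real)"
proof -
  have "(\<integral>x. H (v x) \<partial>M) = 0" by (rule integral_eq_zero_AE[OF assms(3)])
  moreover have "0 \<le> (\<integral>x. H (u x) \<partial>M)" using nn by simp
  ultimately have "(\<integral>x. H (u x) \<partial>M) = 0" using assms(2) by linarith
  then show ?thesis using integral_nonneg_eq_0_iff_AE[OF assms(1)] nn by simp
qed

theorem theorem5p1:
  fixes X :: "real^'d"
    and \<epsilon> M \<omega> Mt :: real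
    and volume_constraint :: bool
    and L :: "(real^'d \<Rightarrow> real) \<Rightarrow> (real^'d \<Rightarrow> real)"
    and \<phi>0 :: "real^'d \<Rightarrow> real"
    and \<phi> :: "real \<Rightarrow> real^'d \<Rightarrow> real"
  assumes dim: "CARD('d) = 2 \<or> CARD('d) = 3"
    and X: "\<And>i. X $ i > 0"
    and eps: "\<epsilon> > 0"
    and M: "M > 0"
    and omega: "0 < \<omega>" "\<omega> < 1"
    and Mt: "Mt = (if volume_constraint then M else 0)"
    and L: "Linf_bounded_linear (torus X) L"
    and L_psd: "L2_pos_semidef (torus X) L"
    and sol: "global_weak_solution X \<epsilon> \<omega> Mt L \<phi>0 \<phi>"
    and small: "\<epsilon> * max \<omega> (1 - \<omega>) / 6 *
      (Linf_onorm (torus X) L + Mt * measure lebesgue (cbox (- X) X)) \<le> 1"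
    and init: "AE x in torus X. 0 \<le> \<phi>0 x \<and> \<phi>0 x \<le> 1"
  shows "\<forall>t>0. AE x in torus X. 0 \<le> \<phi> t x \<and> \<phi> t x \<le> 1"
proof (intro allI impI)
  fix t :: real assume t: "t > 0"
  have "AE x in torus X. \<phi> 0 x = \<phi>0 x" using sol by (simp add: global_weak_solution_def)
  with init have init0: "AE x in torus X. 0 \<le> \<phi> 0 x \<and> \<phi> 0 x \<le> 1" by eventually_elim simp
  let ?h = "upper_excess" and ?H = "upper_energy"
  \<comment> \<open>The reflection at \<open>1/2\<close> turns the upper bound into the lower bound.\<close>
  let ?h' = "\<lambda>s. - upper_excess (1 - s)" and ?H' = "\<lambda>s. upper_energy (1 - s)"
  have up: "AE x in torus X. ?H (\<phi> t x) = 0"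
  proof (rule AE_of_zero_energy[where v="\<phi> 0" and H="?H"])
    have "?h s = 0" if "s \<le> 1" for s using that by (simp add: upper_excess_def)
    then have *: "\<And>s. 0 \<le> s \<Longrightarrow> s \<le> 1 \<Longrightarrow> ?h s = 0" "\<And>s. \<bar>?h s\<bar> \<le> 1"
      using upper_excess_range by auto
    note E = energy_le_initial[OF X eps omega L sol mono_upper_excess *(2) upper_excess_lipschitz *(1)
        deriv_W_pot_upper_excess upper_energy_convex measurable_upper_energy t]
    show "integrable (torus X) (\<lambda>x. ?H (\<phi> t x))" by (rule E(1))
    show "(\<integral>x. ?H (\<phi> t x) \<partial>torus X) \<le> (\<integral>x. ?H (\<phi> 0 x) \<partial>torus X)" by (rule E(2))
    show "AE x in torus X. ?H (\<phi> 0 x) = 0" using init0 by eventually_elim (simp add: upper_energy_eq_0_iff)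
  qed (rule upper_energy_nonneg)
  have low: "AE x in torus X. ?H' (\<phi> t x) = 0"
  proof (rule AE_of_zero_energy[where v="\<phi> 0" and H="?H'"])
    have mono: "mono ?h'" using monoD[OF mono_upper_excess] by (intro monoI) simp
    have bound: "\<bar>?h' s\<bar> \<le> 1" for s using upper_excess_range[of "1 - s"] by simp
    have lip: "\<bar>?h' a - ?h' b\<bar> \<le> \<bar>a - b\<bar>" for a b using upper_excess_lipschitz[of "1 - a" "1 - b"] by simp
    have zero: "?h' s = 0" if "0 \<le> s" "s \<le> 1" for s using that by (simp add: upper_excess_def)
    have sgn: "0 \<le> deriv W_pot s * ?h' s" for s
      using deriv_W_pot_upper_excess[of "1 - s"] by (simp add: deriv_W_pot_reflect)
    have conv: "?H' a - ?H' b \<le> ?h' a * (a - b)" for a b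
      using upper_energy_convex[of "1 - a" "1 - b"] by (simp add: algebra_simps)
    have meas: "?H' \<in> borel_measurable borel"
      by (rule measurable_compose[OF _ measurable_upper_energy]) simp
    note E = energy_le_initial[OF X eps omega L sol mono bound lip zero sgn conv meas t]
    show "integrable (torus X) (\<lambda>x. ?H' (\<phi> t x))" by (rule E(1))
    show "(\<integral>x. ?H' (\<phi> t x) \<partial>torus X) \<le> (\<integral>x. ?H' (\<phi> 0 x) \<partial>torus X)" by (rule E(2))
    show "AE x in torus X. ?H' (\<phi> 0 x) = 0" using init0 by eventually_elim (simp add: upper_energy_eq_0_iff)
  qed (rule upper_energy_nonneg)
  show "AE x in torus X. 0 \<le> \<phi> t x \<and> \<phi> t x \<le> 1"
    using up low by eventually_elim (simp add: upper_energy_eq_0_iff)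
qed

end
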